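(* Let $\omega^{XBR}=\sum_xp(x)|x\rangle\langle x|^X\otimes|\psi_x\rangle\langle\psi_x|^{BR}$. In the unassisted model there exists a sequence of side information codes (see context) compressing $B^n$ at asymptotic qubit rate \[ R_B=\tfrac12\big(S(B)+S(B|X)\big), \] entropies being with respect to $\omega^{XBR}$.
   Context: $\mathcal X$ is a finite alphabet, $p$ a distribution, $|\psi_x\rangle\in B\otimes R$ finite-dimensional. Extended source: $\omega^{X^nX'^nB^nR^n}=\sum_{x^n}p(x^n)|x^n\rangle\langle x^n|^{X^n}\otimes|x^n\rangle\langle x^n|^{X'^n}\otimes\psi_{x^n}^{B^nR^n}$. An unassisted side information code of block length $n$: Bob applies a CPTP map $\mathcal E_B:B^n\to C$, and the decoder, who holds $X^n$, applies a CPTP map $\mathcal D:X^nC\to\hat X^n\hat B^n$; it has error $\epsilon$ if $F\big(\omega^{X^nX'^nB^nR^n},(\mathcal D\circ(\mathrm{id}_{X^n}\otimes\mathcal E_B)\otimes\mathrm{id}_{X'^nR^n})\omega^{X^nX'^nB^nR^n}\big)\ge1-\epsilon$, $F(\rho,\sigma)=\|\sqrt\rho\sqrt\sigma\|_1$. A sequence of codes achieves rate $R_B$ if the error tends to $0$ and $\frac1n\log|C|\to R_B$. *)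

theory Defs
  imports "Jordan_Normal_Form.Char_Poly" "HOL-Library.Multiset"
begin

(* All quantum objects are complex matrices / vectors (Jordan_Normal_Form).
   Composite systems A(x)B use the Kronecker convention: index (a,b) <-> a * dim B + b. *)

definition mtrace :: "complex mat \<Rightarrow> complex" where
  "mtrace A = (\<Sum>i<dim_row A. A $$ (i,i))"

definition adj :: "complex mat \<Rightarrow> complex mat" where
  "adj A = mat (dim_col A) (dim_row A) (\<lambda>(i,j). cnj (A $$ (j,i)))"

definition psd :: "complex mat \<Rightarrow> bool" where
  "psd A \<longleftrightarrow> A \<in> carrier_mat (dim_row A) (dim_row A) \<and>
     (\<forall>v. dim_vec v = dim_row A \<longrightarrow>
        (\<exists>r::real. r \<ge> 0 \<and>
          (\<Sum>i<dim_row A. \<Sum>j<dim_row A. cnj (v $ i) * A $$ (i,j) * v $ j) = complex_of_real r))"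

definition msqrt :: "complex mat \<Rightarrow> complex mat" where
  "msqrt A = (THE B. psd B \<and> B * B = A)"

definition trace_norm :: "complex mat \<Rightarrow> real" where
  "trace_norm A = Re (mtrace (msqrt (adj A * A)))"

definition fidelity :: "complex mat \<Rightarrow> complex mat \<Rightarrow> real" where
  "fidelity \<rho> \<sigma> = trace_norm (msqrt \<rho> * msqrt \<sigma>)"

definition kron :: "complex mat \<Rightarrow> complex mat \<Rightarrow> complex mat" where
  "kron A B = mat (dim_row A * dim_row B) (dim_col A * dim_col B)
     (\<lambda>(i,j). A $$ (i div dim_row B, j div dim_col B) * B $$ (i mod dim_row B, j mod dim_col B))"

definition ptrace_right :: "nat \<Rightarrow> nat \<Rightarrow> complex mat \<Rightarrow> complex mat" where
  "ptrace_right d1 d2 M = mat d1 d1 (\<lambda>(i,j). \<Sum>k<d2. M $$ (i*d2+k, j*d2+k))"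

definition ptrace_left :: "nat \<Rightarrow> nat \<Rightarrow> complex mat \<Rightarrow> complex mat" where
  "ptrace_left d1 d2 M = mat d2 d2 (\<lambda>(i,j). \<Sum>k<d1. M $$ (k*d2+i, k*d2+j))"

definition eigs :: "complex mat \<Rightarrow> complex multiset" where
  "eigs A = (THE M. char_poly A = prod_mset (image_mset (\<lambda>e. [:-e, 1:]) M))"

definition eta :: "real \<Rightarrow> real" where
  "eta x = (if x > 0 then x * log 2 x else 0)"

definition vn_entropy :: "complex mat \<Rightarrow> real" where
  "vn_entropy \<rho> = - sum_mset (image_mset (\<lambda>e. eta (Re e)) (eigs \<rho>))"

(* CPTP maps C^din -> C^dout, given by a Kraus decomposition *)
definition is_channel :: "nat \<Rightarrow> nat \<Rightarrow> complex mat list \<Rightarrow> bool" where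
  "is_channel din dout Ks \<longleftrightarrow> (\<forall>K\<in>set Ks. K \<in> carrier_mat dout din) \<and>
     foldr (\<lambda>K acc. adj K * K + acc) Ks (0\<^sub>m din din) = 1\<^sub>m din"

definition apply_channel :: "nat \<Rightarrow> complex mat list \<Rightarrow> complex mat \<Rightarrow> complex mat" where
  "apply_channel dout Ks \<rho> = foldr (\<lambda>K acc. K * \<rho> * adj K + acc) Ks (0\<^sub>m dout dout)"

definition outer :: "complex vec \<Rightarrow> complex vec \<Rightarrow> complex mat" where
  "outer v w = mat (dim_vec v) (dim_vec w) (\<lambda>(i,j). v $ i * cnj (w $ j))"

definition proj :: "nat \<Rightarrow> nat \<Rightarrow> complex mat" where
  "proj d x = mat d d (\<lambda>(i,j). if i = x \<and> j = x then 1 else 0)"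

definition msum :: "nat \<Rightarrow> ('i \<Rightarrow> complex mat) \<Rightarrow> 'i set \<Rightarrow> complex mat" where
  "msum d f S = mat d d (\<lambda>(i,j). \<Sum>x\<in>S. f x $$ (i,j))"

(* k-th digit in base d: encodes strings of length n over {0..<d} as numbers < d^n *)
definition digit :: "nat \<Rightarrow> nat \<Rightarrow> nat \<Rightarrow> nat" where
  "digit d i k = (i div d ^ k) mod d"

definition omega1 :: "nat \<Rightarrow> (nat \<Rightarrow> real) \<Rightarrow> (nat \<Rightarrow> complex vec) \<Rightarrow> nat \<Rightarrow> nat \<Rightarrow> complex mat" where
  "omega1 m p psi dB dR = msum (m*dB*dR)
     (\<lambda>x. complex_of_real (p x) \<cdot>\<^sub>m kron (proj m x) (outer (psi x) (psi x))) {..<m}"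

(* |psi_{x^n}> in B^n (x) R^n, B^n = B_1...B_n, R^n = R_1...R_n *)
definition psi_n :: "nat \<Rightarrow> (nat \<Rightarrow> complex vec) \<Rightarrow> nat \<Rightarrow> nat \<Rightarrow> nat \<Rightarrow> nat \<Rightarrow> complex vec" where
  "psi_n m psi dB dR n xi = vec (dB^n * dR^n) (\<lambda>idx.
     \<Prod>k<n. psi (digit m xi k) $ (digit dB (idx div dR^n) k * dR + digit dR (idx mod dR^n) k))"

definition p_n :: "nat \<Rightarrow> (nat \<Rightarrow> real) \<Rightarrow> nat \<Rightarrow> nat \<Rightarrow> real" where
  "p_n m p n xi = (\<Prod>k<n. p (digit m xi k))"

(* extended source omega^{X^n B^n R^n X'^n}; the tensor factors are ordered X^n, B^n, R^n, X'^n *)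
definition omega_ext :: "nat \<Rightarrow> (nat \<Rightarrow> real) \<Rightarrow> (nat \<Rightarrow> complex vec) \<Rightarrow> nat \<Rightarrow> nat \<Rightarrow> nat \<Rightarrow> complex mat" where
  "omega_ext m p psi dB dR n = msum (m^n * dB^n * dR^n * m^n)
     (\<lambda>xi. complex_of_real (p_n m p n xi) \<cdot>\<^sub>m
        kron (proj (m^n) xi) (kron (outer (psi_n m psi dB dR n xi) (psi_n m psi dB dR n xi)) (proj (m^n) xi)))
     {..<m^n}"

(* output state (D o (id_{X^n} (x) E_B) (x) id_{X'^n R^n}) omega, factors ordered Xhat^n, Bhat^n, R^n, X'^n *)
definition code_output :: "nat \<Rightarrow> (nat \<Rightarrow> real) \<Rightarrow> (nat \<Rightarrow> complex vec) \<Rightarrow> nat \<Rightarrow> nat \<Rightarrow> nat \<Rightarrow> nat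
     \<Rightarrow> complex mat list \<Rightarrow> complex mat list \<Rightarrow> complex mat" where
  "code_output m p psi dB dR n c Enc Dec =
     apply_channel (m^n * dB^n * dR^n * m^n) (map (\<lambda>D. kron D (1\<^sub>m (dR^n * m^n))) Dec)
       (apply_channel (m^n * c * dR^n * m^n) (map (\<lambda>K. kron (1\<^sub>m (m^n)) (kron K (1\<^sub>m (dR^n * m^n)))) Enc)
          (omega_ext m p psi dB dR n))"

end

theory Submission
  imports Defs "Jordan_Normal_Form.Spectral_Radius" "HOL-Real_Asymp.Real_Asymp"
begin

text \<open>Bob restricts to the typical subspace \<open>T\<close> of \<open>B\<^sup>n\<close> in the eigenbasis of the average state and applies
  a random sign matrix from \<open>T\<close> into \<open>C\<close> tensored with an environment of dimension \<open>E\<close>, turned into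
  an isometry by its polar part; the environment is discarded. If \<open>card T\<close> is small against
  \<open>E c\<close>, then the polar part changes the matrix only little on average. Given \<open>x\<^sup>n\<close>,
  the \<open>E * card J\<close> images of the conditionally typical eigenvectors \<open>J\<close> of the marginal of \<open>\<psi>\<close> at \<open>x\<^sup>n\<close>
  under the Kraus operators are nearly orthonormal as soon as \<open>E * card J\<close> is small against \<open>c\<close>, so the
  decoder, who knows \<open>x\<^sup>n\<close>, applies the square-root (pretty good) measurement of these vectors
  coherently and recovers the eigenvector. No decoupling or Uhlmann argument is needed:
  second moments of quadratic forms in random signs suffice.
  With \<open>card T\<close> about \<open>2\<^bsup>n S(B)\<^esup>\<close> and \<open>card J\<close> about \<open>2\<^bsup>n S(B|X)\<^esup>\<close>, both conditions hold for
  \<open>c\<close> slightly above \<open>2\<^bsup>n (S(B) + S(B|X)) / 2\<^esup>\<close> and \<open>E\<close> equal to \<open>2\<^bsup>n (S(B) - S(B|X)) / 2\<^esup>\<close>.\<close>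

section \<open>Adjoints, unitaries and the spectral theorem\<close>

text \<open>The source is entangled with \<open>R\<close>, so the decoder has to restore phases and
  not only the label of an eigenvector. What counts are the traces of \<open>D * K\<close> against
  the marginal at \<open>x\<close>, for all pairs of Kraus operators of decoder and encoder: the
  fidelity is a sum over \<open>x\<close> of roots of sums of their squares. Only pairs with the
  same environment index \<open>e\<close> are kept. Each of these traces should be close to 1 / sqrt
  E, so by Cauchy-Schwarz little is lost in passing to their sum. The two polar parts are not
  polynomial in the signs; the inequalities of \<open>is_polar_part\<close> replace them by
  expressions of degree at most four, whose mean can be bounded. Replacing Bob's sign matrix by its
  polar part costs little although he does not know \<open>x\<close>: the error is weighted by the
  average state, which is diagonal in the basis that defines \<open>T\<close>. The fidelity bound is
  averaged over \<open>x\<close> before the signs are fixed, so one sign pattern serves all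
  \<open>x\<close>. The block length enters only through the parameters of
  \<open>random_code\<close>.\<close>

lemma dim_adj[simp]: "dim_row (adj A) = dim_col A" "dim_col (adj A) = dim_row A"
  by (auto simp: adj_def)

lemma adj_carrier[simp]: "A \<in> carrier_mat a b \<Longrightarrow> adj A \<in> carrier_mat b a"
  by (auto simp: adj_def)

lemma index_adj[simp]: "i < dim_col A \<Longrightarrow> j < dim_row A \<Longrightarrow> adj A $$ (i,j) = cnj (A $$ (j,i))"
  by (auto simp: adj_def)

lemma mult_entry:
  "i < dim_row A \<Longrightarrow> j < dim_col B \<Longrightarrow> dim_col A = dim_row B \<Longrightarrow>
    (A * B) $$ (i,j) = (\<Sum>k<dim_row B. A $$ (i,k) * B $$ (k,j))"
  by (auto simp: scalar_prod_def atLeast0LessThan intro!: sum.cong)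

lemma mult_entry':
  "A \<in> carrier_mat a b \<Longrightarrow> B \<in> carrier_mat b c \<Longrightarrow> i < a \<Longrightarrow> j < c \<Longrightarrow>
    (A * B) $$ (i,j) = (\<Sum>k<b. A $$ (i,k) * B $$ (k,j))"
  by (subst mult_entry) auto

lemma adj_mult: "A \<in> carrier_mat a b \<Longrightarrow> B \<in> carrier_mat b c \<Longrightarrow> adj (A * B) = adj B * adj A"
  by (rule eq_matI) (auto simp: mult_entry' mult_entry ac_simps simp del: index_mult_mat(1))

lemma adj_adj[simp]: "adj (adj A) = A"
  by (rule eq_matI) auto

lemma adj_one[simp]: "adj (1\<^sub>m n) = 1\<^sub>m n"
  by (rule eq_matI) auto

lemma adj_minus: "A \<in> carrier_mat a b \<Longrightarrow> B \<in> carrier_mat a b \<Longrightarrow> adj (A - B) = adj A - adj B"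
  by (rule eq_matI) auto

abbreviation rdiag :: "nat \<Rightarrow> (nat \<Rightarrow> real) \<Rightarrow> complex mat" where
  "rdiag n f \<equiv> mat_diag n (\<lambda>i. complex_of_real (f i))"

lemma adj_mat_diag_real[simp]:
  "adj (rdiag n f) = rdiag n f"
  by (rule eq_matI) (auto simp: mat_diag_def)

definition unitary :: "nat \<Rightarrow> complex mat \<Rightarrow> bool" where
  "unitary n U \<longleftrightarrow> U \<in> carrier_mat n n \<and> adj U * U = 1\<^sub>m n"

lemma unitaryD:
  assumes "unitary n U"
  shows "U \<in> carrier_mat n n" "adj U \<in> carrier_mat n n" "adj U * U = 1\<^sub>m n" "U * adj U = 1\<^sub>m n"
  using assms mat_mult_left_right_inverse[of "adj U" n U] by (auto simp: unitary_def)

lemma unitary_mult: assumes "unitary n U" "unitary n V" shows "unitary n (U * V)"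
proof -
  note c = unitaryD[OF assms(1)] unitaryD[OF assms(2)]
  have "adj (U * V) * (U * V) = adj V * (adj U * (U * V))"
    using c by (simp add: adj_mult[of _ n n _ n] assoc_mult_mat[of _ n n _ n _ n] mult_carrier_mat[of _ n n _ n])
  also have "adj U * (U * V) = (adj U * U) * V"
    using c by (intro assoc_mult_mat[symmetric]) auto
  finally show ?thesis using c by (simp add: unitary_def)
qed

text \<open>The Householder reflection along \<open>v - e\<^sub>0\<close>; it maps \<open>e\<^sub>0\<close> to \<open>v\<close> because \<open>v 0\<close> is real.\<close>
lemma unitary_first_col:
  assumes v: "(\<Sum>i<n. (cmod (v i))\<^sup>2) = 1" and n: "n > 0" and v0: "v 0 = complex_of_real a"
  shows "\<exists>U. unitary n U \<and> (\<forall>i<n. U $$ (i,0) = v i)"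
proof -
  define w where "w i = v i - (if i = 0 then 1 else 0)" for i :: nat
  define N where "N = (\<Sum>i<n. (cmod (w i))\<^sup>2)"
  have split: "(\<Sum>i<n. f i) = f 0 + (\<Sum>i\<in>{..<n}-{0}. f i)" for f :: "nat \<Rightarrow> real"
    using n by (subst sum.remove[of _ 0]) auto
  have "N = (a - 1)\<^sup>2 + (\<Sum>i\<in>{..<n}-{0}. (cmod (v i))\<^sup>2)"
  proof -
    have "cmod (complex_of_real a - 1) = \<bar>a - 1\<bar>"
      by (metis norm_of_real of_real_1 of_real_diff)
    then show ?thesis unfolding N_def split by (auto simp: w_def v0 intro!: sum.cong)
  qed
  also have "(\<Sum>i\<in>{..<n}-{0}. (cmod (v i))\<^sup>2) = 1 - a\<^sup>2"
    using v unfolding split by (simp add: v0)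
  finally have N: "N = 2 - 2 * a" by (simp add: power2_eq_square algebra_simps)
  \<comment> \<open>If \<open>v\<close> is already the first basis vector, then \<open>w\<close> is
    zero and the reflection degenerates to the identity.\<close>
  define U where "U = mat n n (\<lambda>(i,j). (if i = j then 1 else 0) - (if N = 0 then 0 else complex_of_real (2/N)) * w i * cnj (w j))"
  have Uc: "U \<in> carrier_mat n n" by (auto simp: U_def)
  have adjU: "adj U = U"
    by (rule eq_matI) (auto simp: U_def)
  have Ncx: "complex_of_real N = (\<Sum>i<n. cnj (w i) * w i)"
    unfolding N_def of_real_sum by (intro sum.cong refl) (metis complex_norm_square mult.commute)
  have "U * U = 1\<^sub>m n"
  proof (rule eq_matI)
    fix i j assume ij: "i < dim_row (1\<^sub>m n :: complex mat)" "j < dim_col (1\<^sub>m n :: complex mat)"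
    define c where "c = (if N = 0 then 0 else complex_of_real (2/N))"
    have "(U * U) $$ (i,j) = (\<Sum>k<n. ((if i = k then 1 else 0) - c * w i * cnj (w k)) * ((if k = j then 1 else 0) - c * w k * cnj (w j)))"
      using ij by (subst mult_entry'[OF Uc Uc]) (auto simp: U_def c_def intro!: sum.cong)
    also have "\<dots> = (\<Sum>k<n. (if k = i then (if i = j then 1 else 0) else 0) - (if k = i then c * w i * cnj (w j) else 0)
        - (if k = j then c * w i * cnj (w j) else 0) + c * c * w i * cnj (w j) * (cnj (w k) * w k))"
      by (intro sum.cong) (auto simp: algebra_simps)
    also have "\<dots> = (if i = j then 1 else 0) - c * w i * cnj (w j) - c * w i * cnj (w j) + c * c * w i * cnj (w j) * N"
      using ij unfolding sum.distrib sum_subtractf sum_distrib_left[symmetric] Ncx[symmetric] by simp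
    also have "\<dots> = (if i = j then 1 else 0)"
      by (auto simp: c_def field_simps)
    finally show "(U * U) $$ (i,j) = (1\<^sub>m n :: complex mat) $$ (i,j)" using ij by auto
  qed (auto simp: U_def)
  moreover have "U $$ (i,0) = v i" if i: "i < n" for i
  proof (cases "N = 0")
    case True
    have "(cmod (w i))\<^sup>2 = 0"
      using True i unfolding N_def by (subst (asm) sum_nonneg_eq_0_iff) auto
    then show ?thesis using True i n by (auto simp: U_def w_def)
  next
    case False
    have "U $$ (i,0) = (if i = 0 then 1 else 0) - complex_of_real (2/N) * w i * cnj (w 0)"
      using i n False by (auto simp: U_def)
    also have "complex_of_real (2/N) * w i * cnj (w 0) = w i * complex_of_real (2/N * (a - 1))"
      by (simp add: w_def v0)
    also have "2/N * (a-1) = -1" using False N by (auto simp: field_simps)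
    finally show ?thesis by (simp add: w_def)
  qed
  ultimately show ?thesis using Uc adjU by (intro exI[of _ U]) (auto simp: unitary_def)
qed

text \<open>Deflation: an eigenvector exists because a complex matrix has nonempty spectrum, a
  unitary with this first column makes the matrix block diagonal, and induction treats the remaining
  block.\<close>

theorem hermitian_spectral:
  assumes "A \<in> carrier_mat n n" "adj A = A"
  shows "\<exists>U l. unitary n U \<and> A = U * rdiag n l * adj U"
  using assms
proof (induction n arbitrary: A)
  case 0
  then show ?case by (intro exI[of _ "1\<^sub>m 0"] exI[of _ "\<lambda>_. 0"]) (auto simp: unitary_def)
next
  case (Suc n)
  note A = Suc.prems(1) and hA = Suc.prems(2)
  from spectrum_non_empty[OF A] obtain ev where "eigenvalue A ev"
    by (auto simp: spectrum_def)
  then obtain v where v: "v \<in> carrier_vec (Suc n)" "v \<noteq> 0\<^sub>v (Suc n)" "A *\<^sub>v v = ev \<cdot>\<^sub>v v"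
    using A unfolding eigenvalue_def eigenvector_def by auto
  define N where "N = sqrt (\<Sum>i<Suc n. (cmod (v $ i))\<^sup>2)"
  have "(\<Sum>i<Suc n. (cmod (v $ i))\<^sup>2) \<noteq> 0"
  proof
    assume "(\<Sum>i<Suc n. (cmod (v $ i))\<^sup>2) = 0"
    then have "\<forall>i<Suc n. v $ i = 0" by (subst (asm) sum_nonneg_eq_0_iff) auto
    then show False using v by (auto intro!: eq_vecI)
  qed
  moreover have "(\<Sum>i<Suc n. (cmod (v $ i))\<^sup>2) \<ge> 0" by (intro sum_nonneg) auto
  ultimately have Npos: "N > 0" and N2: "N\<^sup>2 = (\<Sum>i<Suc n. (cmod (v $ i))\<^sup>2)"
    by (auto simp: N_def simp del: sum.lessThan_Suc)
  \<comment> \<open>The phase makes the first entry real, as \<open>unitary_first_col\<close>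
    requires.\<close>
  define ph where "ph = (if v $ 0 = 0 then 1 else cnj (v $ 0) / cmod (v $ 0))"
  have ph: "cmod ph = 1" by (auto simp: ph_def norm_divide)
  define u where "u i = ph * v $ i / N" for i
  have u1: "(\<Sum>i<Suc n. (cmod (u i))\<^sup>2) = 1"
    using Npos unfolding u_def norm_mult norm_divide ph
    by (simp add: power_divide sum_divide_distrib[symmetric] N2[symmetric] del: sum.lessThan_Suc)
  have u0: "u 0 = complex_of_real (cmod (v $ 0) / N)"
    by (auto simp: u_def ph_def complex_norm_square[symmetric] power2_eq_square)
       (metis complex_norm_square mult.commute nonzero_mult_div_cancel_right norm_eq_zero of_real_eq_0_iff of_real_power power2_eq_square)
  from unitary_first_col[OF u1 _ u0] obtain H where H: "unitary (Suc n) H" "\<forall>i<Suc n. H $$ (i,0) = u i"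
    by blast
  note Hc = unitaryD[OF H(1)]
  have Au: "(\<Sum>k<Suc n. A $$ (i,k) * u k) = ev * u i" if i: "i < Suc n" for i
  proof -
    have "(\<Sum>k<Suc n. A $$ (i,k) * v $ k) = ev * v $ i"
      using arg_cong[OF v(3), of "\<lambda>w. w $ i"] i A v(1)
      by (auto simp: scalar_prod_def atLeast0LessThan)
    then have "(\<Sum>k<Suc n. A $$ (i,k) * v $ k) * (ph / N) = ev * v $ i * (ph / N)" by simp
    then show ?thesis unfolding sum_distrib_right u_def by (simp add: field_simps)
  qed
  define B where "B = adj H * (A * H)"
  have B: "B \<in> carrier_mat (Suc n) (Suc n)" using A Hc by (auto simp: B_def)
  have hB: "adj B = B"
    unfolding B_def using A Hc hA
    by (simp add: adj_mult[of _ "Suc n" "Suc n" _ "Suc n"] assoc_mult_mat[of _ "Suc n" "Suc n" _ "Suc n" _ "Suc n"] mult_carrier_mat[of _ "Suc n" "Suc n" _ "Suc n"])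
  have col0: "B $$ (i,0) = (if i = 0 then ev else 0)" if i: "i < Suc n" for i
  proof -
    have AH: "(A * H) $$ (k,0) = ev * H $$ (k,0)" if "k < Suc n" for k
      using that A Hc H(2) Au by (subst mult_entry'[of _ "Suc n" "Suc n" _ "Suc n"]) (auto simp del: sum.lessThan_Suc)
    have "B $$ (i,0) = (\<Sum>k<Suc n. adj H $$ (i,k) * (ev * H $$ (k,0)))"
      unfolding B_def using i A Hc AH
      by (subst mult_entry'[of _ "Suc n" "Suc n" _ "Suc n"]) (auto simp del: sum.lessThan_Suc intro!: sum.cong)
    also have "\<dots> = ev * (adj H * H) $$ (i,0)"
      using i Hc(1,2) by (subst mult_entry'[of _ "Suc n" "Suc n" _ "Suc n"])
        (auto simp del: sum.lessThan_Suc simp: sum_distrib_left ac_simps)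
    finally show ?thesis using i Hc by auto
  qed
  \<comment> \<open>Hermiticity carries the zeros of the first column over to the first row, and it
    makes \<open>ev\<close> real.\<close>
  have row0: "B $$ (0,i) = (if i = 0 then cnj ev else 0)" if i: "i < Suc n" for i
    using arg_cong[OF hB, of "\<lambda>M. M $$ (0,i)"] i B col0[OF i] by auto
  have ev: "cnj ev = ev" using col0[of 0] row0[of 0] by auto
  define C where "C = mat n n (\<lambda>(i,j). B $$ (Suc i, Suc j))"
  have C: "C \<in> carrier_mat n n" by (auto simp: C_def)
  have hC: "adj C = C"
  proof (rule eq_matI)
    fix i j assume "i < dim_row C" "j < dim_col C"
    then show "adj C $$ (i,j) = C $$ (i,j)"
      using arg_cong[OF hB, of "\<lambda>M. M $$ (Suc i, Suc j)"] B by (auto simp: C_def)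
  qed (auto simp: C_def)
  from Suc.IH[OF C hC] obtain U l where U: "unitary n U" and CU: "C = U * rdiag n l * adj U"
    by blast
  note Uc = unitaryD[OF U]
  define L where "L i = (case i of 0 \<Rightarrow> Re ev | Suc j \<Rightarrow> l j)" for i
  define W where "W = four_block_mat (1\<^sub>m 1) (0\<^sub>m 1 n) (0\<^sub>m n 1) U"
  have W: "W \<in> carrier_mat (Suc n) (Suc n)"
    unfolding W_def using Uc(1) by (intro carrier_matI) auto
  have adjW: "adj W = four_block_mat (1\<^sub>m 1) (0\<^sub>m 1 n) (0\<^sub>m n 1) (adj U)"
    unfolding W_def using Uc by (intro eq_matI) (auto simp: index_mat_four_block)
  have BF: "B = four_block_mat (mat_diag 1 (\<lambda>i. complex_of_real (Re ev))) (0\<^sub>m 1 n) (0\<^sub>m n 1) C"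
    using B C ev by (intro eq_matI) (auto simp: index_mat_four_block col0 row0 C_def mat_diag_def complex_eq_iff)
  have DF: "mat_diag (Suc n) (\<lambda>i. complex_of_real (L i)) =
     four_block_mat (mat_diag 1 (\<lambda>i. complex_of_real (Re ev))) (0\<^sub>m 1 n) (0\<^sub>m n 1) (rdiag n l)"
    by (intro eq_matI) (auto simp: index_mat_four_block mat_diag_def L_def split: nat.splits)
  have blk: "four_block_mat X (0\<^sub>m 1 n) (0\<^sub>m n 1) P * four_block_mat Y (0\<^sub>m 1 n) (0\<^sub>m n 1) Q =
      four_block_mat (X * Y) (0\<^sub>m 1 n) (0\<^sub>m n 1) (P * Q)"
    if "X \<in> carrier_mat 1 1" "Y \<in> carrier_mat 1 1" "P \<in> carrier_mat n n" "Q \<in> carrier_mat n n" for X Y P Q :: "complex mat"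
    using that by (subst mult_four_block_mat[of _ 1 1 _ n _ n _ _ 1 _ n]) auto
  have WW: "adj W * W = 1\<^sub>m (Suc n)"
    unfolding adjW unfolding W_def using Uc by (subst blk) auto
  have uW: "unitary (Suc n) W" using W WW by (simp add: unitary_def)
  have BW: "B = W * mat_diag (Suc n) (\<lambda>i. complex_of_real (L i)) * adj W"
  proof -
    define X where "X = mat_diag 1 (\<lambda>i. complex_of_real (Re ev))"
    have X: "X \<in> carrier_mat 1 1" by (simp only: X_def mat_diag_dim)
    define D where "D = rdiag n l"
    have D: "D \<in> carrier_mat n n" by (simp add: D_def)
    have "W * mat_diag (Suc n) (\<lambda>i. complex_of_real (L i)) = four_block_mat X (0\<^sub>m 1 n) (0\<^sub>m n 1) (U * D)"
      unfolding W_def DF X_def[symmetric] D_def[symmetric] blk[OF one_carrier_mat X Uc(1) D] left_mult_one_mat[OF X] ..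
    then show ?thesis
      unfolding adjW BF CU X_def[symmetric] D_def[symmetric]
      by (simp only: blk[OF X one_carrier_mat mult_carrier_mat[OF Uc(1) D] Uc(2)] right_mult_one_mat[OF X])
  qed
  have "A = (H * adj H) * A * (H * adj H)" using A Hc by simp
  also have "\<dots> = H * B * adj H" unfolding B_def using A Hc(1,2)
    by (simp add: assoc_mult_mat[of _ "Suc n" "Suc n" _ "Suc n" _ "Suc n"] mult_carrier_mat[of _ "Suc n" "Suc n" _ "Suc n"])
  also have "\<dots> = (H * W) * mat_diag (Suc n) (\<lambda>i. complex_of_real (L i)) * adj (H * W)"
    unfolding BW using Hc(1,2) W
    by (simp add: adj_mult[of _ "Suc n" "Suc n" _ "Suc n"] assoc_mult_mat[of _ "Suc n" "Suc n" _ "Suc n" _ "Suc n"] mult_carrier_mat[of _ "Suc n" "Suc n" _ "Suc n"])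
  finally show ?case using unitary_mult[OF H(1) uW] by blast
qed

lemma mat_assoc:
  "dim_col A = dim_row B \<Longrightarrow> dim_col B = dim_row C \<Longrightarrow> A * B * C = A * (B * (C :: 'a :: semiring_0 mat))"
  by (rule assoc_mult_mat[of _ "dim_row A" "dim_row B" _ "dim_row C" _ "dim_col C"]) auto

lemma adj_mult_dim: "dim_col A = dim_row B \<Longrightarrow> adj (A * B) = adj B * adj A"
  by (rule adj_mult[of _ "dim_row A" "dim_row B" _ "dim_col B"]) auto

lemma one_mult_dim: "dim_row A = n \<Longrightarrow> 1\<^sub>m n * A = (A :: 'a :: semiring_1 mat)"
  "dim_col A = n \<Longrightarrow> A * 1\<^sub>m n = A"
  by (auto intro: left_mult_one_mat' right_mult_one_mat')

lemma dim_mat_diag[simp]: "dim_row (mat_diag n f) = n" "dim_col (mat_diag n f) = n"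
  by (auto simp: mat_diag_def)

lemma spectral_entry:
  assumes "unitary n U" "i < n" "j < n"
  shows "(U * mat_diag n f * adj U) $$ (i,j) = (\<Sum>k<n. U $$ (i,k) * f k * cnj (U $$ (j,k)))"
  using assms unitaryD[OF assms(1)]
  by (subst mult_entry'[of _ n n _ n]) (auto simp: mat_diag_mult_right[of _ n] intro!: sum.cong)

lemma spectral_entry_diag:
  assumes "unitary n U" "i < n"
  shows "(U * rdiag n f * adj U) $$ (i,i) =
    complex_of_real (\<Sum>k<n. (cmod (U $$ (i,k)))\<^sup>2 * f k)"
  using assms by (subst spectral_entry) (auto simp: complex_norm_square mult_ac simp del: of_real_power)

lemma spectral_mult:
  assumes "unitary n U"
  shows "(U * mat_diag n f * adj U) * (U * mat_diag n g * adj U) = U * mat_diag n (\<lambda>i. f i * g i) * adj U"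
proof -
  note c = unitaryD[OF assms]
  have "(U * mat_diag n f * adj U) * (U * mat_diag n g * adj U) =
     U * mat_diag n f * ((adj U * U) * (mat_diag n g * adj U))"
    using c(1,2) by (simp add: mat_assoc)
  also have "\<dots> = U * (mat_diag n f * mat_diag n g) * adj U"
    unfolding c(3) left_mult_one_mat[OF mult_carrier_mat[OF mat_diag_dim c(2)]]
    using c(1,2) by (simp add: mat_assoc del: mat_diag_diag)
  finally show ?thesis by simp
qed

lemma spectral_adj:
  assumes "unitary n U"
  shows "adj (U * rdiag n f * adj U) = U * rdiag n f * adj U"
  using unitaryD[OF assms]
  by (simp add: adj_mult_dim mat_assoc)

lemma spectral_carrier[simp]:
  "unitary n U \<Longrightarrow> U * mat_diag n f * adj U \<in> carrier_mat n n"
  by (auto simp: unitary_def)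

section \<open>Positive semidefinite matrices and their roots\<close>

lemma psd_carrier: "psd A \<Longrightarrow> A \<in> carrier_mat (dim_row A) (dim_row A)"
  by (simp add: psd_def)

lemma psd_gram:
  assumes V: "V \<in> carrier_mat k n"
  shows "psd (adj V * V)"
  unfolding psd_def
proof (intro conjI allI impI)
  show "adj V * V \<in> carrier_mat (dim_row (adj V * V)) (dim_row (adj V * V))"
    using V by auto
  fix v :: "complex vec" assume "dim_vec v = dim_row (adj V * V)"
  let ?w = "\<lambda>l. \<Sum>j<n. V $$ (l,j) * v $ j"
  have "(\<Sum>i<n. \<Sum>j<n. cnj (v $ i) * (adj V * V) $$ (i,j) * v $ j) =
     (\<Sum>i<n. \<Sum>j<n. \<Sum>l<k. cnj (V $$ (l,i) * v $ i) * (V $$ (l,j) * v $ j))"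
    using V by (intro sum.cong refl) (subst mult_entry'[of _ n k _ n], auto simp: sum_distrib_left sum_distrib_right mult_ac)
  also have "\<dots> = (\<Sum>i<n. \<Sum>l<k. \<Sum>j<n. cnj (V $$ (l,i) * v $ i) * (V $$ (l,j) * v $ j))"
    by (intro sum.cong refl sum.swap)
  also have "\<dots> = (\<Sum>l<k. \<Sum>i<n. \<Sum>j<n. cnj (V $$ (l,i) * v $ i) * (V $$ (l,j) * v $ j))"
    by (rule sum.swap)
  also have "\<dots> = (\<Sum>l<k. cnj (?w l) * ?w l)"
    by (simp add: sum_product)
  also have "\<dots> = complex_of_real (\<Sum>l<k. (cmod (?w l))\<^sup>2)"
    unfolding of_real_sum complex_norm_square by (simp add: mult.commute)
  finally have "(\<Sum>i<n. \<Sum>j<n. cnj (v $ i) * (adj V * V) $$ (i,j) * v $ j) = complex_of_real (\<Sum>l<k. (cmod (?w l))\<^sup>2)" .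
  moreover have "dim_row (adj V * V) = n" using V by auto
  ultimately show "\<exists>r\<ge>0. (\<Sum>i<dim_row (adj V * V). \<Sum>j<dim_row (adj V * V). cnj (v $ i) * (adj V * V) $$ (i,j) * v $ j) = complex_of_real r"
    by (intro exI[of _ "\<Sum>l<k. (cmod (?w l))\<^sup>2"] conjI sum_nonneg) simp_all
qed

lemma psd_carrierI: "psd A \<Longrightarrow> dim_row A = n \<Longrightarrow> A \<in> carrier_mat n n"
  using psd_carrier by blast

lemma psd_quadratic:
  assumes "psd A" "A \<in> carrier_mat n n"
  shows "\<exists>r\<ge>0. (\<Sum>i<n. \<Sum>j<n. cnj (v i) * A $$ (i,j) * v j) = complex_of_real r"
proof -
  have d: "dim_row A = n" using assms(2) by auto
  have "dim_vec (vec n v) = dim_row A" by (simp add: d)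
  from assms(1)[unfolded psd_def, THEN conjunct2, rule_format, OF this] show ?thesis
    unfolding d by simp
qed

text \<open>\<open>psd\<close> only asks for a real nonnegative form, and hermiticity follows by
  polarisation: the values at two basis vectors combined with coefficients 1 and 1, and with 1 and
  \<i>, determine how the two off-diagonal entries are related.\<close>

lemma psd_hermitian:
  assumes "psd A"
  shows "adj A = A"
proof -
  define n where "n = dim_row A"
  have A: "A \<in> carrier_mat n n" by (rule psd_carrierI[OF assms]) (simp add: n_def)
  have q: "\<exists>r\<ge>0. cnj a * A $$ (i,i) * a + cnj a * A $$ (i,j) * b + cnj b * A $$ (j,i) * a + cnj b * A $$ (j,j) * b = complex_of_real r"
    if "i < n" "j < n" for i j a b
  proof -
    \<comment> \<open>Adding two indicators, rather than distinguishing cases, covers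
      \<open>i = j\<close> as well.\<close>
    let ?v = "\<lambda>k. (if k = i then a else 0) + (if k = j then b else 0)"
    have delta: "(\<Sum>k<n. g k * ((if k = i then x else 0) + (if k = j then y else 0))) = g i * x + g j * y"
      for g :: "nat \<Rightarrow> complex" and x y
    proof -
      have "(\<Sum>k<n. g k * ((if k = i then x else 0) + (if k = j then y else 0))) =
          (\<Sum>k<n. (if k = i then g i * x else 0) + (if k = j then g j * y else 0))"
        by (intro sum.cong) (auto simp: algebra_simps)
      then show ?thesis using that by (simp add: sum.distrib)
    qed
    have r: "(\<Sum>l<n. A $$ (k,l) * ?v l) = A $$ (k,i) * a + A $$ (k,j) * b" for k
      by (rule delta)
    have l: "(\<Sum>k<n. cnj (?v k) * g k) = cnj a * g i + cnj b * g j" for g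
    proof -
      have "(\<Sum>k<n. cnj (?v k) * g k) = (\<Sum>k<n. g k * ((if k = i then cnj a else 0) + (if k = j then cnj b else 0)))"
        by (intro sum.cong) auto
      then show ?thesis by (simp only: delta mult.commute)
    qed
    have "(\<Sum>k<n. \<Sum>l<n. cnj (?v k) * A $$ (k,l) * ?v l) = (\<Sum>k<n. cnj (?v k) * (\<Sum>l<n. A $$ (k,l) * ?v l))"
      by (simp add: sum_distrib_left mult.assoc)
    also have "\<dots> = cnj a * (A $$ (i,i) * a + A $$ (i,j) * b) + cnj b * (A $$ (j,i) * a + A $$ (j,j) * b)"
      unfolding r l ..
    finally show ?thesis using psd_quadratic[OF assms A, of ?v] by (simp add: algebra_simps)
  qed
  have diag: "Im (A $$ (i,i)) = 0" if "i < n" for i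
    using q[OF that that, of 1 0] by (auto simp: complex_eq_iff)
  show ?thesis
  proof (rule eq_matI)
    fix i j assume "i < dim_row A" "j < dim_col A"
    then have ij: "i < n" "j < n" using A by auto
    show "adj A $$ (i,j) = A $$ (i,j)"
      using q[OF ij, of 1 1] q[OF ij, of 1 \<i>] ij A diag[OF ij(1)] diag[OF ij(2)] by (auto simp: complex_eq_iff)
  qed (use A in auto)
qed

lemma psd_spectral:
  assumes "psd A" "A \<in> carrier_mat n n"
  shows "\<exists>U l. unitary n U \<and> (\<forall>i. l i \<ge> 0) \<and> A = U * rdiag n l * adj U"
proof -
  obtain U l where U: "unitary n U" and A: "A = U * rdiag n l * adj U"
    using hermitian_spectral[OF assms(2) psd_hermitian[OF assms(1)]] by blast
  note c = unitaryD[OF U]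
  have "adj U * A * U = (adj U * U) * rdiag n l * (adj U * U)"
    unfolding A using c(1,2) by (simp add: mat_assoc)
  then have D: "adj U * A * U = rdiag n l"
    by (simp add: c(3) left_mult_one_mat[of _ n n] right_mult_one_mat[of _ n n])
  have pos: "l i \<ge> 0" if i: "i < n" for i
  proof -
    have "(adj U * A * U) $$ (i,i) = (\<Sum>j<n. \<Sum>k<n. cnj (U $$ (j,i)) * A $$ (j,k) * U $$ (k,i))"
    proof -
      have "(adj U * A * U) $$ (i,i) = (adj U * (A * U)) $$ (i,i)"
        using c(1,2) assms(2) by (simp add: mat_assoc)
      also have "\<dots> = (\<Sum>j<n. cnj (U $$ (j,i)) * (A * U) $$ (j,i))"
        using i c(1,2) assms(2) by (subst mult_entry'[of _ n n _ n]) auto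
      also have "\<dots> = (\<Sum>j<n. \<Sum>k<n. cnj (U $$ (j,i)) * A $$ (j,k) * U $$ (k,i))"
        using i c(1) assms(2) by (intro sum.cong refl, subst mult_entry'[of A n n U n]) (auto simp: sum_distrib_left mult.assoc)
      finally show ?thesis .
    qed
    then show ?thesis using psd_quadratic[OF assms, of "\<lambda>j. U $$ (j,i)"] i unfolding D
      by (auto simp: mat_diag_def)
  qed
  \<comment> \<open>The eigenvalues are set to 0 outside the range so that nonnegativity holds for
    every index.\<close>
  have "rdiag n l = mat_diag n (\<lambda>i. complex_of_real (if i < n then l i else 0))"
    by (intro eq_matI) (auto simp: mat_diag_def)
  then show ?thesis using pos U A by (intro exI[of _ U] exI[of _ "\<lambda>i. if i < n then l i else 0"]) auto
qed

lemma psd_diag: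
  assumes V: "V \<in> carrier_mat d n" and "\<And>i. l i \<ge> 0"
  shows "psd (V * rdiag n l * adj V)"
proof -
  let ?S = "mat_diag n (\<lambda>i. complex_of_real (sqrt (l i)))"
  have "rdiag n l = ?S * ?S"
    using assms(2) by (simp flip: of_real_mult)
  then have "V * rdiag n l * adj V = (V * ?S) * (?S * adj V)"
    using V by (simp add: mat_assoc del: mat_diag_diag)
  also have "\<dots> = adj (?S * adj V) * (?S * adj V)"
    using V by (simp add: adj_mult_dim)
  finally show ?thesis using psd_gram[OF mult_carrier_mat[OF mat_diag_dim adj_carrier[OF V]]] by metis
qed

lemma psd_sqrt_exists:
  assumes "psd A" shows "\<exists>B. psd B \<and> B * B = A"
proof -
  obtain U l where U: "unitary (dim_row A) U" "\<And>i. l i \<ge> 0" "A = U * mat_diag (dim_row A) (\<lambda>i. complex_of_real (l i)) * adj U"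
    using psd_spectral[OF assms psd_carrier[OF assms]] by blast
  let ?B = "U * mat_diag (dim_row A) (\<lambda>i. complex_of_real (sqrt (l i))) * adj U"
  have "?B * ?B = A" using U by (simp add: spectral_mult U(3)[symmetric] flip: of_real_mult)
  moreover have "psd ?B" using U unitaryD[OF U(1)] by (intro psd_diag[of _ "dim_row A"]) auto
  ultimately show ?thesis by blast
qed

text \<open>In eigenbases of the two roots the transition matrix intertwines the squared, hence also
  the unsquared, nonnegative eigenvalues.\<close>
lemma psd_sqrt_unique:
  assumes "psd B" "psd C" "B * B = C * C"
  shows "B = C"
proof -
  define n where "n = dim_row B"
  have B: "B \<in> carrier_mat n n" by (rule psd_carrierI[OF assms(1)]) (simp add: n_def)
  have "dim_row C = n" using arg_cong[OF assms(3), of dim_row] by (simp add: n_def)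
  then have C: "C \<in> carrier_mat n n" by (rule psd_carrierI[OF assms(2)])
  obtain U b where U: "unitary n U" "\<And>i. b i \<ge> 0" "B = U * rdiag n b * adj U"
    using psd_spectral[OF assms(1) B] by blast
  obtain V c where V: "unitary n V" "\<And>i. c i \<ge> 0" "C = V * rdiag n c * adj V"
    using psd_spectral[OF assms(2) C] by blast
  note Uc = unitaryD[OF U(1)] and Vc = unitaryD[OF V(1)]
  have conj: "adj V * (U * D * adj U) * U = adj V * U * D" "adj V * (V * D * adj V) * U = D * (adj V * U)"
    if "D \<in> carrier_mat n n" for D
  proof -
    have "adj V * (U * D * adj U) * U = (adj V * U * D) * (adj U * U)"
      using that Uc(1,2) Vc(1,2) by (simp add: mat_assoc)
    also have "\<dots> = adj V * U * D" unfolding Uc(3) using that Uc(1,2) by (intro one_mult_dim) auto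
    finally show "adj V * (U * D * adj U) * U = adj V * U * D" .
    have "adj V * (V * D * adj V) * U = (adj V * V) * (D * (adj V * U))"
      using that Uc(1,2) Vc(1,2) by (simp add: mat_assoc)
    also have "\<dots> = D * (adj V * U)" unfolding Vc(3) using that Uc(1,2) by (intro one_mult_dim) auto
    finally show "adj V * (V * D * adj V) * U = D * (adj V * U)" .
  qed
  define T where "T = adj V * U"
  have T: "T \<in> carrier_mat n n" using Uc Vc by (auto simp: T_def)
  have "adj V * (B * B) * U = adj V * (C * C) * U" using assms(3) by simp
  then have sq: "T * mat_diag n (\<lambda>i. complex_of_real (b i) * complex_of_real (b i)) =
      mat_diag n (\<lambda>i. complex_of_real (c i) * complex_of_real (c i)) * T"
    unfolding U(3) V(3) spectral_mult[OF U(1)] spectral_mult[OF V(1)] by (simp add: conj T_def)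
  have "T * rdiag n b = rdiag n c * T"
  proof (rule eq_matI)
    fix i j assume "i < dim_row (rdiag n c * T)" "j < dim_col (rdiag n c * T)"
    then have ij: "i < n" "j < n" using T by (auto simp: mat_diag_def)
    have "T $$ (i,j) * (complex_of_real (b j * b j - c i * c i)) = 0"
      using arg_cong[OF sq, of "\<lambda>M. M $$ (i,j)"] ij T
      by (simp add: mat_diag_mult_left[of _ n n] mat_diag_mult_right[of _ n] algebra_simps)
    then have "T $$ (i,j) = 0 \<or> b j * b j - c i * c i = 0" by (simp only: mult_eq_0_iff of_real_eq_0_iff)
    then have "T $$ (i,j) = 0 \<or> b j = c i"
      using power2_eq_iff_nonneg[OF U(2)[of j] V(2)[of i]] by (auto simp: power2_eq_square)
    then show "(T * rdiag n b) $$ (i,j) = (rdiag n c * T) $$ (i,j)"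
      using ij T by (auto simp: mat_diag_mult_left[of _ n n] mat_diag_mult_right[of _ n])
  qed (use T in \<open>auto simp: mat_diag_def\<close>)
  then have "adj V * B * U = adj V * C * U" unfolding U(3) V(3) by (simp add: conj T_def)
  then have "V * (adj V * B * U) * adj U = V * (adj V * C * U) * adj U" by simp
  moreover have "V * (adj V * X * U) * adj U = X" if "X \<in> carrier_mat n n" for X
  proof -
    have "V * (adj V * X * U) * adj U = (V * adj V) * X * (U * adj U)"
      using that Uc(1,2) Vc(1,2) by (simp add: mat_assoc)
    then show ?thesis using that by (simp add: Uc(4) Vc(4))
  qed
  ultimately show ?thesis using B C by simp
qed

lemma msqrt_eqI: "psd B \<Longrightarrow> B * B = A \<Longrightarrow> msqrt A = B"
  unfolding msqrt_def by (rule the_equality) (auto intro: psd_sqrt_unique)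

lemma msqrt_psd: assumes "psd A" shows "psd (msqrt A)" "msqrt A * msqrt A = A"
  using psd_sqrt_exists[OF assms] msqrt_eqI by auto

section \<open>Trace norm and fidelity through Gram matrices\<close>

lemma mtrace_comm:
  "A \<in> carrier_mat a b \<Longrightarrow> B \<in> carrier_mat b a \<Longrightarrow> mtrace (A * B) = mtrace (B * A)"
  unfolding mtrace_def
  by (subst (2) sum.cong[OF refl, of _ _ "\<lambda>i. \<Sum>k<a. B $$ (i,k) * A $$ (k,i)"])
     (auto simp: mult_entry' mult.commute simp del: index_mult_mat(1) intro: sum.swap)

lemma gram_diag:
  assumes "V \<in> carrier_mat d n" "j < n"
  shows "(adj V * V) $$ (j,j) = complex_of_real (\<Sum>k<d. (cmod (V $$ (k,j)))\<^sup>2)"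
  using assms by (subst mult_entry'[of _ n d _ n]) (auto simp: complex_norm_square mult.commute simp del: of_real_power)

lemma gram_diag_zero:
  assumes "V \<in> carrier_mat d n" "j < n" "(adj V * V) $$ (j,j) = 0" "k < d"
  shows "V $$ (k,j) = 0"
proof -
  have "(\<Sum>k<d. (cmod (V $$ (k,j)))\<^sup>2) = 0" using assms by (simp only: gram_diag of_real_eq_0_iff)
  then show ?thesis using assms(4) by (subst (asm) sum_nonneg_eq_0_iff) auto
qed

text \<open>\<open>V * adj V\<close> and \<open>adj V * V\<close> share their nonzero eigenvalues.
  Since the second is diagonal, the root of the first is \<open>V\<close> times the inverse roots of
  the positive \<open>t i\<close> times \<open>adj V\<close>.\<close>

lemma trace_norm_gram:
  assumes V: "V \<in> carrier_mat d n" and A: "adj A * A = V * adj V"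
    and G: "adj V * V = rdiag n t" and t: "\<And>i. t i \<ge> 0"
  shows "trace_norm A = (\<Sum>i<n. sqrt (t i))"
proof -
  define g where "g i = (if t i = 0 then 0 else 1 / sqrt (t i))" for i
  let ?D = "\<lambda>f. rdiag n f"
  define Q where "Q = V * ?D g * adj V"
  have "psd Q" unfolding Q_def using V t by (intro psd_diag) (auto simp: g_def)
  have "Q * Q = V * (?D g * (adj V * V) * ?D g) * adj V"
    using V unfolding Q_def
    by (simp add: mat_assoc del: mat_diag_diag)
  also have "?D g * (adj V * V) * ?D g = ?D (\<lambda>i. if t i = 0 then 0 else 1)"
  proof -
    have "g i * t i * g i = (if t i = 0 then 0 else 1)" for i
      using t[of i] by (auto simp: g_def field_simps real_div_sqrt)
    then show ?thesis unfolding G by (simp flip: of_real_mult)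
  qed
  \<comment> \<open>Columns with \<open>t j = 0\<close> vanish by \<open>gram_diag_zero\<close>, so
    cutting them off changes nothing.\<close>
  also have "V * ?D (\<lambda>i. if t i = 0 then 0 else 1) = V"
    unfolding mat_diag_mult_right[OF V]
  proof (rule eq_matI)
    fix i j assume "i < dim_row V" "j < dim_col V"
    then have ij: "i < d" "j < n" using V by auto
    then have "t j = 0 \<Longrightarrow> V $$ (i,j) = 0"
      by (intro gram_diag_zero[OF V]) (simp_all add: G, simp add: mat_diag_def)
    then show "mat d n (\<lambda>(i, j). V $$ (i, j) * complex_of_real (if t j = 0 then 0 else 1)) $$ (i,j) = V $$ (i,j)"
      using ij by auto
  qed (use V in auto)
  finally have "msqrt (adj A * A) = Q" unfolding A using \<open>psd Q\<close> by (intro msqrt_eqI) auto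
  then have "trace_norm A = Re (mtrace (V * ?D g * adj V))" by (simp add: trace_norm_def Q_def)
  also have "mtrace (V * ?D g * adj V) = mtrace (adj V * (V * ?D g))"
    using V by (intro mtrace_comm[of _ d n]) auto
  also have "adj V * (V * ?D g) = (adj V * V) * ?D g"
    using V by (simp add: mat_assoc)
  also have "\<dots> = ?D (\<lambda>i. sqrt (t i))"
  proof -
    have "t i * g i = sqrt (t i)" for i
      using t[of i] by (simp add: g_def real_div_sqrt)
    then show ?thesis unfolding G by (simp flip: of_real_mult)
  qed
  finally show ?thesis by (simp add: mtrace_def mat_diag_def)
qed

text \<open>With \<open>S\<close> the root of \<open>\<sigma>\<close>, the squared modulus of the
  product of the two roots is \<open>(S * W) * adj (S * W)\<close>, and
  \<open>trace_norm_gram\<close> passes to the opposite Gram matrix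
  \<open>adj W * \<sigma> * W\<close>. Neither root has to be computed.\<close>

lemma fidelity_gram:
  assumes W: "W \<in> carrier_mat d n" and \<sigma>: "psd \<sigma>" "\<sigma> \<in> carrier_mat d d"
    and G: "adj W * \<sigma> * W = rdiag n t" and t: "\<And>i. t i \<ge> 0"
  shows "fidelity (W * adj W) \<sigma> = (\<Sum>i<n. sqrt (t i))"
proof -
  define R S where "R = msqrt (W * adj W)" and "S = msqrt \<sigma>"
  have "psd (W * adj W)" using psd_gram[of "adj W" n d] W by simp
  note R = msqrt_psd[OF this, folded R_def] and S = msqrt_psd[OF \<sigma>(1), folded S_def]
  have Rc: "R \<in> carrier_mat d d" using arg_cong[OF R(2), of dim_row] W by (intro psd_carrierI[OF R(1)]) auto
  have Sc: "S \<in> carrier_mat d d" using arg_cong[OF S(2), of dim_row] \<sigma>(2) by (intro psd_carrierI[OF S(1)]) auto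
  have "adj (R * S) * (R * S) = S * (R * R) * S"
    using Rc Sc psd_hermitian[OF R(1)] psd_hermitian[OF S(1)]
    by (simp add: adj_mult_dim mat_assoc)
  also have "\<dots> = (S * W) * adj (S * W)"
    unfolding R(2) using W Sc psd_hermitian[OF S(1)]
    by (simp add: adj_mult_dim mat_assoc)
  finally have 1: "adj (R * S) * (R * S) = (S * W) * adj (S * W)" .
  have "adj (S * W) * (S * W) = adj W * (S * S) * W"
    using W Sc psd_hermitian[OF S(1)]
    by (simp add: adj_mult_dim mat_assoc)
  then have 2: "adj (S * W) * (S * W) = rdiag n t" unfolding S(2) G .
  show ?thesis unfolding fidelity_def R_def[symmetric] S_def[symmetric]
    using W Sc by (intro trace_norm_gram[OF _ 1 2 t]) auto
qed

lemma psd_zero: "psd (0\<^sub>m n n)"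
proof -
  have "adj (0\<^sub>m n n) * (0\<^sub>m n n) = (0\<^sub>m n n :: complex mat)"
    by (rule right_mult_zero_mat) auto
  then show ?thesis using psd_gram[of "0\<^sub>m n n" n n] by simp
qed

lemma psd_add:
  assumes "psd A" "psd B" "A \<in> carrier_mat n n" "B \<in> carrier_mat n n"
  shows "psd (A + B)"
  unfolding psd_def
proof (intro conjI allI impI)
  fix v :: "complex vec" assume "dim_vec v = dim_row (A + B)"
  obtain r s where "r \<ge> 0" "(\<Sum>i<n. \<Sum>j<n. cnj (v $ i) * A $$ (i,j) * v $ j) = complex_of_real r"
     "s \<ge> 0" "(\<Sum>i<n. \<Sum>j<n. cnj (v $ i) * B $$ (i,j) * v $ j) = complex_of_real s"
    using psd_quadratic[OF assms(1,3)] psd_quadratic[OF assms(2,4)] by metis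
  moreover have "(\<Sum>i<n. \<Sum>j<n. cnj (v $ i) * (A + B) $$ (i,j) * v $ j) =
    (\<Sum>i<n. \<Sum>j<n. cnj (v $ i) * A $$ (i,j) * v $ j) + (\<Sum>i<n. \<Sum>j<n. cnj (v $ i) * B $$ (i,j) * v $ j)"
    unfolding sum.distrib[symmetric] using assms(3,4) by (intro sum.cong refl) (auto simp: algebra_simps)
  ultimately show "\<exists>r\<ge>0. (\<Sum>i<dim_row (A + B). \<Sum>j<dim_row (A + B). cnj (v $ i) * (A + B) $$ (i,j) * v $ j) = complex_of_real r"
    using assms(3,4) by (intro exI[of _ "r + s"]) auto
qed (use assms in auto)

lemma psd_conj:
  assumes "psd A" "A \<in> carrier_mat n n" "K \<in> carrier_mat k n"
  shows "psd (K * A * adj K)"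
proof -
  note S = msqrt_psd[OF assms(1)]
  define B where "B = msqrt A"
  have "dim_row B = n" using arg_cong[OF S(2), of dim_row] assms(2) by (simp add: B_def)
  then have B: "B \<in> carrier_mat n n" "adj B = B" "B * B = A"
    using psd_carrierI[OF S(1)] psd_hermitian[OF S(1)] S(2) by (simp_all add: B_def)
  have "K * A * adj K = adj (B * adj K) * (B * adj K)"
    using B(1,2) assms(3) unfolding B(3)[symmetric]
    by (simp add: adj_mult_dim mat_assoc)
  then show ?thesis using B(1) assms(3) psd_gram[of "B * adj K" n k] by (simp add:)
qed

section \<open>Polar parts and their scalar estimates\<close>

text \<open>The polar part \<open>Y\<close> of \<open>W\<close> is the partial isometry with \<open>adj Y * W\<close> the positive root of the
  Gram matrix \<open>adj W * W\<close>; its columns are the pretty good measurement vectors of the columns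
  of \<open>W\<close>. Only the following consequences of the functional calculus are needed; they rest on
  \<open>sqrt t \<ge> 3/2 * t - 1/2 * t\<^sup>2\<close> and \<open>(1 - sqrt t)\<^sup>2 \<le> (1 - t)\<^sup>2\<close>.\<close>
definition is_polar_part :: "complex mat \<Rightarrow> complex mat \<Rightarrow> bool" where
  "is_polar_part W Y \<longleftrightarrow> Y \<in> carrier_mat (dim_row W) (dim_col W) \<and> Y * (adj Y * Y) = Y
    \<and> (\<forall>k<dim_col W. Re ((adj Y * W) $$ (k,k)) \<ge> 3/2 * (\<Sum>i<dim_row W. (cmod (W $$ (i,k)))\<^sup>2) - 1/2 * (\<Sum>l<dim_col W. (cmod ((adj W * W) $$ (k,l)))\<^sup>2))
    \<and> (\<forall>k<dim_col W. (\<Sum>i<dim_row W. (cmod (Y $$ (i,k)))\<^sup>2) \<le> 1)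
    \<and> (\<forall>k<dim_col W. (\<Sum>i<dim_row W. (cmod (Y $$ (i,k) - W $$ (i,k)))\<^sup>2) \<le>
         (\<Sum>l<dim_col W. (cmod ((adj W * W) $$ (k,l)))\<^sup>2) - 2 * (\<Sum>i<dim_row W. (cmod (W $$ (i,k)))\<^sup>2) + 1)
    \<and> (\<forall>k<dim_col W. (\<forall>i<dim_row W. W $$ (i,k) = 0) \<longrightarrow> (\<forall>i<dim_row W. Y $$ (i,k) = 0))"

lemma polar_part_exists:
  assumes W: "W \<in> carrier_mat a b"
  shows "\<exists>Y. is_polar_part W Y"
proof -
  define G where "G = adj W * W"
  have G: "G \<in> carrier_mat b b" using W by (auto simp: G_def)
  obtain U l where U: "unitary b U" and l: "\<And>i. l i \<ge> 0" and GU: "G = U * rdiag b l * adj U"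
    using psd_spectral[OF _ G] psd_gram[OF W] unfolding G_def by blast
  note Uc = unitaryD[OF U]
  let ?F = "\<lambda>f. U * rdiag b f * adj U"
  \<comment> \<open>The inverse root on the positive spectrum, so that \<open>Y\<close> is
    \<open>W\<close> times the pseudo-inverse of the root of its Gram matrix.\<close>
  define f where "f x = (if x = 0 then 0 else 1 / sqrt x)" for x :: real
  define Y where "Y = W * ?F (\<lambda>i. f (l i))"
  have Fc: "?F g \<in> carrier_mat b b" for g using U by simp
  have Yc: "Y \<in> carrier_mat a b" using W Fc by (auto simp: Y_def)
  have adjY: "adj Y = ?F (\<lambda>i. f (l i)) * adj W"
    unfolding Y_def adj_mult[OF W Fc] spectral_adj[OF U] ..
  have FF: "?F g * ?F h = ?F (\<lambda>i. g i * h i)" for g h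
    unfolding spectral_mult[OF U] by simp
  have YW: "adj Y * W = ?F (\<lambda>i. sqrt (l i))"
  proof -
    have "adj Y * W = ?F (\<lambda>i. f (l i)) * G"
      unfolding adjY G_def using W Uc(1) by (simp add: mat_assoc)
    also have "\<dots> = ?F (\<lambda>i. f (l i) * l i)" unfolding GU FF ..
    also have "(\<lambda>i. f (l i) * l i) = (\<lambda>i. sqrt (l i))" using l by (auto simp: f_def real_div_sqrt)
    finally show ?thesis .
  qed
  let ?s = "\<lambda>i. if l i = 0 then 0 else (1::real)"
  have YY: "adj Y * Y = ?F ?s"
  proof -
    have "adj Y * Y = (adj Y * W) * ?F (\<lambda>i. f (l i))"
      unfolding Y_def using W Uc(1) by (simp add: mat_assoc)
    also have "\<dots> = ?F (\<lambda>i. sqrt (l i) * f (l i))" unfolding YW FF ..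
    also have "(\<lambda>i. sqrt (l i) * f (l i)) = ?s" by (auto simp: f_def)
    finally show ?thesis .
  qed
  have YYY: "Y * (adj Y * Y) = Y"
  proof -
    have "Y * (adj Y * Y) = W * (?F (\<lambda>i. f (l i)) * ?F ?s)"
      unfolding YY unfolding Y_def using W Uc(1) by (simp add: mat_assoc)
    also have "\<dots> = W * ?F (\<lambda>i. f (l i) * ?s i)" unfolding FF ..
    also have "(\<lambda>i. f (l i) * ?s i) = (\<lambda>i. f (l i))" by (auto simp: f_def)
    finally show ?thesis by (simp add: Y_def)
  qed
  \<comment> \<open>The weights \<open>u k\<close> sum to 1 over the eigenvalues. Each diagonal
    entry of a function of \<open>G\<close> is thus an average of that function, and the claims
    reduce to inequalities between scalars.\<close>
  define u where "u k i = (cmod (U $$ (k,i)))\<^sup>2" for k i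
  have u0: "u k i \<ge> 0" for k i by (simp add: u_def)
  have diag: "?F g $$ (k,k) = complex_of_real (\<Sum>i<b. u k i * g i)" if "k < b" for g k
    unfolding u_def using spectral_entry_diag[OF U that] .
  have Gkk: "(\<Sum>i<a. (cmod (W $$ (i,k)))\<^sup>2) = (\<Sum>i<b. u k i * l i)" if "k < b" for k
    using gram_diag[OF W that] diag[OF that, of l] unfolding G_def[symmetric] GU[symmetric] by (simp only: of_real_eq_iff)
  have Ykk: "(\<Sum>i<a. (cmod (Y $$ (i,k)))\<^sup>2) = (\<Sum>i<b. u k i * ?s i)" if "k < b" for k
    using gram_diag[OF Yc that] diag[OF that, of ?s] unfolding YY by (simp only: of_real_eq_iff)
  \<comment> \<open>The squared norm of row \<open>k\<close> of the hermitian matrix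
    \<open>G\<close> is a diagonal entry of its square.\<close>
  have GGkk: "(\<Sum>j<b. (cmod (G $$ (k,j)))\<^sup>2) = (\<Sum>i<b. u k i * (l i)\<^sup>2)" if k: "k < b" for k
  proof -
    have GG: "adj G * G = ?F (\<lambda>i. (l i)\<^sup>2)"
      unfolding GU spectral_adj[OF U] FF by (simp add: power2_eq_square)
    have "(\<Sum>j<b. (cmod (G $$ (j,k)))\<^sup>2) = (\<Sum>i<b. u k i * (l i)\<^sup>2)"
      using gram_diag[OF G k] diag[OF k, of "\<lambda>i. (l i)\<^sup>2"] unfolding GG by (simp only: of_real_eq_iff)
    moreover have "cmod (G $$ (k,j)) = cmod (G $$ (j,k))" if "j < b" for j
      using arg_cong[OF spectral_adj[OF U, of l, folded GU], of "\<lambda>M. M $$ (k,j)"] k that G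
      by (metis carrier_matD complex_mod_cnj index_adj)
    ultimately show ?thesis by simp
  qed
  have u1: "(\<Sum>i<b. u k i) = 1" if "k < b" for k
  proof -
    have "U * mat_diag b (\<lambda>i. complex_of_real 1) * adj U = 1\<^sub>m b" using Uc by simp
    then have "complex_of_real (\<Sum>i<b. u k i * 1) = 1" using diag[OF that, of "\<lambda>_. 1"] that by auto
    then show ?thesis by (simp flip: of_real_sum)
  qed
  have c1: "Re ((adj Y * W) $$ (k,k)) \<ge> 3/2 * (\<Sum>i<a. (cmod (W $$ (i,k)))\<^sup>2) - 1/2 * (\<Sum>l<b. (cmod (G $$ (k,l)))\<^sup>2)"
    if k: "k < b" for k
  proof -
    have sq: "3/2 * x - 1/2 * x\<^sup>2 \<le> sqrt x" if "x \<ge> 0" for x :: real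
    proof -
      define y where "y = sqrt x"
      have y: "y \<ge> 0" "x = y\<^sup>2" using that by (auto simp: y_def)
      \<comment> \<open>This product is the difference of the two sides. Its double zero at 1 makes
        the estimate sharp to first order where the eigenvalues are expected.\<close>
      have "0 \<le> y * ((y - 1)\<^sup>2 * (y + 2)) / 2" using y by simp
      also have "\<dots> = y - (3/2 * x - 1/2 * x\<^sup>2)" unfolding y(2) by (simp add: power2_eq_square field_simps)
      finally show ?thesis by (simp add: y_def)
    qed
    have "(\<Sum>i<b. u k i * (3/2 * l i - 1/2 * (l i)\<^sup>2)) \<le> (\<Sum>i<b. u k i * sqrt (l i))"
      using sq l u0 by (intro sum_mono mult_left_mono) auto
    then show ?thesis unfolding YW diag[OF k] Gkk[OF k] GGkk[OF k]
      by (simp add: algebra_simps sum_subtractf sum_distrib_left)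
  qed
  have c2: "(\<Sum>i<a. (cmod (Y $$ (i,k)))\<^sup>2) \<le> 1" if k: "k < b" for k
  proof -
    have "(\<Sum>i<b. u k i * ?s i) \<le> (\<Sum>i<b. u k i)" by (intro sum_mono) (auto simp: u0)
    then show ?thesis unfolding Ykk[OF k] u1[OF k] .
  qed
  have c3: "(\<Sum>i<a. (cmod (Y $$ (i,k) - W $$ (i,k)))\<^sup>2) \<le>
         (\<Sum>l<b. (cmod (G $$ (k,l)))\<^sup>2) - 2 * (\<Sum>i<a. (cmod (W $$ (i,k)))\<^sup>2) + 1" if k: "k < b" for k
  proof -
    have "(cmod (y - w))\<^sup>2 = (cmod y)\<^sup>2 + (cmod w)\<^sup>2 - 2 * Re (cnj y * w)" for y w
      unfolding cmod_power2 by (simp add: power2_eq_square algebra_simps)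
    then have "(\<Sum>i<a. (cmod (Y $$ (i,k) - W $$ (i,k)))\<^sup>2) =
      (\<Sum>i<a. (cmod (Y $$ (i,k)))\<^sup>2) + (\<Sum>i<a. (cmod (W $$ (i,k)))\<^sup>2) - 2 * Re (\<Sum>i<a. cnj (Y $$ (i,k)) * W $$ (i,k))"
      by (simp add: sum.distrib sum_subtractf sum_distrib_left)
    also have "(\<Sum>i<a. cnj (Y $$ (i,k)) * W $$ (i,k)) = (adj Y * W) $$ (k,k)"
      using k Yc W by (subst mult_entry'[of _ b a _ b]) auto
    also have "(\<Sum>i<a. (cmod (Y $$ (i,k)))\<^sup>2) + (\<Sum>i<a. (cmod (W $$ (i,k)))\<^sup>2) - 2 * Re ((adj Y * W) $$ (k,k)) =
       (\<Sum>i<b. u k i * (?s i + l i - 2 * sqrt (l i)))"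
      unfolding YW diag[OF k] Gkk[OF k] Ykk[OF k] by (simp add: algebra_simps sum_subtractf sum.distrib sum_distrib_left)
    also have "\<dots> \<le> (\<Sum>i<b. u k i * ((l i)\<^sup>2 - 2 * l i + 1))"
    proof (intro sum_mono mult_left_mono u0)
      fix i
      define y where "y = sqrt (l i)"
      have y: "y \<ge> 0" "l i = y\<^sup>2" using l by (auto simp: y_def)
      have "(1 - y)\<^sup>2 * 1 \<le> (1 - y)\<^sup>2 * (1 + y)\<^sup>2"
        using y(1) by (intro mult_left_mono) auto
      then have "1 + y\<^sup>2 - 2 * y \<le> (y\<^sup>2)\<^sup>2 - 2 * y\<^sup>2 + 1" by (simp add: power2_eq_square algebra_simps)
      then show "?s i + l i - 2 * sqrt (l i) \<le> (l i)\<^sup>2 - 2 * l i + 1"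
        unfolding y_def[symmetric] y(2) by auto
    qed
    also have "\<dots> = (\<Sum>l<b. (cmod (G $$ (k,l)))\<^sup>2) - 2 * (\<Sum>i<a. (cmod (W $$ (i,k)))\<^sup>2) + 1"
      unfolding GGkk[OF k] Gkk[OF k] using u1[OF k] by (simp add: algebra_simps sum_subtractf sum.distrib sum_distrib_left)
    finally show ?thesis .
  qed
  have c4: "Y $$ (i,k) = 0" if k: "k < b" and z: "\<forall>i<a. W $$ (i,k) = 0" and i: "i < a" for i k
  proof -
    have "(\<Sum>i<b. u k i * l i) = 0" using Gkk[OF k] z by simp
    then have "\<forall>i<b. u k i * l i = 0" using u0 l by (subst (asm) sum_nonneg_eq_0_iff) auto
    then have "(\<Sum>i<b. u k i * ?s i) = 0" by (intro sum.neutral) auto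
    then have "(\<Sum>i<a. (cmod (Y $$ (i,k)))\<^sup>2) = 0" using Ykk[OF k] by simp
    then show ?thesis using i by (subst (asm) sum_nonneg_eq_0_iff) auto
  qed
  have d: "dim_row W = a" "dim_col W = b" using W by auto
  show ?thesis using Yc YYY c1 c2 c3 c4 unfolding is_polar_part_def d G_def[symmetric] by (intro exI[of _ Y]) blast
qed

section \<open>Second moments of random signs\<close>

text \<open>A sign pattern is encoded as the set of its negative positions, so the expectation over
  independent uniform signs is a finite average over a power set.\<close>

definition rsign :: "'a set \<Rightarrow> 'a \<Rightarrow> real" where
  "rsign S i = (if i \<in> S then -1 else 1)"

definition sign_avg :: "'a set \<Rightarrow> ('a set \<Rightarrow> real) \<Rightarrow> real" where
  "sign_avg I f = (\<Sum>S\<in>Pow I. f S) / 2 ^ card I"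

lemma sign_avg_empty[simp]: "sign_avg {} f = f {}"
  by (simp add: sign_avg_def)

text \<open>Conditioning on the sign at one position; this drives the inductions below.\<close>

lemma sign_avg_insert:
  assumes "finite I" "n \<notin> I"
  shows "sign_avg (insert n I) f = sign_avg I (\<lambda>S. (f S + f (insert n S)) / 2)"
proof -
  have "(\<Sum>S\<in>Pow (insert n I). f S) = (\<Sum>S\<in>Pow I. f S) + (\<Sum>S\<in>insert n ` Pow I. f S)"
    unfolding Pow_insert using assms by (intro sum.union_disjoint) auto
  also have "(\<Sum>S\<in>insert n ` Pow I. f S) = (\<Sum>S\<in>Pow I. f (insert n S))"
    using assms by (subst sum.reindex) (auto simp: inj_on_def)
  finally show ?thesis using assms
    by (simp add: sign_avg_def sum.distrib add_divide_distrib flip: sum_divide_distrib)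
qed

lemma sign_avg_add: "sign_avg I (\<lambda>S. f S + g S) = sign_avg I f + sign_avg I g"
  by (simp add: sign_avg_def sum.distrib add_divide_distrib)

lemma sign_avg_diff: "sign_avg I (\<lambda>S. f S - g S) = sign_avg I f - sign_avg I g"
  by (simp add: sign_avg_def sum_subtractf diff_divide_distrib)

lemma sign_avg_cmult: "sign_avg I (\<lambda>S. c * f S) = c * sign_avg I f"
  by (simp add: sign_avg_def flip: sum_distrib_left)

lemma sign_avg_sum: "sign_avg I (\<lambda>S. \<Sum>k\<in>K. f k S) = (\<Sum>k\<in>K. sign_avg I (f k))"
  by (simp add: sign_avg_def sum.swap[of _ K] flip: sum_divide_distrib)

lemma sign_avg_const: "finite I \<Longrightarrow> sign_avg I (\<lambda>S. c) = c"
  by (simp add: sign_avg_def card_Pow)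

lemma sign_avg_cong: "(\<And>S. S \<subseteq> I \<Longrightarrow> f S = g S) \<Longrightarrow> sign_avg I f = sign_avg I g"
  unfolding sign_avg_def by (intro arg_cong2[where f = "(/)"] sum.cong) auto

lemma sign_avg_mono: "(\<And>S. S \<subseteq> I \<Longrightarrow> f S \<le> g S) \<Longrightarrow> sign_avg I f \<le> sign_avg I g"
  unfolding sign_avg_def by (intro divide_right_mono sum_mono) auto

text \<open>The probabilistic method: not every value can lie below the mean.\<close>

lemma sign_avg_attained:
  assumes "finite I" shows "\<exists>S\<subseteq>I. f S \<ge> sign_avg I f"
proof (rule ccontr)
  assume "\<not> ?thesis"
  then have "\<And>S. S \<in> Pow I \<Longrightarrow> f S < sign_avg I f" by (auto simp: not_le)
  then have "(\<Sum>S\<in>Pow I. f S) < (\<Sum>S\<in>Pow I. sign_avg I f)"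
    using assms by (intro sum_strict_mono) auto
  then show False using assms by (simp add: sign_avg_def card_Pow)
qed

lemma parallelogram: "((cmod (z + w))\<^sup>2 + (cmod (z - w))\<^sup>2) / 2 = (cmod z)\<^sup>2 + (cmod w)\<^sup>2"
  unfolding cmod_power2 by (simp add: power2_eq_square field_simps)

text \<open>Distinct signs are orthogonal: averaging over one of them is the parallelogram identity,
  which removes its cross terms.\<close>

lemma sign_avg_linear:
  fixes a :: complex and c :: "'a \<Rightarrow> complex"
  assumes "finite I"
  shows "sign_avg I (\<lambda>S. (cmod (a + (\<Sum>i\<in>I. c i * rsign S i)))\<^sup>2) = (cmod a)\<^sup>2 + (\<Sum>i\<in>I. (cmod (c i))\<^sup>2)"
  using assms
proof (induction I arbitrary: a)
  case (insert n I)
  have "((cmod (a + (\<Sum>i\<in>insert n I. c i * rsign S i)))\<^sup>2 + (cmod (a + (\<Sum>i\<in>insert n I. c i * rsign (insert n S) i)))\<^sup>2) / 2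
     = (cmod (a + (\<Sum>i\<in>I. c i * rsign S i)))\<^sup>2 + (cmod (c n))\<^sup>2" if "S \<subseteq> I" for S
  proof -
    have "(\<Sum>i\<in>I. c i * rsign (insert n S) i) = (\<Sum>i\<in>I. c i * rsign S i)"
      using insert.hyps by (intro sum.cong) (auto simp: rsign_def)
    then have "a + (\<Sum>i\<in>insert n I. c i * rsign (insert n S) i) = (a + (\<Sum>i\<in>I. c i * rsign S i)) - c n"
      "a + (\<Sum>i\<in>insert n I. c i * rsign S i) = (a + (\<Sum>i\<in>I. c i * rsign S i)) + c n"
      using insert.hyps that by (auto simp: rsign_def)
    then show ?thesis by (simp only: parallelogram)
  qed
  then have "sign_avg (insert n I) (\<lambda>S. (cmod (a + (\<Sum>i\<in>insert n I. c i * rsign S i)))\<^sup>2) =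
     sign_avg I (\<lambda>S. (cmod (a + (\<Sum>i\<in>I. c i * rsign S i)))\<^sup>2 + (cmod (c n))\<^sup>2)"
    unfolding sign_avg_insert[OF insert.hyps] by (intro sign_avg_cong)
  then show ?case using insert by (simp add: sign_avg_add sign_avg_const)
qed simp

lemma cmod_add_square_le: "(cmod (x + y))\<^sup>2 \<le> 2 * ((cmod x)\<^sup>2 + (cmod y)\<^sup>2)"
proof -
  have "(cmod (x + y))\<^sup>2 + (cmod (x - y))\<^sup>2 = 2 * ((cmod x)\<^sup>2 + (cmod y)\<^sup>2)"
    using parallelogram[of x y] by (simp add: field_simps)
  moreover have "0 \<le> (cmod (x - y))\<^sup>2" by simp
  ultimately show ?thesis by linarith
qed

text \<open>Squares of signs are 1, so the diagonal is deterministic, and products of signs over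
  different unordered pairs are orthogonal. The factor 2 arises because \<open>M i j\<close> and
  \<open>M j i\<close> multiply the same product. The shift \<open>a\<close> absorbs one diagonal
  entry in each induction step.\<close>

lemma sign_avg_quadratic:
  fixes a :: complex and M :: "'a \<Rightarrow> 'a \<Rightarrow> complex"
  assumes "finite I"
  shows "sign_avg I (\<lambda>S. (cmod (a + (\<Sum>i\<in>I. \<Sum>j\<in>I. M i j * rsign S i * rsign S j)))\<^sup>2)
    \<le> (cmod (a + (\<Sum>i\<in>I. M i i)))\<^sup>2 + 2 * (\<Sum>i\<in>I. \<Sum>j\<in>I. if i = j then 0 else (cmod (M i j))\<^sup>2)"
  using assms
proof (induction I arbitrary: a)
  case (insert n I)
  let ?Z = "\<lambda>S. \<Sum>i\<in>I. \<Sum>j\<in>I. M i j * rsign S i * rsign S j"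
  let ?L = "\<lambda>S. \<Sum>i\<in>I. (M n i + M i n) * rsign S i"
  have "((cmod (a + (\<Sum>i\<in>insert n I. \<Sum>j\<in>insert n I. M i j * rsign S i * rsign S j)))\<^sup>2 +
      (cmod (a + (\<Sum>i\<in>insert n I. \<Sum>j\<in>insert n I. M i j * rsign (insert n S) i * rsign (insert n S) j)))\<^sup>2) / 2
     = (cmod ((a + M n n) + ?Z S))\<^sup>2 + (cmod (0 + ?L S))\<^sup>2" if "S \<subseteq> I" for S
  proof -
    \<comment> \<open>The entry at \<open>n\<close>, \<open>n\<close> loses its signs and all terms
      with exactly one index \<open>n\<close> form the linear part \<open>?L\<close>, so flipping
      the sign at \<open>n\<close> only changes the sign of \<open>?L\<close>.\<close>
    have exp: "(\<Sum>i\<in>insert n I. \<Sum>j\<in>insert n I. M i j * rsign S' i * rsign S' j) =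
       M n n * rsign S' n * rsign S' n + rsign S' n * ?L S' + ?Z S'" for S'
      using insert.hyps by (simp add: sum.distrib algebra_simps sum_distrib_left)
    have "?L (insert n S) = ?L S" "?Z (insert n S) = ?Z S"
      using insert.hyps by (auto simp: rsign_def intro!: sum.cong)
    moreover have "rsign S n = 1" "rsign (insert n S) n = -1" using that insert.hyps by (auto simp: rsign_def)
    ultimately have "a + (\<Sum>i\<in>insert n I. \<Sum>j\<in>insert n I. M i j * rsign S i * rsign S j) = (a + M n n + ?Z S) + ?L S"
      "a + (\<Sum>i\<in>insert n I. \<Sum>j\<in>insert n I. M i j * rsign (insert n S) i * rsign (insert n S) j) = (a + M n n + ?Z S) - ?L S"
      unfolding exp by simp_all
    then show ?thesis by (simp only: parallelogram add_0_left)
  qed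
  then have "sign_avg (insert n I) (\<lambda>S. (cmod (a + (\<Sum>i\<in>insert n I. \<Sum>j\<in>insert n I. M i j * rsign S i * rsign S j)))\<^sup>2) =
     sign_avg I (\<lambda>S. (cmod ((a + M n n) + ?Z S))\<^sup>2 + (cmod (0 + ?L S))\<^sup>2)"
    unfolding sign_avg_insert[OF insert.hyps] by (intro sign_avg_cong)
  also have "\<dots> = sign_avg I (\<lambda>S. (cmod ((a + M n n) + ?Z S))\<^sup>2) + (\<Sum>i\<in>I. (cmod (M n i + M i n))\<^sup>2)"
    unfolding sign_avg_add sign_avg_linear[OF insert.hyps(1)] by simp
  also have "\<dots> \<le> ((cmod ((a + M n n) + (\<Sum>i\<in>I. M i i)))\<^sup>2 + 2 * (\<Sum>i\<in>I. \<Sum>j\<in>I. if i = j then 0 else (cmod (M i j))\<^sup>2))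
      + (\<Sum>i\<in>I. 2 * ((cmod (M n i))\<^sup>2 + (cmod (M i n))\<^sup>2))"
    by (intro add_mono insert.IH sum_mono cmod_add_square_le)
  also have "\<dots> = (cmod (a + (\<Sum>i\<in>insert n I. M i i)))\<^sup>2 + 2 * (\<Sum>i\<in>insert n I. \<Sum>j\<in>insert n I. if i = j then 0 else (cmod (M i j))\<^sup>2)"
  proof -
    have "(\<Sum>i\<in>I. if n = i then 0 else (cmod (M n i))\<^sup>2) = (\<Sum>i\<in>I. (cmod (M n i))\<^sup>2)"
      "(\<Sum>i\<in>I. if i = n then 0 else (cmod (M i n))\<^sup>2) = (\<Sum>i\<in>I. (cmod (M i n))\<^sup>2)"
      using insert.hyps by (auto intro!: sum.cong)
    then show ?thesis using insert.hyps by (simp add: sum.distrib algebra_simps flip: sum_distrib_left)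
  qed
  finally show ?case .
qed simp

text \<open>A sum over pairs of positions is the form of a matrix supported on these pairs;
  injectivity prevents two coefficients from landing on the same entry. The fluctuation bound keeps
  the diagonal coefficients for simplicity.\<close>

lemma sign_avg_quadratic_family:
  fixes m :: "'b \<Rightarrow> complex"
  assumes I: "finite I" and K: "finite K" and inj: "inj_on (\<lambda>k. (\<alpha> k, \<beta> k)) K"
    and img: "\<And>k. k \<in> K \<Longrightarrow> \<alpha> k \<in> I" "\<And>k. k \<in> K \<Longrightarrow> \<beta> k \<in> I"
  shows "sign_avg I (\<lambda>S. (cmod (\<Sum>k\<in>K. m k * rsign S (\<alpha> k) * rsign S (\<beta> k)))\<^sup>2)
    \<le> (cmod (\<Sum>k\<in>{k\<in>K. \<alpha> k = \<beta> k}. m k))\<^sup>2 + 2 * (\<Sum>k\<in>K. (cmod (m k))\<^sup>2)"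
proof -
  let ?g = "\<lambda>k. (\<alpha> k, \<beta> k)"
  define M where "M i j = (if (i,j) \<in> ?g ` K then m (the_inv_into K ?g (i,j)) else 0)" for i j
  have Mg: "M (\<alpha> k) (\<beta> k) = m k" if "k \<in> K" for k
    using that the_inv_into_f_f[OF inj that] by (auto simp: M_def)
  have M0: "(i,j) \<notin> ?g ` K \<Longrightarrow> M i j = 0" for i j by (simp add: M_def)
  have reindex: "(\<Sum>i\<in>I. \<Sum>j\<in>I. F i j) = (\<Sum>k\<in>K. F (\<alpha> k) (\<beta> k))"
    if "\<And>i j. (i,j) \<notin> ?g ` K \<Longrightarrow> F i j = 0" for F :: "'a \<Rightarrow> 'a \<Rightarrow> 'c :: comm_monoid_add"
  proof -
    have "(\<Sum>i\<in>I. \<Sum>j\<in>I. F i j) = (\<Sum>p\<in>I\<times>I. F (fst p) (snd p))"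
      by (simp add: sum.cartesian_product case_prod_beta)
    also have "\<dots> = (\<Sum>p\<in>?g ` K. F (fst p) (snd p))"
      using I img that by (intro sum.mono_neutral_right) auto
    also have "\<dots> = (\<Sum>k\<in>K. F (\<alpha> k) (\<beta> k))"
      using inj by (subst sum.reindex) auto
    finally show ?thesis .
  qed
  have 1: "(\<Sum>i\<in>I. \<Sum>j\<in>I. M i j * rsign S i * rsign S j) = (\<Sum>k\<in>K. m k * rsign S (\<alpha> k) * rsign S (\<beta> k))" for S
    by (subst reindex) (simp_all add: M0 Mg)
  have "(\<Sum>i\<in>I. M i i) = (\<Sum>i\<in>I. \<Sum>j\<in>I. if i = j then M i j else 0)"
    using I by simp
  also have "\<dots> = (\<Sum>k\<in>K. if \<alpha> k = \<beta> k then M (\<alpha> k) (\<beta> k) else 0)"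
    by (rule reindex) (auto simp: M_def)
  also have "\<dots> = (\<Sum>k\<in>{k\<in>K. \<alpha> k = \<beta> k}. m k)"
  proof -
    have "(\<Sum>k\<in>K. if \<alpha> k = \<beta> k then M (\<alpha> k) (\<beta> k) else 0) = (\<Sum>k\<in>K. if \<alpha> k = \<beta> k then m k else 0)"
      by (intro sum.cong refl) (simp only: Mg)
    then show ?thesis using K by (simp add: sum.inter_filter)
  qed
  finally have 2: "(\<Sum>i\<in>I. M i i) = (\<Sum>k\<in>{k\<in>K. \<alpha> k = \<beta> k}. m k)" .
  have "(\<Sum>i\<in>I. \<Sum>j\<in>I. if i = j then 0 else (cmod (M i j))\<^sup>2) \<le> (\<Sum>i\<in>I. \<Sum>j\<in>I. (cmod (M i j))\<^sup>2)"
    by (intro sum_mono) auto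
  also have "\<dots> = (\<Sum>k\<in>K. (cmod (M (\<alpha> k) (\<beta> k)))\<^sup>2)"
    by (rule reindex) (auto simp: M_def)
  also have "\<dots> = (\<Sum>k\<in>K. (cmod (m k))\<^sup>2)" by (simp add: Mg)
  finally have 3: "(\<Sum>i\<in>I. \<Sum>j\<in>I. if i = j then 0 else (cmod (M i j))\<^sup>2) \<le> (\<Sum>k\<in>K. (cmod (m k))\<^sup>2)" .
  show ?thesis using sign_avg_quadratic[OF I, of 0 M] 3 unfolding 1 2 by simp
qed

lemma sign_avg_block_norm:
  fixes f :: "'b \<Rightarrow> complex" and c e E :: nat
  assumes "finite T" "e < E"
  shows "sign_avg ({..<E} \<times> {..<c} \<times> T) (\<lambda>S. \<Sum>\<gamma><c. (cmod (\<Sum>b\<in>T. f b * rsign S (e,\<gamma>,b)))\<^sup>2) = c * (\<Sum>b\<in>T. (cmod (f b))\<^sup>2)"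
proof -
  let ?I = "{..<E} \<times> {..<c} \<times> T"
  have "sign_avg ?I (\<lambda>S. (cmod (\<Sum>b\<in>T. f b * rsign S (e,\<gamma>,b)))\<^sup>2) = (\<Sum>b\<in>T. (cmod (f b))\<^sup>2)" if "\<gamma> < c" for \<gamma>
  proof -
    \<comment> \<open>One row of the sign matrix as a linear form in all signs.\<close>
    define g where "g i = (if fst i = e \<and> fst (snd i) = \<gamma> then f (snd (snd i)) else 0)" for i
    have red: "(\<Sum>i\<in>?I. F i) = (\<Sum>b\<in>T. F (e,\<gamma>,b))"
      if z: "\<And>i. \<not> (fst i = e \<and> fst (snd i) = \<gamma>) \<Longrightarrow> F i = 0" for F :: "nat \<times> nat \<times> 'b \<Rightarrow> 'c :: comm_monoid_add"
    proof -
      have "(\<Sum>i\<in>?I. F i) = (\<Sum>i\<in>(\<lambda>b. (e,\<gamma>,b)) ` T. F i)"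
      proof (intro sum.mono_neutral_right ballI)
        fix i assume "i \<in> ?I - (\<lambda>b. (e,\<gamma>,b)) ` T"
        then have "\<not> (fst i = e \<and> fst (snd i) = \<gamma>)" by (cases i) auto
        then show "F i = 0" by (rule z)
      qed (use assms \<open>\<gamma> < c\<close> in auto)
      then show ?thesis by (simp add: sum.reindex inj_on_def)
    qed
    have "sign_avg ?I (\<lambda>S. (cmod (0 + (\<Sum>i\<in>?I. g i * rsign S i)))\<^sup>2) = (cmod 0)\<^sup>2 + (\<Sum>i\<in>?I. (cmod (g i))\<^sup>2)"
      using assms by (intro sign_avg_linear) auto
    then show ?thesis by (subst (asm) (1 2) red) (auto simp: g_def)
  qed
  then show ?thesis unfolding sign_avg_sum by simp
qed

text \<open>Bounds the entries of the Gram matrix of the images seen by the decoder. Positions of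
  different blocks never coincide, so a mean survives only for \<open>e = e'\<close>, where it is
  \<open>c\<close> times the inner product; the rest is fluctuation.\<close>

lemma sign_avg_block_overlap:
  fixes f g :: "'a \<Rightarrow> complex" and c e e' E :: nat
  assumes T: "finite T" and e: "e < E" "e' < E"
  shows "sign_avg ({..<E} \<times> {..<c} \<times> T) (\<lambda>S. (cmod (\<Sum>\<gamma><c. cnj (\<Sum>b\<in>T. f b * rsign S (e,\<gamma>,b)) * (\<Sum>b\<in>T. g b * rsign S (e',\<gamma>,b))))\<^sup>2)
    \<le> (if e = e' then (c * cmod (\<Sum>b\<in>T. cnj (f b) * g b))\<^sup>2 else 0)
        + 2 * c * (\<Sum>b\<in>T. (cmod (f b))\<^sup>2) * (\<Sum>b\<in>T. (cmod (g b))\<^sup>2)"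
proof -
  let ?I = "{..<E} \<times> {..<c} \<times> T" and ?K = "{..<c} \<times> T \<times> T"
  define \<alpha> \<beta> m where "\<alpha> = (\<lambda>k::nat \<times> 'a \<times> 'a. (e, fst k, fst (snd k)))" and "\<beta> = (\<lambda>k::nat \<times> 'a \<times> 'a. (e', fst k, snd (snd k)))"
    and "m = (\<lambda>k::nat \<times> 'a \<times> 'a. cnj (f (fst (snd k))) * g (snd (snd k)))"
  have 1: "(\<Sum>\<gamma><c. cnj (\<Sum>b\<in>T. f b * rsign S (e,\<gamma>,b)) * (\<Sum>b\<in>T. g b * rsign S (e',\<gamma>,b))) =
     (\<Sum>k\<in>?K. m k * rsign S (\<alpha> k) * rsign S (\<beta> k))" for S
    unfolding cnj_sum sum_product sum.cartesian_product case_prod_beta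
    by (intro sum.cong refl) (simp add: \<alpha>_def \<beta>_def m_def mult_ac)
  have 2: "(\<Sum>k\<in>{k\<in>?K. \<alpha> k = \<beta> k}. m k) = (if e = e' then c * (\<Sum>b\<in>T. cnj (f b) * g b) else 0)"
  proof (cases "e = e'")
    case True
    have "{k\<in>?K. \<alpha> k = \<beta> k} = (\<lambda>(\<gamma>,b). (\<gamma>,b,b)) ` ({..<c} \<times> T)"
      using True by (auto simp: \<alpha>_def \<beta>_def)
    then have "(\<Sum>k\<in>{k\<in>?K. \<alpha> k = \<beta> k}. m k) = (\<Sum>(\<gamma>,b)\<in>{..<c} \<times> T. cnj (f b) * g b)"
      by (simp add: sum.reindex inj_on_def case_prod_beta m_def)
    then show ?thesis using True by (simp flip: sum.cartesian_product)
  qed (auto simp: \<alpha>_def \<beta>_def)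
  have 3: "(\<Sum>k\<in>?K. (cmod (m k))\<^sup>2) = c * ((\<Sum>b\<in>T. (cmod (f b))\<^sup>2) * (\<Sum>b\<in>T. (cmod (g b))\<^sup>2))"
  proof -
    have "(\<Sum>k\<in>?K. (cmod (m k))\<^sup>2) = (\<Sum>\<gamma><c. \<Sum>b\<in>T. \<Sum>b'\<in>T. (cmod (f b))\<^sup>2 * (cmod (g b'))\<^sup>2)"
      unfolding sum.cartesian_product by (simp add: m_def norm_mult power_mult_distrib case_prod_beta)
    then show ?thesis by (simp add: sum_product)
  qed
  have "sign_avg ?I (\<lambda>S. (cmod (\<Sum>k\<in>?K. m k * rsign S (\<alpha> k) * rsign S (\<beta> k)))\<^sup>2)
    \<le> (cmod (\<Sum>k\<in>{k\<in>?K. \<alpha> k = \<beta> k}. m k))\<^sup>2 + 2 * (\<Sum>k\<in>?K. (cmod (m k))\<^sup>2)"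
    using T e by (intro sign_avg_quadratic_family) (auto simp: inj_on_def \<alpha>_def \<beta>_def)
  then show ?thesis unfolding 1 2 3 by (auto simp: norm_mult split: if_splits)
qed

text \<open>Bounds the off-diagonal Gram entries of Bob's sign matrix. Two different columns share
  no position, so there is only fluctuation.\<close>

lemma sign_avg_column_overlap:
  fixes T :: "'a set" and c E :: nat
  assumes T: "finite T" and b: "b \<in> T" "b' \<in> T" "b \<noteq> b'"
  shows "sign_avg ({..<E} \<times> {..<c} \<times> T) (\<lambda>S. (cmod (\<Sum>e<E. \<Sum>\<gamma><c. complex_of_real (rsign S (e,\<gamma>,b) * rsign S (e,\<gamma>,b'))))\<^sup>2)
    \<le> 2 * (real E * real c)"
proof -
  let ?I = "{..<E} \<times> {..<c} \<times> T" and ?K = "{..<E} \<times> {..<c}"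
  define \<alpha> \<beta> where "\<alpha> = (\<lambda>k::nat \<times> nat. (fst k, snd k, b))" and "\<beta> = (\<lambda>k::nat \<times> nat. (fst k, snd k, b'))"
  have 1: "(\<Sum>e<E. \<Sum>\<gamma><c. complex_of_real (rsign S (e,\<gamma>,b) * rsign S (e,\<gamma>,b'))) =
     (\<Sum>k\<in>?K. (1::complex) * complex_of_real (rsign S (\<alpha> k)) * complex_of_real (rsign S (\<beta> k)))" for S
    by (simp add: \<alpha>_def \<beta>_def sum.cartesian_product case_prod_beta)
  have "sign_avg ?I (\<lambda>S. (cmod (\<Sum>k\<in>?K. (1::complex) * complex_of_real (rsign S (\<alpha> k)) * complex_of_real (rsign S (\<beta> k))))\<^sup>2)
    \<le> (cmod (\<Sum>k\<in>{k\<in>?K. \<alpha> k = \<beta> k}. 1))\<^sup>2 + 2 * (\<Sum>k\<in>?K. (cmod (1::complex))\<^sup>2)"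
    using T b by (intro sign_avg_quadratic_family) (auto simp: inj_on_def \<alpha>_def \<beta>_def)
  moreover have "{k\<in>?K. \<alpha> k = \<beta> k} = {}" using b by (auto simp: \<alpha>_def \<beta>_def)
  ultimately show ?thesis unfolding 1 by (simp only:) simp
qed

section \<open>Kronecker products and channels\<close>

lemma sum_lessThan_mult: "(\<Sum>k<a*b. f k) = (\<Sum>i<a. \<Sum>j<b. f (i*b+j))" for a b :: nat
proof -
  have "(\<Sum>k<a*b. f k) = (\<Sum>i<a. sum f {i*b..<i*b+b})" by (rule sum.nat_group[symmetric])
  also have "\<dots> = (\<Sum>i<a. \<Sum>j<b. f (i*b+j))"
  proof (rule sum.cong[OF refl])
    fix i
    show "sum f {i*b..<i*b+b} = (\<Sum>j<b. f (i*b+j))"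
      using sum.shift_bounds_nat_ivl[of f 0 "i*b" b] by (simp add: atLeast0LessThan add.commute)
  qed
  finally show ?thesis .
qed

lemma pair_index_less: "i < a \<Longrightarrow> j < b \<Longrightarrow> i * b + j < a * (b::nat)"
  using mult_le_mono1[of "Suc i" a b] by simp

lemma dim_kron[simp]: "dim_row (kron A B) = dim_row A * dim_row B" "dim_col (kron A B) = dim_col A * dim_col B"
  by (auto simp: kron_def)

lemma index_kron:
  "i < dim_row A * dim_row B \<Longrightarrow> j < dim_col A * dim_col B \<Longrightarrow>
    kron A B $$ (i,j) = A $$ (i div dim_row B, j div dim_col B) * B $$ (i mod dim_row B, j mod dim_col B)"
  by (auto simp: kron_def)

lemma div_mod_less: "i < a * b \<Longrightarrow> i div b < a" "i < a * b \<Longrightarrow> i mod b < b" for a b :: nat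
  by (auto simp: less_mult_imp_div_less intro!: mod_less_divisor Nat.gr0I)

lemma kron_mult:
  assumes "dim_col A = dim_row C" "dim_col B = dim_row D"
  shows "kron A B * kron C D = kron (A * C) (B * D)"
proof (rule eq_matI)
  fix i j assume "i < dim_row (kron (A * C) (B * D))" "j < dim_col (kron (A * C) (B * D))"
  then have i: "i < dim_row A * dim_row B" and j: "j < dim_col C * dim_col D" by auto
  note ij = div_mod_less[OF i] div_mod_less[OF j]
  have "(kron A B * kron C D) $$ (i,j) = (\<Sum>k<dim_row C * dim_row D. kron A B $$ (i,k) * kron C D $$ (k,j))"
    using i j assms by (subst mult_entry) auto
  also have "\<dots> = (\<Sum>a<dim_row C. \<Sum>b<dim_row D. (A $$ (i div dim_row B, a) * C $$ (a, j div dim_col D)) *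
      (B $$ (i mod dim_row B, b) * D $$ (b, j mod dim_col D)))"
    unfolding sum_lessThan_mult using i j assms pair_index_less[of _ "dim_row C" _ "dim_row D"]
    by (intro sum.cong refl) (auto simp: index_kron)
  also have "\<dots> = (A * C) $$ (i div dim_row B, j div dim_col D) * (B * D) $$ (i mod dim_row B, j mod dim_col D)"
    using ij assms by (simp add: mult_entry sum_product del: index_mult_mat(1))
  also have "\<dots> = kron (A * C) (B * D) $$ (i,j)" using i j by (subst index_kron) auto
  finally show "(kron A B * kron C D) $$ (i,j) = kron (A * C) (B * D) $$ (i,j)" .
qed auto

lemma kron_adj: "adj (kron A B) = kron (adj A) (adj B)"
  by (rule eq_matI) (auto simp: index_kron div_mod_less)

lemma kron_assoc: "kron (kron A B) C = kron A (kron B C)"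
proof (rule eq_matI)
  fix i j assume "i < dim_row (kron A (kron B C))" "j < dim_col (kron A (kron B C))"
  then have i: "i < dim_row A * (dim_row B * dim_row C)" "i < dim_row A * dim_row B * dim_row C"
    and j: "j < dim_col A * (dim_col B * dim_col C)" "j < dim_col A * dim_col B * dim_col C" by (auto simp: mult.assoc)
  have d: "i div c div b = i div (b * c)" "i mod (b * c) div c = i div c mod b" "i mod (b * c) mod c = i mod c" for i b c :: nat
  proof -
    have e: "i mod (b * c) = c * (i div c mod b) + i mod c" using mod_mult2_eq[of i c b] by (simp add: mult.commute)
    show "i div c div b = i div (b * c)" using div_mult2_eq[of i c b] by (simp add: mult.commute)
    show "i mod (b * c) div c = i div c mod b" "i mod (b * c) mod c = i mod c" unfolding e by (cases "c = 0", auto)+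
  qed
  show "kron (kron A B) C $$ (i,j) = kron A (kron B C) $$ (i,j)"
    using i j div_mod_less[OF i(1)] div_mod_less[OF i(2)] div_mod_less[OF j(1)] div_mod_less[OF j(2)]
    by (simp add: index_kron d mult.assoc)
qed (auto simp: mult.assoc)

lemma kron_one: "kron (1\<^sub>m a) (1\<^sub>m b) = 1\<^sub>m (a * b)"
proof (rule eq_matI)
  fix i j assume "i < dim_row (1\<^sub>m (a*b) :: complex mat)" "j < dim_col (1\<^sub>m (a*b) :: complex mat)"
  then have ij: "i < a * b" "j < a * b" by auto
  have "i = j \<longleftrightarrow> i div b = j div b \<and> i mod b = j mod b" by (metis div_mult_mod_eq)
  then show "kron (1\<^sub>m a) (1\<^sub>m b) $$ (i,j) = (1\<^sub>m (a*b) :: complex mat) $$ (i,j)"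
    using ij div_mod_less[OF ij(1)] div_mod_less[OF ij(2)] by (auto simp: index_kron)
qed auto

lemma kron_1x1: "dim_row A = 1 \<Longrightarrow> dim_col A = 1 \<Longrightarrow> dim_row B = 1 \<Longrightarrow> dim_col B = 1 \<Longrightarrow>
   kron A B $$ (0,0) = A $$ (0,0) * B $$ (0,0)"
  by (simp add: index_kron)

section \<open>Kraus lists and their action\<close>

lemma foldr_add_mat:
  assumes "\<And>K. K \<in> set Ks \<Longrightarrow> f K \<in> carrier_mat a b"
  shows "foldr (\<lambda>K acc. f K + acc) Ks (0\<^sub>m a b) \<in> carrier_mat a b"
    "i < a \<Longrightarrow> j < b \<Longrightarrow> foldr (\<lambda>K acc. f K + acc) Ks (0\<^sub>m a b) $$ (i,j) = (\<Sum>K\<leftarrow>Ks. f K $$ (i,j))"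
proof -
  have "foldr (\<lambda>K acc. f K + acc) Ks (0\<^sub>m a b) \<in> carrier_mat a b \<and> (i < a \<longrightarrow> j < b \<longrightarrow>
    foldr (\<lambda>K acc. f K + acc) Ks (0\<^sub>m a b) $$ (i,j) = (\<Sum>K\<leftarrow>Ks. f K $$ (i,j)))"
    using assms by (induction Ks) auto
  then show "foldr (\<lambda>K acc. f K + acc) Ks (0\<^sub>m a b) \<in> carrier_mat a b"
    "i < a \<Longrightarrow> j < b \<Longrightarrow> foldr (\<lambda>K acc. f K + acc) Ks (0\<^sub>m a b) $$ (i,j) = (\<Sum>K\<leftarrow>Ks. f K $$ (i,j))" by auto
qed

lemma apply_channel_simps:
  "apply_channel d [] \<rho> = 0\<^sub>m d d"
  "apply_channel d (K # Ks) \<rho> = K * \<rho> * adj K + apply_channel d Ks \<rho>"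
  by (auto simp: apply_channel_def)

lemma conj_carrier: "K \<in> carrier_mat e d \<Longrightarrow> K * \<rho> * adj K \<in> carrier_mat e e"
  by (rule carrier_matI) simp_all

lemma apply_channel_carrier:
  assumes "\<And>K. K \<in> set Ks \<Longrightarrow> K \<in> carrier_mat e d"
  shows "apply_channel e Ks \<rho> \<in> carrier_mat e e"
  unfolding apply_channel_def using assms by (intro foldr_add_mat conj_carrier) auto

lemma apply_channel_append:
  assumes "\<And>K. K \<in> set (Ks @ Ls) \<Longrightarrow> K \<in> carrier_mat e d"
  shows "apply_channel e (Ks @ Ls) \<rho> = apply_channel e Ks \<rho> + apply_channel e Ls \<rho>"
  using assms
proof (induction Ks)
  case Nil
  then show ?case using apply_channel_carrier[of Ls e d \<rho>] by (simp add: apply_channel_simps)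
next
  case (Cons K Ks)
  have "K \<in> carrier_mat e d" using Cons.prems by auto
  then have "K * \<rho> * adj K \<in> carrier_mat e e" by (rule conj_carrier)
  moreover have "apply_channel e Ks \<rho> \<in> carrier_mat e e" "apply_channel e Ls \<rho> \<in> carrier_mat e e"
    using Cons.prems by (auto intro!: apply_channel_carrier[of _ e d])
  ultimately show ?case using Cons by (simp add: apply_channel_simps assoc_add_mat[of _ e e])
qed

lemma apply_channel_psd:
  assumes "psd \<rho>" "\<rho> \<in> carrier_mat d d" "\<And>K. K \<in> set Ks \<Longrightarrow> K \<in> carrier_mat e d"
  shows "psd (apply_channel e Ks \<rho>)"
  using assms(3)
proof (induction Ks)
  case Nil
  then show ?case by (simp add: apply_channel_simps psd_zero)
next
  case (Cons K Ks)
  then have K: "K \<in> carrier_mat e d" by auto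
  have "psd (K * \<rho> * adj K)" using psd_conj[OF assms(1,2) K] .
  moreover have "K * \<rho> * adj K \<in> carrier_mat e e" using K by (rule conj_carrier)
  moreover have "apply_channel e Ks \<rho> \<in> carrier_mat e e"
    using Cons.prems by (intro apply_channel_carrier[of _ e d]) auto
  ultimately show ?case using Cons by (auto simp: apply_channel_simps intro!: psd_add[of _ _ e])
qed

lemma conj_mult:
  assumes "L \<in> carrier_mat e d" "K \<in> carrier_mat d c" "\<rho> \<in> carrier_mat c c"
  shows "L * (K * \<rho> * adj K) * adj L = (L * K) * \<rho> * adj (L * K)"
  using assms by (simp add: mat_assoc adj_mult_dim)

lemma apply_channel_conj:
  assumes L: "L \<in> carrier_mat f e" and \<rho>: "\<rho> \<in> carrier_mat d d" and Ks: "\<And>K. K \<in> set Ks \<Longrightarrow> K \<in> carrier_mat e d"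
  shows "L * apply_channel e Ks \<rho> * adj L = apply_channel f (map (\<lambda>K. L * K) Ks) \<rho>"
  using Ks
proof (induction Ks)
  case Nil
  then show ?case using L by (simp add: apply_channel_simps)
next
  case (Cons K Ks)
  then have K: "K \<in> carrier_mat e d" by auto
  have A: "apply_channel e Ks \<rho> \<in> carrier_mat e e" "K * \<rho> * adj K \<in> carrier_mat e e"
    using Cons.prems K by (auto intro!: apply_channel_carrier[of _ e d] conj_carrier)
  have "L * (K * \<rho> * adj K + apply_channel e Ks \<rho>) * adj L = L * (K * \<rho> * adj K) * adj L + L * apply_channel e Ks \<rho> * adj L"
    using A L by (simp add: mult_add_distrib_mat[of _ f e _ e] add_mult_distrib_mat[of _ f e _ _ f])
  then show ?case using Cons conj_mult[OF L K \<rho>] by (simp add: apply_channel_simps)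
qed

lemma apply_channel_comp:
  assumes \<rho>: "\<rho> \<in> carrier_mat d d" and Ks: "\<And>K. K \<in> set Ks \<Longrightarrow> K \<in> carrier_mat e d" and Ls: "\<And>L. L \<in> set Ls \<Longrightarrow> L \<in> carrier_mat f e"
  shows "apply_channel f Ls (apply_channel e Ks \<rho>) = apply_channel f (concat (map (\<lambda>L. map (\<lambda>K. L * K) Ks) Ls)) \<rho>"
  using Ls
proof (induction Ls)
  case Nil
  then show ?case by (simp add: apply_channel_simps)
next
  case (Cons L Ls)
  have "apply_channel f (concat (map (\<lambda>L. map (\<lambda>K. L * K) Ks) (L # Ls))) \<rho> =
     apply_channel f (map (\<lambda>K. L * K) Ks) \<rho> + apply_channel f (concat (map (\<lambda>L. map (\<lambda>K. L * K) Ks) Ls)) \<rho>"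
    using Cons.prems Ks unfolding list.map concat.simps
    by (intro apply_channel_append[of _ _ f d]) (auto intro!: mult_carrier_mat[of _ f e _ d])
  moreover have "L * apply_channel e Ks \<rho> * adj L = apply_channel f (map (\<lambda>K. L * K) Ks) \<rho>"
    using Cons.prems by (intro apply_channel_conj[OF _ \<rho> Ks]) auto
  ultimately show ?case using Cons by (simp add: apply_channel_simps)
qed

text \<open>If every Kraus operator is diagonal between the vectors of the ensemble, then the output
  commutes with the ensemble and the fidelity is classical.\<close>
lemma fidelity_apply_channel:
  assumes W: "W \<in> carrier_mat d n" and As: "\<And>A. A \<in> set As \<Longrightarrow> A \<in> carrier_mat d d"
    and diag: "\<And>A. A \<in> set As \<Longrightarrow> adj W * A * W = mat_diag n (g A)"
  shows "fidelity (W * adj W) (apply_channel d As (W * adj W)) = (\<Sum>x<n. sqrt (\<Sum>A\<leftarrow>As. (cmod (g A x))\<^sup>2))"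
proof (rule fidelity_gram[OF W])
  have WW: "W * adj W \<in> carrier_mat d d" "psd (W * adj W)" using W psd_gram[of "adj W" n d] by auto
  show "psd (apply_channel d As (W * adj W))" using apply_channel_psd[OF WW(2,1) As] .
  show "apply_channel d As (W * adj W) \<in> carrier_mat d d" using apply_channel_carrier[OF As] .
  show "0 \<le> (\<Sum>A\<leftarrow>As. (cmod (g A x))\<^sup>2)" for x by (induction As) auto
  have "adj W * apply_channel d As (W * adj W) * W = apply_channel n (map (\<lambda>A. adj W * A) As) (W * adj W)"
    using apply_channel_conj[OF adj_carrier[OF W] WW(1) As] by simp
  also have "\<dots> = mat_diag n (\<lambda>x. complex_of_real (\<Sum>A\<leftarrow>As. (cmod (g A x))\<^sup>2))"
    using As diag
  proof (induction As)
    case Nil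
    then show ?case by (auto simp: apply_channel_simps mat_diag_def)
  next
    case (Cons A As)
    have A: "A \<in> carrier_mat d d" "adj W * A * W = mat_diag n (g A)" using Cons.prems by auto
    have "adj W * A * (W * adj W) * adj (adj W * A) = (adj W * A * W) * adj (adj W * A * W)"
      using A(1) W by (simp add: mat_assoc adj_mult_dim)
    also have "\<dots> = mat_diag n (\<lambda>x. complex_of_real ((cmod (g A x))\<^sup>2))"
    proof -
      have "adj (mat_diag n (g A)) = mat_diag n (\<lambda>x. cnj (g A x))"
        by (rule eq_matI) (auto simp: mat_diag_def)
      then show ?thesis unfolding A(2) by (simp only: mat_diag_diag complex_norm_square)
    qed
    finally show ?case using Cons by (auto simp: apply_channel_simps mat_diag_def)
  qed
  finally show "adj W * apply_channel d As (W * adj W) * W = mat_diag n (\<lambda>x. complex_of_real (\<Sum>A\<leftarrow>As. (cmod (g A x))\<^sup>2))" .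
qed

section \<open>Rank-one states and marginals\<close>

definition col_mat :: "complex vec \<Rightarrow> complex mat" where
  "col_mat v = mat (dim_vec v) 1 (\<lambda>(i,j). v $ i)"

lemma dim_col_mat[simp]: "dim_row (col_mat v) = dim_vec v" "dim_col (col_mat v) = 1"
  by (auto simp: col_mat_def)

lemma outer_col_mat: "outer v w = col_mat v * adj (col_mat w)"
  by (rule eq_matI) (auto simp: outer_def mult_entry col_mat_def simp del: index_mult_mat(1))

lemma proj_col_mat: "proj d x = col_mat (unit_vec d x) * adj (col_mat (unit_vec d x))" 
  by (rule eq_matI) (auto simp: proj_def mult_entry col_mat_def unit_vec_def simp del: index_mult_mat(1))

lemma dim_proj[simp]: "dim_row (proj d x) = d" "dim_col (proj d x) = d"
  by (auto simp: proj_def)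

abbreviation marginal :: "nat \<Rightarrow> nat \<Rightarrow> complex vec \<Rightarrow> complex mat" where
  "marginal d r v \<equiv> ptrace_right d r (outer v v)"

lemma sandwich_entry:
  assumes "A \<in> carrier_mat a a" "U \<in> carrier_mat a n" "V \<in> carrier_mat a k" "i < n" "j < k"
  shows "(adj U * A * V) $$ (i,j) = (\<Sum>r<a. \<Sum>s<a. cnj (U $$ (r,i)) * A $$ (r,s) * V $$ (s,j))"
proof -
  have "adj U * A * V = adj U * (A * V)" using assms by (simp add: mat_assoc)
  then have "(adj U * A * V) $$ (i,j) = (\<Sum>r<a. cnj (U $$ (r,i)) * (A * V) $$ (r,j))"
    using assms by (simp only:, subst mult_entry'[of _ n a _ k]) auto
  also have "\<dots> = (\<Sum>r<a. \<Sum>s<a. cnj (U $$ (r,i)) * A $$ (r,s) * V $$ (s,j))"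
    using assms by (intro sum.cong refl, subst mult_entry'[of A a a V k]) (auto simp: sum_distrib_left mult.assoc)
  finally show ?thesis .
qed

text \<open>An operator on the first factor sees only the reduced state. This is how the reference
  system drops out of the fidelity.\<close>

lemma expectation_kron_one:
  assumes X: "X \<in> carrier_mat d d" and v: "dim_vec v = d * r"
  shows "(adj (col_mat v) * kron X (1\<^sub>m r) * col_mat v) $$ (0,0) = mtrace (X * marginal d r v)"
proof -
  have "(adj (col_mat v) * kron X (1\<^sub>m r) * col_mat v) $$ (0,0) =
      (\<Sum>k<d*r. \<Sum>l<d*r. cnj (v $ k) * kron X (1\<^sub>m r) $$ (k,l) * v $ l)"
    using X v by (subst sandwich_entry[of _ "d*r" _ 1 _ 1]) (auto simp: col_mat_def)
  also have "\<dots> = (\<Sum>b<d. \<Sum>i<r. \<Sum>b'<d. \<Sum>j<r. if j = i then X $$ (b,b') * (cnj (v $ (b*r+i)) * v $ (b'*r+i)) else 0)"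
    unfolding sum_lessThan_mult
  proof (intro sum.cong refl)
    fix b i b' j assume a: "b \<in> {..<d}" "i \<in> {..<r}" "b' \<in> {..<d}" "j \<in> {..<r}"
    then show "cnj (v $ (b*r+i)) * kron X (1\<^sub>m r) $$ (b*r+i, b'*r+j) * v $ (b'*r+j) =
      (if j = i then X $$ (b,b') * (cnj (v $ (b*r+i)) * v $ (b'*r+i)) else 0)"
      using X pair_index_less[of b d i r] pair_index_less[of b' d j r] by (auto simp: index_kron)
  qed
  also have "\<dots> = (\<Sum>b<d. \<Sum>i<r. \<Sum>b'<d. X $$ (b,b') * (cnj (v $ (b*r+i)) * v $ (b'*r+i)))"
    by (intro sum.cong refl) auto
  also have "\<dots> = (\<Sum>b<d. \<Sum>b'<d. \<Sum>i<r. X $$ (b,b') * (cnj (v $ (b*r+i)) * v $ (b'*r+i)))"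
    by (intro sum.cong refl sum.swap)
  also have "\<dots> = mtrace (X * marginal d r v)"
  proof -
    have "(X * marginal d r v) $$ (b,b) = (\<Sum>b'<d. \<Sum>i<r. X $$ (b,b') * (cnj (v $ (b*r+i)) * v $ (b'*r+i)))"
      if "b < d" for b
      using X that pair_index_less[of _ d _ r] v
      by (subst mult_entry'[of _ d d _ d]) (auto simp: ptrace_right_def outer_def sum_distrib_left mult_ac)
    then show ?thesis using X by (auto simp: mtrace_def simp del: index_mult_mat(1))
  qed
  finally show ?thesis .
qed

lemma kron_carrier: "A \<in> carrier_mat a b \<Longrightarrow> B \<in> carrier_mat c d \<Longrightarrow> kron A B \<in> carrier_mat (a * c) (b * d)"
  by (auto simp: kron_def)

lemma proj_carrier: "proj d x \<in> carrier_mat d d"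
  by (simp add: proj_def)

section \<open>Channels from partial isometries and classical control\<close>

lemma is_channel_iff:
  assumes "\<And>K. K \<in> set Ks \<Longrightarrow> K \<in> carrier_mat b a"
  shows "is_channel a b Ks \<longleftrightarrow> apply_channel a (map adj Ks) (1\<^sub>m b) = 1\<^sub>m a"
proof -
  have "foldr (\<lambda>K acc. adj K * K + acc) Ks (0\<^sub>m a a) = apply_channel a (map adj Ks) (1\<^sub>m b)"
    using assms
  proof (induction Ks)
    case (Cons K Ks)
    then have "adj K * 1\<^sub>m b * adj (adj K) = adj K * K"
      using right_mult_one_mat[OF adj_carrier[of K b a]] by simp
    then show ?case using Cons by (simp add: apply_channel_simps)
  qed (simp add: apply_channel_simps)
  then show ?thesis using assms by (simp add: is_channel_def)
qed

lemma is_channel_iff_entries: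
  assumes "\<And>K. K \<in> set Ks \<Longrightarrow> K \<in> carrier_mat b a"
  shows "is_channel a b Ks \<longleftrightarrow> (\<forall>i<a. \<forall>j<a. (\<Sum>K\<leftarrow>Ks. (adj K * K) $$ (i,j)) = (if i = j then 1 else 0))"
proof -
  have c: "K \<in> set Ks \<Longrightarrow> adj K * K \<in> carrier_mat a a" for K using assms[of K] by auto
  note f = foldr_add_mat[of Ks "\<lambda>K. adj K * K" a a, OF c]
  have "foldr (\<lambda>K acc. adj K * K + acc) Ks (0\<^sub>m a a) = 1\<^sub>m a \<longleftrightarrow>
    (\<forall>i<a. \<forall>j<a. (\<Sum>K\<leftarrow>Ks. (adj K * K) $$ (i,j)) = (if i = j then 1 else 0))" (is "?F = _ \<longleftrightarrow> ?R")
  proof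
    assume "?F = 1\<^sub>m a"
    then show ?R using f(2) by simp
  next
    assume ?R then show "?F = 1\<^sub>m a" using f by (intro eq_matI) auto
  qed
  then show ?thesis using assms by (simp add: is_channel_def)
qed

lemma is_channel_carrier: "is_channel a b Ks \<Longrightarrow> K \<in> set Ks \<Longrightarrow> K \<in> carrier_mat b a"
  by (auto simp: is_channel_def)

text \<open>Kraus operators of \<open>Z\<close> followed by discarding an environment of dimension
  \<open>N\<close>, whose index is the leading part of the row index.\<close>

definition blocks :: "nat \<Rightarrow> nat \<Rightarrow> complex mat \<Rightarrow> complex mat list" where
  "blocks N c Z = map (\<lambda>e. mat c (dim_col Z) (\<lambda>(\<gamma>,b). Z $$ (e*c+\<gamma>,b))) [0..<N]"

text \<open>Kraus operators that apply \<open>Q\<close>, measure in the standard basis and prepare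
  the first basis vector.\<close>

definition first_rows :: "nat \<Rightarrow> complex mat \<Rightarrow> complex mat list" where
  "first_rows c Q = map (\<lambda>k. mat c (dim_col Q) (\<lambda>(\<gamma>,b). if \<gamma> = 0 then Q $$ (k,b) else 0)) [0..<dim_row Q]"

lemma sum_list_upt: "(\<Sum>x\<leftarrow>[0..<n]. f x) = (\<Sum>x<n. f x)"
  by (simp add: interv_sum_list_conv_sum_set_nat atLeast0LessThan)

lemma sum_list_map_concat: "(\<Sum>x\<leftarrow>concat xss. f x) = (\<Sum>xs\<leftarrow>xss. \<Sum>x\<leftarrow>xs. f x)"
  by (induction xss) auto

lemma blocks_gram:
  assumes "Z \<in> carrier_mat (N*c) d" "i < d" "j < d"
  shows "(\<Sum>K\<leftarrow>blocks N c Z. (adj K * K) $$ (i,j)) = (adj Z * Z) $$ (i,j)"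
proof -
  have "(\<Sum>K\<leftarrow>blocks N c Z. (adj K * K) $$ (i,j)) = (\<Sum>e<N. \<Sum>\<gamma><c. cnj (Z $$ (e*c+\<gamma>,i)) * Z $$ (e*c+\<gamma>,j))"
    unfolding blocks_def using assms
    by (simp add: o_def sum_list_upt mult_entry del: index_mult_mat(1))
  also have "\<dots> = (adj Z * Z) $$ (i,j)"
    using assms by (subst mult_entry'[of _ d "N*c" _ d]) (auto simp: sum_lessThan_mult[symmetric, where f = "\<lambda>k. cnj (Z $$ (k,i)) * Z $$ (k,j)"])
  finally show ?thesis .
qed

lemma first_rows_gram:
  assumes "Q \<in> carrier_mat a d" "i < d" "j < d" "c > 0"
  shows "(\<Sum>K\<leftarrow>first_rows c Q. (adj K * K) $$ (i,j)) = (adj Q * Q) $$ (i,j)"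
proof -
  have "(\<Sum>K\<leftarrow>first_rows c Q. (adj K * K) $$ (i,j)) = (\<Sum>k<a. \<Sum>\<gamma><c. if \<gamma> = 0 then cnj (Q $$ (k,i)) * Q $$ (k,j) else 0)"
    unfolding first_rows_def using assms
    by (simp add: o_def sum_list_upt mult_entry if_distrib if_distribR cong: if_cong del: index_mult_mat(1))
  also have "\<dots> = (\<Sum>k<a. cnj (Q $$ (k,i)) * Q $$ (k,j))"
    using assms by (intro sum.cong refl) auto
  also have "\<dots> = (adj Q * Q) $$ (i,j)"
    using assms by (subst mult_entry'[of _ d a _ d]) auto
  finally show ?thesis .
qed

text \<open>The completion resets the orthogonal complement of the initial space to the first basis vector.\<close>
lemma partial_isometry_channel:
  assumes Z: "Z \<in> carrier_mat (N*c) d" and c: "c > 0" and P: "(adj Z * Z) * (adj Z * Z) = adj Z * Z"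
  shows "is_channel d c (blocks N c Z @ first_rows c (1\<^sub>m d - adj Z * Z))"
proof -
  define R where "R = adj Z * Z"
  define Q where "Q = 1\<^sub>m d - R"
  have R: "R \<in> carrier_mat d d" "adj R = R" using Z by (auto simp: R_def adj_mult_dim)
  have Q: "Q \<in> carrier_mat d d" using R by (auto simp: Q_def)
  have "adj Q = Q" unfolding Q_def using R adj_minus[OF one_carrier_mat R(1)] by simp
  moreover have "Q * Q = 1\<^sub>m d * (1\<^sub>m d - R) - R * (1\<^sub>m d - R)"
    unfolding Q_def using R by (intro minus_mult_distrib_mat) auto
  moreover have "R * (1\<^sub>m d - R) = R * 1\<^sub>m d - R * R"
    using R by (intro mult_minus_distrib_mat) auto
  moreover have "R * R = R" using P by (simp add: R_def)
  \<comment> \<open>\<open>Q\<close> is the complementary projection, so its Gram matrix supplies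
    exactly what the blocks of \<open>Z\<close> lack to the identity.\<close>
  ultimately have QQ: "adj Q * Q = 1\<^sub>m d - R" using R by (auto intro!: eq_matI simp: one_mult_dim)
  show ?thesis unfolding R_def[symmetric] Q_def[symmetric]
  proof (subst is_channel_iff_entries)
    show "\<And>K. K \<in> set (blocks N c Z @ first_rows c Q) \<Longrightarrow> K \<in> carrier_mat c d"
      using Z Q by (auto simp: blocks_def first_rows_def)
    have "(\<Sum>K\<leftarrow>blocks N c Z @ first_rows c Q. (adj K * K) $$ (i,j)) = (if i = j then 1 else 0)" if "i < d" "j < d" for i j
      using blocks_gram[OF Z that] first_rows_gram[OF Q that c] that R unfolding QQ R_def[symmetric] by simp
    then show "\<forall>i<d. \<forall>j<d. (\<Sum>K\<leftarrow>blocks N c Z @ first_rows c Q. (adj K * K) $$ (i,j)) = (if i = j then 1 else 0)" by blast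
  qed
qed

lemma channel_unitary_left:
  assumes "is_channel a b Ks" "unitary b U"
  shows "is_channel a b (map (\<lambda>K. U * K) Ks)"
proof -
  note c = is_channel_carrier[OF assms(1)] and Uc = unitaryD[OF assms(2)]
  have "adj (U * K) * (U * K) = adj K * K" if "K \<in> set Ks" for K
  proof -
    have "adj (U * K) * (U * K) = adj K * ((adj U * U) * K)"
      using c[OF that] Uc(1) by (simp add: mat_assoc adj_mult_dim)
    then show ?thesis using c[OF that] by (simp add: Uc(3) one_mult_dim)
  qed
  then have *: "(\<Sum>K\<leftarrow>map (\<lambda>K. U * K) Ks. (adj K * K) $$ (i,j)) = (\<Sum>K\<leftarrow>Ks. (adj K * K) $$ (i,j))" for i j
    by (simp add: o_def cong: map_cong)
  have "K \<in> set (map (\<lambda>K. U * K) Ks) \<Longrightarrow> K \<in> carrier_mat b a" for K using c Uc(1) by auto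
  then show ?thesis using assms(1) by (simp only: is_channel_iff_entries[OF c] is_channel_iff_entries *)
qed

lemma channel_unitary_right:
  assumes "is_channel a b Ks" "unitary a (adj U)" "U \<in> carrier_mat a a"
  shows "is_channel a b (map (\<lambda>K. K * U) Ks)"
proof -
  note c = is_channel_carrier[OF assms(1)]
  have ca: "K \<in> set (map (\<lambda>K. K * U) Ks) \<Longrightarrow> K \<in> carrier_mat b a" for K
    using mult_carrier_mat[OF c assms(3)] by auto
  have "map adj (map (\<lambda>K. K * U) Ks) = map (\<lambda>K. adj U * K) (map adj Ks)"
    using adj_mult[OF c assms(3)] by auto
  then have "apply_channel a (map adj (map (\<lambda>K. K * U) Ks)) (1\<^sub>m b) = adj U * apply_channel a (map adj Ks) (1\<^sub>m b) * adj (adj U)"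
    using c assms(3) by (simp only:) (subst apply_channel_conj[of _ a a _ b], auto)
  also have "\<dots> = adj U * adj (adj U)"
    using assms(1,3) by (simp add: is_channel_iff[OF c] one_mult_dim)
  also have "\<dots> = 1\<^sub>m a" using unitaryD(4)[OF assms(2)] .
  finally show ?thesis by (simp only: is_channel_iff[OF ca])
qed

abbreviation controlled :: "nat \<Rightarrow> (nat \<Rightarrow> complex mat list) \<Rightarrow> complex mat list" where
  "controlled M Ds \<equiv> concat (map (\<lambda>x. map (kron (proj M x)) (Ds x)) [0..<M])"

text \<open>The projectors confine each \<open>x\<close> to its own diagonal block, where the
  completeness relation is that of \<open>Ds x\<close>.\<close>

lemma controlled_channel:
  assumes "\<And>x. x < M \<Longrightarrow> is_channel c d (Ds x)"
  shows "is_channel (M*c) (M*d) (controlled M Ds)" (is "is_channel _ _ ?L")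
proof (subst is_channel_iff_entries)
  note c = is_channel_carrier[OF assms]
  show "\<And>K. K \<in> set ?L \<Longrightarrow> K \<in> carrier_mat (M*d) (M*c)"
    using kron_carrier[OF proj_carrier c] by auto
  show "\<forall>i<M*c. \<forall>j<M*c. (\<Sum>K\<leftarrow>?L. (adj K * K) $$ (i,j)) = (if i = j then 1 else 0)"
  proof (intro allI impI)
    fix i j assume i: "i < M*c" and j: "j < M*c"
    note ij = div_mod_less[OF i] div_mod_less[OF j]
    have one: "(adj (kron (proj M x) D) * kron (proj M x) D) $$ (i,j) =
       (if i div c = x \<and> j div c = x then 1 else 0) * (adj D * D) $$ (i mod c, j mod c)"
      if x: "x < M" and D: "D \<in> set (Ds x)" for x D
    proof -
      have pp: "adj (proj M x) * proj M x = proj M x"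
      proof (rule eq_matI)
        fix a b assume "a < dim_row (proj M x)" "b < dim_col (proj M x)"
        then have ab: "a < M" "b < M" by auto
        have "(adj (proj M x) * proj M x) $$ (a,b) = (\<Sum>k<M. if k = x then if a = x \<and> b = x then 1 else 0 else 0)"
          using ab by (subst mult_entry, simp, simp, simp, intro sum.cong refl) (auto simp: proj_def)
        then show "(adj (proj M x) * proj M x) $$ (a,b) = proj M x $$ (a,b)" using ab x by (simp add: proj_def)
      qed auto
      have dims: "dim_row D = d" "dim_col D = c" using c[OF x D] by auto
      have "adj (kron (proj M x) D) * kron (proj M x) D = kron (proj M x) (adj D * D)"
        by (simp add: kron_adj kron_mult pp)
      then show ?thesis using i j dims ij by (simp add: index_kron) (simp add: proj_def)
    qed
    have "(\<Sum>K\<leftarrow>?L. (adj K * K) $$ (i,j)) = (\<Sum>x<M. \<Sum>D\<leftarrow>Ds x. (adj (kron (proj M x) D) * kron (proj M x) D) $$ (i,j))"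
      by (simp add: sum_list_map_concat o_def sum_list_upt del: index_mult_mat(1))
    also have "\<dots> = (\<Sum>x<M. \<Sum>D\<leftarrow>Ds x. (if i div c = x \<and> j div c = x then 1 else 0) * (adj D * D) $$ (i mod c, j mod c))"
    proof (rule sum.cong[OF refl])
      fix x assume "x \<in> {..<M}"
      then show "(\<Sum>D\<leftarrow>Ds x. (adj (kron (proj M x) D) * kron (proj M x) D) $$ (i,j)) =
         (\<Sum>D\<leftarrow>Ds x. (if i div c = x \<and> j div c = x then 1 else 0) * (adj D * D) $$ (i mod c, j mod c))"
        using one by (intro arg_cong[of _ _ sum_list] map_cong) auto
    qed
    also have "\<dots> = (\<Sum>x<M. (if i div c = x \<and> j div c = x then 1 else 0) * (if i mod c = j mod c then 1 else 0))"
      using assms ij unfolding sum_list_const_mult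
      by (intro sum.cong refl arg_cong2[where f="(*)"]) (auto simp: is_channel_iff_entries[OF c])
    also have "\<dots> = (\<Sum>x<M. if x = i div c then (if i = j then 1 else 0) else 0)"
    proof -
      have "i = j \<longleftrightarrow> i div c = j div c \<and> i mod c = j mod c" by (metis div_mult_mod_eq)
      then show ?thesis by (intro sum.cong refl) auto
    qed
    also have "\<dots> = (if i = j then 1 else 0)" using ij by simp
    finally show "(\<Sum>K\<leftarrow>?L. (adj K * K) $$ (i,j)) = (if i = j then 1 else 0)" .
  qed
qed

section \<open>The fidelity of a controlled code\<close>

definition ensemble_state :: "nat \<Rightarrow> (nat \<Rightarrow> real) \<Rightarrow> (nat \<Rightarrow> complex vec) \<Rightarrow> nat \<Rightarrow> nat \<Rightarrow> complex mat" where
  "ensemble_state M P \<Psi> d r = msum (M*d*r*M)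
     (\<lambda>x. complex_of_real (P x) \<cdot>\<^sub>m kron (proj M x) (kron (outer (\<Psi> x) (\<Psi> x)) (proj M x))) {..<M}"

abbreviation code_state where
  "code_state M P \<Psi> d r c Ks Ls \<equiv> apply_channel (M*d*r*M) (map (\<lambda>D. kron D (1\<^sub>m (r*M))) Ls)
     (apply_channel (M*c*r*M) (map (\<lambda>K. kron (1\<^sub>m M) (kron K (1\<^sub>m (r*M)))) Ks) (ensemble_state M P \<Psi> d r))"

text \<open>The state is \<open>W * adj W\<close> with one column per \<open>x\<close>. Every Kraus
  product carries a projector onto a single letter, so it is diagonal between these columns and
  \<open>fidelity_apply_channel\<close> applies. The summand at \<open>x\<close> is
  \<open>P x\<close> times the root of the entanglement fidelity of the channel on the
  marginal.\<close>

lemma fidelity_controlled_code: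
  fixes P :: "nat \<Rightarrow> real"
  assumes P: "\<And>x. x < M \<Longrightarrow> P x \<ge> 0" and \<Psi>: "\<And>x. x < M \<Longrightarrow> dim_vec (\<Psi> x) = d * r"
    and Ks: "\<And>K. K \<in> set Ks \<Longrightarrow> K \<in> carrier_mat c d"
    and Ds: "\<And>x D. x < M \<Longrightarrow> D \<in> set (Ds x) \<Longrightarrow> D \<in> carrier_mat d c"
  shows "fidelity (ensemble_state M P \<Psi> d r)
     (code_state M P \<Psi> d r c Ks (controlled M Ds))
   = (\<Sum>x<M. sqrt (\<Sum>D\<leftarrow>Ds x. \<Sum>K\<leftarrow>Ks. (P x * cmod (mtrace (D * K * marginal d r (\<Psi> x))))\<^sup>2))"
    (is "fidelity ?\<omega> ?\<sigma> = ?R")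
proof -
  let ?e = "\<lambda>x. col_mat (unit_vec M x)"
  define u where "u x = kron (?e x) (kron (col_mat (\<Psi> x)) (?e x))" for x
  let ?N = "M*d*r*M"
  have ud: "dim_row (u x) = ?N" "dim_col (u x) = 1" if "x < M" for x
    using \<Psi>[OF that] by (auto simp: u_def)
  define W where "W = mat ?N M (\<lambda>(i,x). complex_of_real (sqrt (P x)) * u x $$ (i,0))"
  have W: "W \<in> carrier_mat ?N M" by (simp add: W_def)
  have rank1: "kron (proj M x) (kron (outer (\<Psi> x) (\<Psi> x)) (proj M x)) = u x * adj (u x)" for x
    unfolding u_def outer_col_mat proj_col_mat by (simp add: kron_adj kron_mult)
  have \<omega>: "?\<omega> = W * adj W"
  proof (rule eq_matI)
    fix i j assume "i < dim_row (W * adj W)" "j < dim_col (W * adj W)"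
    then have ij: "i < ?N" "j < ?N" using W by auto
    have "?\<omega> $$ (i,j) = (\<Sum>x<M. complex_of_real (P x) * (u x * adj (u x)) $$ (i,j))"
      unfolding ensemble_state_def rank1 using ij ud by (simp add: msum_def del: index_mult_mat(1))
    also have "\<dots> = (\<Sum>x<M. W $$ (i,x) * cnj (W $$ (j,x)))"
    proof (rule sum.cong[OF refl])
      fix x assume x: "x \<in> {..<M}"
      have s: "complex_of_real (P x) = complex_of_real (sqrt (P x)) * complex_of_real (sqrt (P x))"
        using P x by (simp flip: of_real_mult)
      show "complex_of_real (P x) * (u x * adj (u x)) $$ (i,j) = W $$ (i,x) * cnj (W $$ (j,x))"
        using x ij ud[of x] unfolding s by (subst mult_entry) (auto simp: W_def)
    qed
    also have "\<dots> = (W * adj W) $$ (i,j)" using ij W by (subst mult_entry'[of _ ?N M _ ?N]) auto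
    finally show "?\<omega> $$ (i,j) = (W * adj W) $$ (i,j)" .
  qed (use W in \<open>auto simp: ensemble_state_def msum_def\<close>)
  define Ks' where "Ks' = map (\<lambda>K. kron (1\<^sub>m M) (kron K (1\<^sub>m (r*M)))) Ks"
  define Ls where "Ls = map (\<lambda>D. kron D (1\<^sub>m (r*M))) (controlled M Ds)"
  have Ks': "K \<in> set Ks' \<Longrightarrow> K \<in> carrier_mat (M*c*r*M) ?N" for K
    using kron_carrier[OF one_carrier_mat[of M] kron_carrier[OF Ks one_carrier_mat[of "r*M"]]]
    by (auto simp: Ks'_def mult.assoc)
  have Ls: "L \<in> set Ls \<Longrightarrow> L \<in> carrier_mat ?N (M*c*r*M)" for L
    using kron_carrier[OF kron_carrier[OF proj_carrier[of M] Ds] one_carrier_mat[of "r*M"]]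
    by (auto simp: Ls_def mult.assoc)
  define As where "As = concat (map (\<lambda>L. map (\<lambda>K. L * K) Ks') Ls)"
  have \<sigma>: "?\<sigma> = apply_channel ?N As (W * adj W)"
    unfolding As_def \<omega> Ks'_def[symmetric] Ls_def[symmetric] using W by (intro apply_channel_comp[OF _ Ks' Ls]) auto
  have As: "A \<in> set As \<Longrightarrow> A \<in> carrier_mat ?N ?N" for A
    using mult_carrier_mat[OF Ls Ks'] by (auto simp: As_def)
  define \<rho> where "\<rho> x = marginal d r (\<Psi> x)" for x
  have entry: "(adj W * (kron (kron (proj M y) D) (1\<^sub>m (r*M)) * kron (1\<^sub>m M) (kron K (1\<^sub>m (r*M)))) * W) $$ (x,z) =
     (if x = y \<and> z = y then complex_of_real (P x) * mtrace (D * K * \<rho> x) else 0)" (is "(adj W * ?A * W) $$ _ = _")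
    if y: "y < M" and D: "D \<in> set (Ds y)" and K: "K \<in> set Ks" and x: "x < M" and z: "z < M" for y D K x z
  proof -
    have Dd: "dim_row D = d" "dim_col D = c" "dim_row K = c" "dim_col K = d" using Ds[OF y D] Ks[OF K] by auto
    \<comment> \<open>Encoder and decoder act on the factor \<open>B\<close> as \<open>D * K\<close>
      and on \<open>R\<close> and the copy of \<open>x\<close> as the identity.\<close>
    have A: "?A = kron (proj M y) (kron (kron (D * K) (1\<^sub>m r)) (1\<^sub>m M))"
      unfolding kron_assoc by (simp add: kron_mult one_mult_dim kron_one Dd)
    have Ac: "?A \<in> carrier_mat ?N ?N" unfolding A by (auto simp: Dd mult.assoc)
    have "(adj W * ?A * W) $$ (x,z) = complex_of_real (sqrt (P x)) * complex_of_real (sqrt (P z)) * (adj (u x) * ?A * u z) $$ (0,0)"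
      unfolding sandwich_entry[OF Ac W W x z] using x z ud[of x] ud[of z] Ac
      by (subst sandwich_entry[of _ ?N _ 1 _ 1]) (auto simp: W_def sum_distrib_left mult_ac)
    also have "adj (u x) * ?A * u z = kron (adj (?e x) * proj M y * ?e z)
        (kron (adj (col_mat (\<Psi> x)) * kron (D * K) (1\<^sub>m r) * col_mat (\<Psi> z)) (adj (?e x) * ?e z))"
      unfolding A u_def using \<Psi>[OF x] \<Psi>[OF z] by (simp add: kron_adj kron_mult Dd one_mult_dim)
    also have "\<dots> $$ (0,0) = (adj (?e x) * proj M y * ?e z) $$ (0,0) *
        ((adj (col_mat (\<Psi> x)) * kron (D * K) (1\<^sub>m r) * col_mat (\<Psi> z)) $$ (0,0) * (adj (?e x) * ?e z) $$ (0,0))"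
    proof -
      have "kron A (kron B C) $$ (0,0) = A $$ (0,0) * (B $$ (0,0) * C $$ (0,0))"
        if "dim_row A = 1" "dim_col A = 1" "dim_row B = 1" "dim_col B = 1" "dim_row C = 1" "dim_col C = 1" for A B C
        using that by (simp add: kron_1x1)
      from this[of "adj (?e x) * proj M y * ?e z" "adj (col_mat (\<Psi> x)) * kron (D * K) (1\<^sub>m r) * col_mat (\<Psi> z)" "adj (?e x) * ?e z"]
      show ?thesis by (simp only: index_mult_mat(2,3) dim_adj dim_col_mat)
    qed
    also have "(adj (?e x) * proj M y * ?e z) $$ (0,0) = (if x = y \<and> z = y then 1 else 0)"
    proof -
      have "(adj (?e x) * proj M y * ?e z) $$ (0,0) =
          (\<Sum>a<M. \<Sum>b<M. cnj (?e x $$ (a,0)) * proj M y $$ (a,b) * ?e z $$ (b,0))"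
        by (rule sandwich_entry[OF proj_carrier, where n = 1 and k = 1]) (auto simp: col_mat_def)
      also have "\<dots> = (\<Sum>a<M. if a = x then \<Sum>b<M. if b = z then proj M y $$ (x,z) else 0 else 0)"
      proof (rule sum.cong[OF refl])
        fix a assume "a \<in> {..<M}"
        then show "(\<Sum>b<M. cnj (?e x $$ (a,0)) * proj M y $$ (a,b) * ?e z $$ (b,0)) =
            (if a = x then \<Sum>b<M. if b = z then proj M y $$ (x,z) else 0 else 0)"
          by (cases "a = x") (auto simp only: if_True if_False simp_thms intro!: sum.cong sum.neutral, auto simp: col_mat_def unit_vec_def)
      qed
      finally show ?thesis using x y z by (simp add: proj_def)
    qed
    also have "(adj (?e x) * ?e z) $$ (0,0) = (if x = z then 1 else 0)"
    proof -
      have "(adj (?e x) * ?e z) $$ (0,0) = (\<Sum>k<M. if k = x then if x = z then 1 else 0 else 0)"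
        by (subst mult_entry, simp, simp, simp, intro sum.cong) (auto simp: col_mat_def unit_vec_def)
      then show ?thesis using x by simp
    qed
    finally have *: "(adj W * ?A * W) $$ (x,z) = complex_of_real (sqrt (P x)) * complex_of_real (sqrt (P z)) *
       ((if x = y \<and> z = y then 1 else 0) * ((adj (col_mat (\<Psi> x)) * kron (D * K) (1\<^sub>m r) * col_mat (\<Psi> z)) $$ (0,0) * (if x = z then 1 else 0)))" .
    show ?thesis
    proof (cases "x = y \<and> z = y")
      case True
      have "complex_of_real (sqrt (P x)) * complex_of_real (sqrt (P x)) = complex_of_real (P x)"
        using P[OF x] by (simp flip: of_real_mult)
      moreover have "(adj (col_mat (\<Psi> x)) * kron (D * K) (1\<^sub>m r) * col_mat (\<Psi> x)) $$ (0,0) = mtrace (D * K * \<rho> x)"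
        unfolding \<rho>_def using \<Psi>[OF x] by (intro expectation_kron_one) (auto simp: Dd)
      ultimately show ?thesis unfolding * using True by simp
    qed (use * in auto)
  qed
  define g where "g A x = (adj W * A * W) $$ (x,x)" for A x
  have diag: "adj W * A * W = mat_diag M (g A)" if A: "A \<in> set As" for A
  proof -
    from A obtain y D K where yDK: "y < M" "D \<in> set (Ds y)" "K \<in> set Ks"
      "A = kron (kron (proj M y) D) (1\<^sub>m (r*M)) * kron (1\<^sub>m M) (kron K (1\<^sub>m (r*M)))"
      by (auto simp: As_def Ls_def Ks'_def)
    show ?thesis
    proof (rule eq_matI)
      fix i j assume "i < dim_row (mat_diag M (g A))" "j < dim_col (mat_diag M (g A))"
      then show "(adj W * A * W) $$ (i,j) = mat_diag M (g A) $$ (i,j)"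
        using entry[OF yDK(1-3)] unfolding g_def yDK(4) by (auto simp: mat_diag_def simp del: index_mult_mat(1))
    qed (use W in auto)
  qed
  have "fidelity ?\<omega> ?\<sigma> = (\<Sum>x<M. sqrt (\<Sum>A\<leftarrow>As. (cmod (g A x))\<^sup>2))"
    unfolding \<sigma> unfolding \<omega> by (rule fidelity_apply_channel[OF W As diag])
  also have "\<dots> = ?R"
  proof (intro sum.cong refl arg_cong[where f=sqrt])
    fix x assume "x \<in> {..<M}" then have x: "x < M" by simp
    have "(\<Sum>A\<leftarrow>As. (cmod (g A x))\<^sup>2) = (\<Sum>y<M. \<Sum>D\<leftarrow>Ds y. \<Sum>K\<leftarrow>Ks.
       (cmod (g (kron (kron (proj M y) D) (1\<^sub>m (r*M)) * kron (1\<^sub>m M) (kron K (1\<^sub>m (r*M)))) x))\<^sup>2)"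
      by (simp add: As_def Ls_def Ks'_def sum_list_map_concat o_def sum_list_upt)
    also have "\<dots> = (\<Sum>y<M. \<Sum>D\<leftarrow>Ds y. \<Sum>K\<leftarrow>Ks. if y = x then (P x * cmod (mtrace (D * K * \<rho> x)))\<^sup>2 else 0)"
    proof (rule sum.cong[OF refl])
      fix y assume "y \<in> {..<M}"
      then show "(\<Sum>D\<leftarrow>Ds y. \<Sum>K\<leftarrow>Ks. (cmod (g (kron (kron (proj M y) D) (1\<^sub>m (r*M)) * kron (1\<^sub>m M) (kron K (1\<^sub>m (r*M)))) x))\<^sup>2) =
        (\<Sum>D\<leftarrow>Ds y. \<Sum>K\<leftarrow>Ks. if y = x then (P x * cmod (mtrace (D * K * \<rho> x)))\<^sup>2 else 0)"
        using entry[of y _ _ x x] x P[OF x] unfolding g_def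
        by (intro arg_cong[of _ _ sum_list] map_cong refl) (auto simp: norm_mult simp del: index_mult_mat(1))
    qed
    also have "\<dots> = (\<Sum>y<M. if y = x then (\<Sum>D\<leftarrow>Ds x. \<Sum>K\<leftarrow>Ks. (P x * cmod (mtrace (D * K * \<rho> x)))\<^sup>2) else 0)"
      by (intro sum.cong refl) (auto simp: sum_list_0)
    also have "\<dots> = (\<Sum>D\<leftarrow>Ds x. \<Sum>K\<leftarrow>Ks. (P x * cmod (mtrace (D * K * \<rho> x)))\<^sup>2)" using x by simp
    finally show "(\<Sum>A\<leftarrow>As. (cmod (g A x))\<^sup>2) = (\<Sum>D\<leftarrow>Ds x. \<Sum>K\<leftarrow>Ks. (P x * cmod (mtrace (D * K * marginal d r (\<Psi> x))))\<^sup>2)"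
      unfolding \<rho>_def .
  qed
  finally show ?thesis .
qed

section \<open>The random code\<close>

definition polar :: "complex mat \<Rightarrow> complex mat" where
  "polar W = (SOME Y. is_polar_part W Y)"

lemma polar:
  assumes W: "W \<in> carrier_mat a b"
  shows "polar W \<in> carrier_mat a b" "polar W * (adj (polar W) * polar W) = polar W"
    "k < b \<Longrightarrow> Re ((adj (polar W) * W) $$ (k,k)) \<ge> 3/2 * (\<Sum>i<a. (cmod (W $$ (i,k)))\<^sup>2) - 1/2 * (\<Sum>l<b. (cmod ((adj W * W) $$ (k,l)))\<^sup>2)"
    "k < b \<Longrightarrow> (\<Sum>i<a. (cmod (polar W $$ (i,k)))\<^sup>2) \<le> 1"
    "k < b \<Longrightarrow> (\<Sum>i<a. (cmod (polar W $$ (i,k) - W $$ (i,k)))\<^sup>2) \<le>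
         (\<Sum>l<b. (cmod ((adj W * W) $$ (k,l)))\<^sup>2) - 2 * (\<Sum>i<a. (cmod (W $$ (i,k)))\<^sup>2) + 1"
    "k < b \<Longrightarrow> (\<And>i. i < a \<Longrightarrow> W $$ (i,k) = 0) \<Longrightarrow> i < a \<Longrightarrow> polar W $$ (i,k) = 0"
proof -
  have d: "dim_row W = a" "dim_col W = b" using W by auto
  note * = someI_ex[OF polar_part_exists[OF W], folded polar_def, unfolded is_polar_part_def d]
  show "polar W \<in> carrier_mat a b" "polar W * (adj (polar W) * polar W) = polar W"
    "k < b \<Longrightarrow> Re ((adj (polar W) * W) $$ (k,k)) \<ge> 3/2 * (\<Sum>i<a. (cmod (W $$ (i,k)))\<^sup>2) - 1/2 * (\<Sum>l<b. (cmod ((adj W * W) $$ (k,l)))\<^sup>2)"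
    "k < b \<Longrightarrow> (\<Sum>i<a. (cmod (polar W $$ (i,k)))\<^sup>2) \<le> 1"
    "k < b \<Longrightarrow> (\<Sum>i<a. (cmod (polar W $$ (i,k) - W $$ (i,k)))\<^sup>2) \<le>
         (\<Sum>l<b. (cmod ((adj W * W) $$ (k,l)))\<^sup>2) - 2 * (\<Sum>i<a. (cmod (W $$ (i,k)))\<^sup>2) + 1"
    "k < b \<Longrightarrow> (\<And>i. i < a \<Longrightarrow> W $$ (i,k) = 0) \<Longrightarrow> i < a \<Longrightarrow> polar W $$ (i,k) = 0"
    using * by blast+
qed

text \<open>Both follow from the partial isometry equation; the first makes the encoder a channel,
  the second the decoder.\<close>

lemma polar_projections:
  assumes W: "W \<in> carrier_mat a b"
  shows "(adj (polar W) * polar W) * (adj (polar W) * polar W) = adj (polar W) * polar W"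
    "(polar W * adj (polar W)) * (polar W * adj (polar W)) = polar W * adj (polar W)"
proof -
  note p = polar(1,2)[OF W]
  have "(adj (polar W) * polar W) * (adj (polar W) * polar W) = adj (polar W) * (polar W * (adj (polar W) * polar W))"
    using p(1) by (simp add: mat_assoc)
  then show "(adj (polar W) * polar W) * (adj (polar W) * polar W) = adj (polar W) * polar W" unfolding p(2) .
  have "(polar W * adj (polar W)) * (polar W * adj (polar W)) = (polar W * (adj (polar W) * polar W)) * adj (polar W)"
    using p(1) by (simp add: mat_assoc)
  then show "(polar W * adj (polar W)) * (polar W * adj (polar W)) = polar W * adj (polar W)" unfolding p(2) .
qed

lemma unitary_adj: "unitary n U \<Longrightarrow> unitary n (adj U)"
  unfolding unitary_def[of n "adj U"] adj_adj using unitaryD(2,4)[of n U] by blast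

text \<open>The rows of a unitary are orthonormal, so a vector supported on \<open>T\<close> keeps
  its norm in the basis of the columns.\<close>

lemma unitary_parseval:
  assumes U: "unitary n F" and T: "T \<subseteq> {..<n}"
  shows "(\<Sum>j<n. (cmod (\<Sum>b\<in>T. cnj (v b) * F $$ (b,j)))\<^sup>2) = (\<Sum>b\<in>T. (cmod (v b))\<^sup>2)"
proof -
  note Fc = unitaryD[OF U]
  have o: "(\<Sum>j<n. F $$ (b,j) * cnj (F $$ (b',j))) = (if b = b' then 1 else 0)" if "b \<in> T" "b' \<in> T" for b b'
  proof -
    have "b < n" "b' < n" using that T by auto
    then have "(F * adj F) $$ (b,b') = (\<Sum>j<n. F $$ (b,j) * cnj (F $$ (b',j)))"
      using Fc(1) by (subst mult_entry'[of _ n n _ n]) auto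
    then show ?thesis unfolding Fc(4) using \<open>b < n\<close> \<open>b' < n\<close> by auto
  qed
  have fin: "finite T" using T finite_subset by blast
  have "complex_of_real (\<Sum>j<n. (cmod (\<Sum>b\<in>T. cnj (v b) * F $$ (b,j)))\<^sup>2) =
     (\<Sum>j<n. \<Sum>b\<in>T. \<Sum>b'\<in>T. cnj (v b) * v b' * (F $$ (b,j) * cnj (F $$ (b',j))))"
    unfolding of_real_sum complex_norm_square cnj_sum sum_product by (simp add: mult_ac)
  also have "\<dots> = (\<Sum>b\<in>T. \<Sum>b'\<in>T. \<Sum>j<n. cnj (v b) * v b' * (F $$ (b,j) * cnj (F $$ (b',j))))"
    by (subst sum.swap, rule sum.cong[OF refl], rule sum.swap)
  also have "\<dots> = (\<Sum>b\<in>T. \<Sum>b'\<in>T. cnj (v b) * v b' * (if b = b' then 1 else 0))"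
    unfolding sum_distrib_left[symmetric] using o by simp
  also have "\<dots> = (\<Sum>b\<in>T. \<Sum>b'\<in>T. if b' = b then cnj (v b) * v b else 0)"
    by (intro sum.cong refl) auto
  also have "\<dots> = complex_of_real (\<Sum>b\<in>T. (cmod (v b))\<^sup>2)"
    using fin by (simp add: complex_norm_square mult.commute del: of_real_power)
  finally show ?thesis by (simp only: of_real_eq_iff)
qed

text \<open>The one-shot setting. \<open>\<Phi> x\<close> and \<open>lam x\<close> diagonalise the
  marginal at \<open>x\<close>, and \<open>avg\<close> says that the average marginal has eigenbasis
  \<open>\<beta>\<close> and spectrum \<open>q\<close>. \<open>card_T\<close> keeps Bob's sign
  matrix close to an isometry, with \<open>\<tau>\<close> as tolerance; \<open>R\<close> bounds the
  number of eigenvectors the decoder has to tell apart and enters the final error through E R /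
  c.\<close>

locale random_code =
  fixes M d r c E :: nat and P :: "nat \<Rightarrow> real" and \<Psi> :: "nat \<Rightarrow> complex vec"
    and \<beta> :: "complex mat" and q :: "nat \<Rightarrow> real" and \<Phi> :: "nat \<Rightarrow> complex mat" and lam :: "nat \<Rightarrow> nat \<Rightarrow> real"
    and T :: "nat set" and J :: "nat \<Rightarrow> nat set" and R \<tau> :: real
  assumes P_nonneg: "\<And>x. x < M \<Longrightarrow> P x \<ge> 0" and P_sum: "(\<Sum>x<M. P x) = 1"
    and dim_\<Psi>: "\<And>x. x < M \<Longrightarrow> dim_vec (\<Psi> x) = d * r"
    and \<Phi>: "\<And>x. x < M \<Longrightarrow> unitary d (\<Phi> x)"
    and \<rho>: "\<And>x. x < M \<Longrightarrow> marginal d r (\<Psi> x) = \<Phi> x * rdiag d (lam x) * adj (\<Phi> x)"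
    and lam_nonneg: "\<And>x i. x < M \<Longrightarrow> i < d \<Longrightarrow> lam x i \<ge> 0" and lam_sum: "\<And>x. x < M \<Longrightarrow> (\<Sum>i<d. lam x i) = 1"
    and \<beta>: "unitary d \<beta>"
    and avg: "\<And>b b'. b < d \<Longrightarrow> b' < d \<Longrightarrow>
       (\<Sum>x<M. \<Sum>i<d. P x * lam x i * (adj \<beta> * \<Phi> x) $$ (b,i) * cnj ((adj \<beta> * \<Phi> x) $$ (b',i))) = (if b = b' then complex_of_real (q b) else 0)"
    and q_nonneg: "\<And>b. b < d \<Longrightarrow> q b \<ge> 0" and q_sum: "(\<Sum>b<d. q b) = 1"
    and T: "T \<subseteq> {..<d}" and J: "\<And>x. x < M \<Longrightarrow> J x \<subseteq> {..<d}" and card_J: "\<And>x. x < M \<Longrightarrow> real (card (J x)) \<le> R"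
    and c_pos: "c > 0" and E_pos: "E > 0" and \<tau>_pos: "\<tau> > 0"
    and card_T: "2 * real (card T) \<le> \<tau>\<^sup>2 * (real E * real c)"
begin

lemma fin_T: "finite T" using T finite_subset by blast

definition F :: "nat \<Rightarrow> complex mat" where "F x = adj \<beta> * \<Phi> x"

lemma F: assumes "x < M" shows "unitary d (F x)"
  unfolding F_def using unitary_mult[OF unitary_adj[OF \<beta>] \<Phi>[OF assms]] .

abbreviation signs :: "(nat \<times> nat \<times> nat) set" where "signs \<equiv> {..<E} \<times> {..<c} \<times> T"

text \<open>Written in the eigenbasis of the average state. The columns in \<open>T\<close> are unit
  vectors, since all \<open>E * c\<close> entries have the same modulus.\<close>

definition V :: "(nat \<times> nat \<times> nat) set \<Rightarrow> complex mat" where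
  "V S = mat (E*c) d (\<lambda>(k,b). if b \<in> T then complex_of_real (rsign S (k div c, k mod c, b) / sqrt (real E * real c)) else 0)"

text \<open>Column \<open>e * d + i\<close> is the image of eigenvector \<open>i\<close> under block
  \<open>e\<close> of \<open>V S\<close>, enlarged by sqrt E so that its expected squared norm is
  the weight of the eigenvector inside \<open>T\<close>. Atypical eigenvectors get zero
  columns.\<close>

definition W :: "nat \<Rightarrow> (nat \<times> nat \<times> nat) set \<Rightarrow> complex mat" where
  "W x S = mat c (E*d) (\<lambda>(\<gamma>,k). if k mod d \<in> J x
     then (\<Sum>b\<in>T. F x $$ (b, k mod d) * rsign S (k div d, \<gamma>, b)) / complex_of_real (sqrt (real c)) else 0)"

lemma V_carrier: "V S \<in> carrier_mat (E*c) d" and W_carrier: "W x S \<in> carrier_mat c (E*d)"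
  by (auto simp: V_def W_def)

definition Enc :: "(nat \<times> nat \<times> nat) set \<Rightarrow> complex mat list" where
  "Enc S = map (\<lambda>K. K * adj \<beta>) (blocks E c (polar (V S)) @ first_rows c (1\<^sub>m d - adj (polar (V S)) * polar (V S)))"

text \<open>The adjoint polar part maps \<open>C\<close> to pairs of an environment index and an
  eigenvector index. The former is discarded, and \<open>\<Phi> x\<close> turns the latter back into
  an eigenvector, so decoder block \<open>e\<close> is meant to undo encoder block
  \<open>e\<close>.\<close>

definition Dec :: "(nat \<times> nat \<times> nat) set \<Rightarrow> nat \<Rightarrow> complex mat list" where
  "Dec S x = map (\<lambda>K. \<Phi> x * K) (blocks E d (adj (polar (W x S))) @ first_rows d (1\<^sub>m c - adj (adj (polar (W x S))) * adj (polar (W x S))))"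

lemma d_pos: "d > 0" using q_sum by (cases d) auto

lemma Enc_channel: "is_channel d c (Enc S)"
  unfolding Enc_def
  by (intro channel_unitary_right partial_isometry_channel polar_projections polar(1) V_carrier c_pos)
     (use \<beta> unitaryD[OF \<beta>] in auto)

lemma Dec_channel: assumes "x < M" shows "is_channel c d (Dec S x)"
  unfolding Dec_def
  by (intro channel_unitary_left[OF _ \<Phi>[OF assms]] partial_isometry_channel adj_carrier polar(1) W_carrier d_pos)
     (simp add: polar_projections[OF W_carrier])

definition \<Omega> :: "(nat \<times> nat \<times> nat) set \<Rightarrow> nat \<Rightarrow> nat \<Rightarrow> complex" where
  "\<Omega> S x e = (\<Sum>i<d. lam x i * (\<Sum>\<gamma><c. cnj (polar (W x S) $$ (\<gamma>,e*d+i)) * (\<Sum>b<d. polar (V S) $$ (e*c+\<gamma>,b) * F x $$ (b,i))))"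

lemma overlap_block:
  assumes x: "x < M" and e: "e < E"
  shows "mtrace ((\<Phi> x * blocks E d (adj (polar (W x S))) ! e) * (blocks E c (polar (V S)) ! e * adj \<beta>)
     * marginal d r (\<Psi> x)) = \<Omega> S x e"
proof -
  note Pc = unitaryD[OF \<Phi>[OF x]] and Bc = unitaryD[OF \<beta>] and Yc = polar(1)[OF W_carrier[of x S]] and Vc = polar(1)[OF V_carrier[of S]]
  define D where "D = blocks E d (adj (polar (W x S))) ! e"
  define K where "K = blocks E c (polar (V S)) ! e"
  have D: "D = mat d c (\<lambda>(i,\<gamma>). cnj (polar (W x S) $$ (\<gamma>,e*d+i)))"
    using e Yc pair_index_less[OF e] by (auto simp: D_def blocks_def intro!: eq_matI)
  have K: "K = mat c d (\<lambda>(\<gamma>,b). polar (V S) $$ (e*c+\<gamma>,b))"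
    using e Vc by (auto simp: K_def blocks_def)
  have Dc: "D \<in> carrier_mat d c" "K \<in> carrier_mat c d" by (auto simp: D K)
  let ?L = "rdiag d (lam x)"
  have "(\<Phi> x * D) * (K * adj \<beta>) * (\<Phi> x * ?L * adj (\<Phi> x)) = \<Phi> x * (D * (K * F x) * ?L * adj (\<Phi> x))"
    using Pc(1) Bc(1) Dc by (simp add: mat_assoc F_def)
  then have "mtrace ((\<Phi> x * D) * (K * adj \<beta>) * (\<Phi> x * ?L * adj (\<Phi> x))) = mtrace ((D * (K * F x) * ?L * adj (\<Phi> x)) * \<Phi> x)"
  proof -
    have "D * (K * F x) * ?L * adj (\<Phi> x) \<in> carrier_mat d d" using Pc(1) Dc by (intro carrier_matI) auto
    from mtrace_comm[OF Pc(1) this] show "mtrace ((\<Phi> x * D) * (K * adj \<beta>) * (\<Phi> x * ?L * adj (\<Phi> x))) = mtrace ((D * (K * F x) * ?L * adj (\<Phi> x)) * \<Phi> x)"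
      by (simp only: \<open>(\<Phi> x * D) * (K * adj \<beta>) * (\<Phi> x * ?L * adj (\<Phi> x)) = \<Phi> x * (D * (K * F x) * ?L * adj (\<Phi> x))\<close>)
  qed
  also have "(D * (K * F x) * ?L * adj (\<Phi> x)) * \<Phi> x = D * (K * F x) * ?L * (adj (\<Phi> x) * \<Phi> x)"
    using Pc(1) Dc unitaryD(1)[OF F[OF x]] by (simp add: mat_assoc)
  also have "\<dots> = D * (K * F x) * ?L" unfolding Pc(3) by (simp add: one_mult_dim)
  finally have 1: "mtrace ((\<Phi> x * D) * (K * adj \<beta>) * (\<Phi> x * ?L * adj (\<Phi> x))) = mtrace (D * (K * F x) * ?L)" .
  have KF: "K * F x \<in> carrier_mat c d" using Dc unitaryD(1)[OF F[OF x]] by auto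
  have DKF: "D * (K * F x) \<in> carrier_mat d d" using KF Dc by auto
  have "mtrace (D * (K * F x) * ?L) = (\<Sum>i<d. (D * (K * F x)) $$ (i,i) * lam x i)"
    unfolding mat_diag_mult_right[OF DKF] mtrace_def by auto
  also have "\<dots> = (\<Sum>i<d. lam x i * (\<Sum>\<gamma><c. D $$ (i,\<gamma>) * (\<Sum>b<d. K $$ (\<gamma>,b) * F x $$ (b,i))))"
  proof (intro sum.cong refl)
    fix i assume "i \<in> {..<d}"
    then have i: "i < d" by simp
    have "(D * (K * F x)) $$ (i,i) = (\<Sum>\<gamma><c. D $$ (i,\<gamma>) * (K * F x) $$ (\<gamma>,i))"
      using i Dc KF by (subst mult_entry'[of _ d c _ d]) auto
    also have "\<dots> = (\<Sum>\<gamma><c. D $$ (i,\<gamma>) * (\<Sum>b<d. K $$ (\<gamma>,b) * F x $$ (b,i)))"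
      using i Dc unitaryD(1)[OF F[OF x]] by (intro sum.cong refl, subst mult_entry'[of K c d _ d]) auto
    finally show "(D * (K * F x)) $$ (i,i) * lam x i = lam x i * (\<Sum>\<gamma><c. D $$ (i,\<gamma>) * (\<Sum>b<d. K $$ (\<gamma>,b) * F x $$ (b,i)))"
      by (simp add: mult.commute)
  qed
  also have "\<dots> = \<Omega> S x e" unfolding \<Omega>_def by (intro sum.cong refl) (simp add: D K)
  finally show ?thesis unfolding D_def[symmetric] K_def[symmetric] \<rho>[OF x] 1 .
qed

lemma sum_list_map_append_ge:
  fixes f :: "'b \<Rightarrow> real"
  assumes "\<And>y. f y \<ge> 0"
  shows "sum_list (map f (xs @ ys)) \<ge> sum_list (map f xs)"
proof -
  have "sum_list (map f ys) \<ge> 0" using assms by (intro sum_list_nonneg) auto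
  then show ?thesis by simp
qed

text \<open>All Kraus pairs contribute nonnegatively; only those with equal environment index are
  retained. The completing Kraus operators are dropped as well.\<close>

lemma overlap_sum:
  assumes x: "x < M"
  shows "(\<Sum>D\<leftarrow>Dec S x. \<Sum>K\<leftarrow>Enc S. (P x * cmod (mtrace (D * K * marginal d r (\<Psi> x))))\<^sup>2)
     \<ge> (P x)\<^sup>2 * (\<Sum>e<E. (cmod (\<Omega> S x e))\<^sup>2)"
proof -
  define h where "h D K = (P x * cmod (mtrace ((\<Phi> x * D) * (K * adj \<beta>) * marginal d r (\<Psi> x))))\<^sup>2" for D K
  have h0: "h D K \<ge> 0" for D K by (simp add: h_def)
  let ?D = "blocks E d (adj (polar (W x S)))" and ?K = "blocks E c (polar (V S))"
  have h1: "(\<Sum>K\<leftarrow>Ks. h D K) \<ge> 0" for D Ks by (intro sum_list_nonneg) (auto simp: h0)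
  have len: "length ?D = E" "length ?K = E" by (auto simp: blocks_def)
  have nth: "(\<Sum>D\<leftarrow>Ds. g D) = (\<Sum>e<length Ds. g (Ds ! e))" for g :: "complex mat \<Rightarrow> real" and Ds
    by (simp add: sum_list_sum_nth atLeast0LessThan)
  have "(P x)\<^sup>2 * (\<Sum>e<E. (cmod (\<Omega> S x e))\<^sup>2) = (\<Sum>e<E. h (?D ! e) (?K ! e))"
    unfolding sum_distrib_left using overlap_block[OF x] by (intro sum.cong refl) (simp add: h_def power_mult_distrib)
  also have "\<dots> \<le> (\<Sum>e<E. \<Sum>e'<E. h (?D ! e) (?K ! e'))"
    by (intro sum_mono member_le_sum[where f = "\<lambda>e'. h (?D ! e) (?K ! e')" for e]) (auto simp: h0)
  also have "\<dots> = (\<Sum>D\<leftarrow>?D. \<Sum>K\<leftarrow>?K. h D K)" by (simp add: nth len)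
  also have "\<dots> \<le> (\<Sum>D\<leftarrow>?D. \<Sum>K\<leftarrow>?K @ Ks. h D K)" for Ks
    by (intro sum_list_mono sum_list_map_append_ge h0)
  also have "\<dots> Ks \<le> (\<Sum>D\<leftarrow>?D @ Ds. \<Sum>K\<leftarrow>?K @ Ks. h D K)" for Ks Ds
    by (intro sum_list_map_append_ge h1)
  finally show ?thesis unfolding Dec_def Enc_def by (simp add: o_def h_def)
qed

end

section \<open>Lower bound for the fidelity at fixed signs\<close>

lemma real_sum_squared_le: "(\<Sum>e<n. a e)\<^sup>2 \<le> real n * (\<Sum>e<n. (a e :: real)\<^sup>2)"
proof (cases "n = 0")
  case False
  define m where "m = (\<Sum>e<n. a e) / n"
  have "0 \<le> (\<Sum>e<n. (a e - m)\<^sup>2)" by (intro sum_nonneg) auto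
  also have "\<dots> = (\<Sum>e<n. (a e)\<^sup>2) - 2 * m * (\<Sum>e<n. a e) + n * m\<^sup>2"
    by (simp add: power2_diff sum.distrib sum_subtractf sum_distrib_left mult_ac)
  also have "\<dots> = (\<Sum>e<n. (a e)\<^sup>2) - (\<Sum>e<n. a e)\<^sup>2 / n"
    using False by (simp add: m_def power2_eq_square field_simps)
  finally show ?thesis using False by (simp add: field_simps)
qed simp

text \<open>Cauchy-Schwarz, used to replace a root of squares by something linear. It is nearly an
  equality when all \<open>z e\<close> are close to the same nonnegative real, as is expected of the
  \<open>\<Omega> S x e\<close>.\<close>

lemma Re_sum_le_sqrt:
  assumes "n > 0" shows "Re (\<Sum>e<n. z e) / sqrt (real n) \<le> sqrt (\<Sum>e<n. (cmod (z e))\<^sup>2)"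
proof -
  have "Re (\<Sum>e<n. z e) \<le> (\<Sum>e<n. cmod (z e))"
    unfolding Re_sum by (intro sum_mono complex_Re_le_cmod)
  also have "\<dots> \<le> sqrt (real n * (\<Sum>e<n. (cmod (z e))\<^sup>2))"
    by (intro real_le_rsqrt real_sum_squared_le)
  finally show ?thesis using assms by (simp add: real_sqrt_mult field_simps)
qed

context random_code
begin

abbreviation H where "H S \<equiv> adj (V S) * V S"
abbreviation G where "G x S \<equiv> adj (W x S) * W x S"

definition \<Delta> :: "(nat \<times> nat \<times> nat) set \<Rightarrow> nat \<Rightarrow> nat \<Rightarrow> complex" where
  "\<Delta> S k b = polar (V S) $$ (k,b) - V S $$ (k,b)"

text \<open>The lower bound of \<open>is_polar_part\<close> for the overlap of each measurement
  vector with its column, averaged over the eigenvalue weights and the environment index.\<close>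

definition gain :: "(nat \<times> nat \<times> nat) set \<Rightarrow> nat \<Rightarrow> real" where
  "gain S x = (\<Sum>e<E. \<Sum>i\<in>J x. lam x i * (3/2 * (\<Sum>\<gamma><c. (cmod (W x S $$ (\<gamma>,e*d+i)))\<^sup>2)
      - 1/2 * (\<Sum>l<E*d. (cmod (G x S $$ (e*d+i,l)))\<^sup>2))) / real E"

text \<open>The squared distance between Bob's isometry and his sign matrix, as seen by the marginal
  at \<open>x\<close>.\<close>

definition loss :: "(nat \<times> nat \<times> nat) set \<Rightarrow> nat \<Rightarrow> real" where
  "loss S x = (\<Sum>e<E. \<Sum>i<d. lam x i * (\<Sum>\<gamma><c. (cmod (\<Sum>b<d. \<Delta> S (e*c+\<gamma>) b * F x $$ (b,i)))\<^sup>2))"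

text \<open>Splitting the polar part as \<open>V S\<close> plus \<open>\<Delta> S\<close> separates
  the overlap of the measurement vectors with the columns of \<open>W x S\<close> from an error that
  is handled by a weighted arithmetic-geometric mean inequality.\<close>

lemma overlap_bound:
  assumes x: "x < M"
  shows "Re (\<Sum>e<E. \<Omega> S x e) / sqrt (real E) \<ge> gain S x - (\<tau> + loss S x / \<tau>) / 2"
proof -
  define Y where "Y = polar (W x S)"
  note pW = polar[OF W_carrier[of x S], folded Y_def]
  define \<delta> where "\<delta> e i \<gamma> = (\<Sum>b<d. \<Delta> S (e*c+\<gamma>) b * F x $$ (b,i))" for e i \<gamma>
  define g where "g e i = (if i \<in> J x then 3/2 * (\<Sum>\<gamma><c. (cmod (W x S $$ (\<gamma>,e*d+i)))\<^sup>2)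
      - 1/2 * (\<Sum>l<E*d. (cmod (G x S $$ (e*d+i,l)))\<^sup>2) else 0)" for e i
  define A where "A e i = (\<Sum>\<gamma><c. cnj (Y $$ (\<gamma>,e*d+i)) * (\<Sum>b<d. polar (V S) $$ (e*c+\<gamma>,b) * F x $$ (b,i)))" for e i
  have sE: "sqrt (real E) > 0" using E_pos by simp
  have A: "Re (A e i) \<ge> g e i / sqrt E - (\<tau> / sqrt E + sqrt E / \<tau> * (\<Sum>\<gamma><c. (cmod (\<delta> e i \<gamma>))\<^sup>2)) / 2"
    if e: "e < E" and i: "i < d" for e i
  proof -
    have k: "e*d+i < E*d" using pair_index_less[OF e i] .
    have kd: "(e*d+i) mod d = i" "(e*d+i) div d = e" using i by auto
    \<comment> \<open>\<open>V S\<close> and \<open>W x S\<close> are built from the same signs and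
      differ only in normalisation.\<close>
    have vf: "(\<Sum>b<d. V S $$ (e*c+\<gamma>,b) * F x $$ (b,i)) = W x S $$ (\<gamma>,e*d+i) / sqrt E"
      if \<gamma>: "\<gamma> < c" and iJ: "i \<in> J x" for \<gamma>
    proof -
      have "(\<Sum>b<d. V S $$ (e*c+\<gamma>,b) * F x $$ (b,i)) =
         (\<Sum>b<d. if b \<in> T then F x $$ (b,i) * rsign S (e,\<gamma>,b) / complex_of_real (sqrt (real E * real c)) else 0)"
        using pair_index_less[OF e \<gamma>] \<gamma> by (intro sum.cong refl) (auto simp: V_def)
      also have "\<dots> = (\<Sum>b\<in>T. F x $$ (b,i) * rsign S (e,\<gamma>,b) / complex_of_real (sqrt (real E * real c)))"
        proof -
        have "{..<d} \<inter> T = T" using T by auto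
        then show ?thesis by (simp flip: sum.inter_restrict)
      qed
      also have "\<dots> = (\<Sum>b\<in>T. F x $$ (b,i) * rsign S (e,\<gamma>,b)) / complex_of_real (sqrt (real c)) / sqrt E"
        by (simp add: sum_divide_distrib real_sqrt_mult mult_ac)
      finally show ?thesis using k \<gamma> iJ by (simp only: W_def index_mat(1) kd prod.case if_True)
    qed
    have "A e i = (\<Sum>\<gamma><c. cnj (Y $$ (\<gamma>,e*d+i)) * (\<Sum>b<d. V S $$ (e*c+\<gamma>,b) * F x $$ (b,i))) + (\<Sum>\<gamma><c. cnj (Y $$ (\<gamma>,e*d+i)) * \<delta> e i \<gamma>)"
    proof -
      have "(\<Sum>b<d. polar (V S) $$ (e*c+\<gamma>,b) * F x $$ (b,i)) = (\<Sum>b<d. V S $$ (e*c+\<gamma>,b) * F x $$ (b,i)) + \<delta> e i \<gamma>" for \<gamma>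
        unfolding \<delta>_def \<Delta>_def sum.distrib[symmetric] by (intro sum.cong refl) (simp add: left_diff_distrib)
      then show ?thesis unfolding A_def by (simp only: distrib_left sum.distrib)
    qed
    moreover have "Re (\<Sum>\<gamma><c. cnj (Y $$ (\<gamma>,e*d+i)) * (\<Sum>b<d. V S $$ (e*c+\<gamma>,b) * F x $$ (b,i))) \<ge> g e i / sqrt E"
    proof (cases "i \<in> J x")
      case True
      have "(\<Sum>\<gamma><c. cnj (Y $$ (\<gamma>,e*d+i)) * (\<Sum>b<d. V S $$ (e*c+\<gamma>,b) * F x $$ (b,i))) =
         (\<Sum>\<gamma><c. cnj (Y $$ (\<gamma>,e*d+i)) * W x S $$ (\<gamma>,e*d+i)) / sqrt E"
        using True vf by (simp add: sum_divide_distrib)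
      also have "(\<Sum>\<gamma><c. cnj (Y $$ (\<gamma>,e*d+i)) * W x S $$ (\<gamma>,e*d+i)) = (adj Y * W x S) $$ (e*d+i,e*d+i)"
        using k pW(1) W_carrier[of x S] by (subst mult_entry'[of _ "E*d" c _ "E*d"]) auto
      finally show ?thesis using pW(3)[OF k] True sE by (simp add: g_def divide_right_mono)
    next
      case False
      \<comment> \<open>A zero column of \<open>W x S\<close> stays zero in the polar part, so
        nothing negative is contributed from outside \<open>J x\<close>.\<close>
      have "Y $$ (\<gamma>,e*d+i) = 0" if "\<gamma> < c" for \<gamma>
        using False kd k that by (intro pW(6)[OF k]) (auto simp: W_def)
      then show ?thesis using False by (simp add: g_def)
    qed
    moreover have "Re (\<Sum>\<gamma><c. cnj (Y $$ (\<gamma>,e*d+i)) * \<delta> e i \<gamma>) \<ge> - (\<tau> / sqrt E + sqrt E / \<tau> * (\<Sum>\<gamma><c. (cmod (\<delta> e i \<gamma>))\<^sup>2)) / 2"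
    proof -
      \<comment> \<open>The weights are chosen so that summing over the \<open>E\<close> blocks and
        dividing by sqrt E leaves half of \<open>\<tau> + loss S x / \<tau>\<close>.\<close>
      have am: "- Re (cnj y * z) \<le> (\<tau> / sqrt E * (cmod y)\<^sup>2 + sqrt E / \<tau> * (cmod z)\<^sup>2) / 2" for y z
      proof -
        define s where "s = \<tau> / sqrt E"
        have s: "s > 0" "sqrt E / \<tau> = 1 / s" using \<tau>_pos sE by (auto simp: s_def)
        have "- Re (cnj y * z) \<le> cmod (cnj y * z)" by (metis abs_Re_le_cmod abs_le_iff)
        also have "\<dots> = cmod y * cmod z" by (simp add: norm_mult)
        also have "\<dots> \<le> (s * (cmod y)\<^sup>2 + 1 / s * (cmod z)\<^sup>2) / 2"
        proof -
          have "0 \<le> (s * cmod y - cmod z)\<^sup>2 / s" using s by simp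
          also have "\<dots> = s * (cmod y)\<^sup>2 + 1 / s * (cmod z)\<^sup>2 - 2 * (cmod y * cmod z)"
            using s by (simp add: power2_diff field_simps power2_eq_square)
          finally show ?thesis by simp
        qed
        finally show ?thesis unfolding s(2) by (simp add: s_def)
      qed
      have "- Re (\<Sum>\<gamma><c. cnj (Y $$ (\<gamma>,e*d+i)) * \<delta> e i \<gamma>) = (\<Sum>\<gamma><c. - Re (cnj (Y $$ (\<gamma>,e*d+i)) * \<delta> e i \<gamma>))"
        by (simp only: Re_sum sum_negf)
      also have "\<dots> \<le> (\<Sum>\<gamma><c. (\<tau> / sqrt E * (cmod (Y $$ (\<gamma>,e*d+i)))\<^sup>2 + sqrt E / \<tau> * (cmod (\<delta> e i \<gamma>))\<^sup>2) / 2)"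
        by (intro sum_mono am)
      also have "\<dots> = (\<tau> / sqrt E * (\<Sum>\<gamma><c. (cmod (Y $$ (\<gamma>,e*d+i)))\<^sup>2) + sqrt E / \<tau> * (\<Sum>\<gamma><c. (cmod (\<delta> e i \<gamma>))\<^sup>2)) / 2"
        by (simp add: sum.distrib sum_distrib_left flip: sum_divide_distrib)
      also have "\<dots> \<le> (\<tau> / sqrt E * 1 + sqrt E / \<tau> * (\<Sum>\<gamma><c. (cmod (\<delta> e i \<gamma>))\<^sup>2)) / 2"
        using pW(4)[OF k] \<tau>_pos sE by (intro divide_right_mono add_right_mono mult_left_mono) auto
      finally show ?thesis by simp
    qed
    ultimately show ?thesis by (simp only: plus_complex.sel)
  qed
  have J_sub: "J x \<subseteq> {..<d}" using J[OF x] .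
  have gg: "(\<Sum>i<d. lam x i * g e i) = (\<Sum>i\<in>J x. lam x i * g e i)" for e
    using J_sub by (intro sum.mono_neutral_right) (auto simp: g_def)
  have gain: "(\<Sum>e<E. \<Sum>i<d. lam x i * g e i) = E * gain S x"
    unfolding gg gain_def using E_pos by (simp add: g_def)
  have loss: "(\<Sum>e<E. \<Sum>i<d. lam x i * (\<Sum>\<gamma><c. (cmod (\<delta> e i \<gamma>))\<^sup>2)) = loss S x"
    unfolding loss_def \<delta>_def ..
  have "Re (\<Sum>e<E. \<Omega> S x e) = (\<Sum>e<E. \<Sum>i<d. lam x i * Re (A e i))"
    unfolding \<Omega>_def Re_sum A_def Y_def by (simp only: Re_complex_of_real[symmetric] times_complex.sel) simp
  also have "\<dots> \<ge> (\<Sum>e<E. \<Sum>i<d. lam x i * (g e i / sqrt E - (\<tau> / sqrt E + sqrt E / \<tau> * (\<Sum>\<gamma><c. (cmod (\<delta> e i \<gamma>))\<^sup>2)) / 2))"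
    using A lam_nonneg[OF x] by (intro sum_mono mult_left_mono) auto
  also have "(\<Sum>e<E. \<Sum>i<d. lam x i * (g e i / sqrt E - (\<tau> / sqrt E + sqrt E / \<tau> * (\<Sum>\<gamma><c. (cmod (\<delta> e i \<gamma>))\<^sup>2)) / 2))
     = (\<Sum>e<E. \<Sum>i<d. lam x i * g e i) / sqrt E - (\<tau> / sqrt E) / 2 * (\<Sum>e<E. \<Sum>i<d. lam x i)
       - sqrt E / \<tau> / 2 * (\<Sum>e<E. \<Sum>i<d. lam x i * (\<Sum>\<gamma><c. (cmod (\<delta> e i \<gamma>))\<^sup>2))"
  proof -
    have t: "l * (y / s - (u / s + s / u * a) / 2) = l * y / s - u / s / 2 * l - s / u / 2 * (l * a)" for l y s u a :: real
      by (simp add: algebra_simps add_divide_distrib)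
    show ?thesis unfolding t sum_subtractf sum_distrib_left[symmetric] sum_divide_distrib[symmetric] ..
  qed
  also have "\<dots> = sqrt E * (gain S x - (\<tau> + loss S x / \<tau>) / 2)"
  proof -
    have t: "(s * s * y) / s - u / s / 2 * (s * s) - s / u / 2 * l = s * (y - (u + l / u) / 2)"
      if "s > 0" "u > 0" for s u y l :: real
      using that by (simp add: field_simps)
    have "(\<Sum>e<E. \<Sum>i<d. lam x i) = real E" using lam_sum[OF x] by simp
    moreover have "sqrt E * sqrt E = real E" by simp
    ultimately show ?thesis unfolding gain loss using t[OF sE \<tau>_pos, of "gain S x" "loss S x"] by (simp only:)
  qed
  finally show ?thesis using sE by (simp add: pos_le_divide_eq mult.commute)
qed

definition code_fidelity :: "(nat \<times> nat \<times> nat) set \<Rightarrow> real" where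
  "code_fidelity S = fidelity (ensemble_state M P \<Psi> d r)
     (code_state M P \<Psi> d r c (Enc S) (controlled M (Dec S)))"

lemma code_fidelity_bound:
  "code_fidelity S \<ge> (\<Sum>x<M. P x * gain S x) - \<tau> / 2 - (\<Sum>x<M. P x * loss S x) / (2 * \<tau>)"
proof -
  have "(\<Sum>x<M. P x * gain S x) - \<tau> / 2 - (\<Sum>x<M. P x * loss S x) / (2 * \<tau>) =
     (\<Sum>x<M. P x * gain S x) - \<tau> / 2 * (\<Sum>x<M. P x) - (\<Sum>x<M. P x * loss S x) / (2 * \<tau>)"
    by (simp add: P_sum)
  also have "\<dots> = (\<Sum>x<M. P x * (gain S x - (\<tau> + loss S x / \<tau>) / 2))"
    unfolding sum_distrib_left sum_divide_distrib sum_subtractf[symmetric]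
    using \<tau>_pos by (intro sum.cong refl) (simp add: field_simps)
  also have "\<dots> \<le> (\<Sum>x<M. sqrt (\<Sum>D\<leftarrow>Dec S x. \<Sum>K\<leftarrow>Enc S. (P x * cmod (mtrace (D * K * marginal d r (\<Psi> x))))\<^sup>2))"
  proof (rule sum_mono)
    fix x assume "x \<in> {..<M}" then have x: "x < M" by simp
    have "P x * (gain S x - (\<tau> + loss S x / \<tau>) / 2) \<le> P x * (Re (\<Sum>e<E. \<Omega> S x e) / sqrt (real E))"
      using overlap_bound[OF x] P_nonneg[OF x] by (intro mult_left_mono) auto
    also have "\<dots> \<le> P x * sqrt (\<Sum>e<E. (cmod (\<Omega> S x e))\<^sup>2)"
      using Re_sum_le_sqrt[OF E_pos] P_nonneg[OF x] by (intro mult_left_mono) auto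
    also have "\<dots> = sqrt ((P x)\<^sup>2 * (\<Sum>e<E. (cmod (\<Omega> S x e))\<^sup>2))"
      using P_nonneg[OF x] by (simp add: real_sqrt_mult)
    also have "\<dots> \<le> sqrt (\<Sum>D\<leftarrow>Dec S x. \<Sum>K\<leftarrow>Enc S. (P x * cmod (mtrace (D * K * marginal d r (\<Psi> x))))\<^sup>2)"
      using overlap_sum[OF x] by simp
    finally show "P x * (gain S x - (\<tau> + loss S x / \<tau>) / 2) \<le>
      sqrt (\<Sum>D\<leftarrow>Dec S x. \<Sum>K\<leftarrow>Enc S. (P x * cmod (mtrace (D * K * marginal d r (\<Psi> x))))\<^sup>2)" .
  qed
  also have "\<dots> = code_fidelity S"
    unfolding code_fidelity_def
    by (intro fidelity_controlled_code[symmetric] P_nonneg dim_\<Psi> is_channel_carrier[OF Enc_channel] is_channel_carrier[OF Dec_channel])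
  finally show ?thesis .
qed

section \<open>Averages over the signs\<close>

text \<open>The weight of eigenvector \<open>i\<close> of the marginal at \<open>x\<close> inside
  the span of \<open>T\<close>.\<close>

definition \<pi> :: "nat \<Rightarrow> nat \<Rightarrow> real" where "\<pi> x i = (\<Sum>b\<in>T. (cmod (F x $$ (b,i)))\<^sup>2)"

lemma \<pi>_le_1: assumes "x < M" "i < d" shows "\<pi> x i \<le> 1"
proof -
  have "(adj (F x) * F x) $$ (i,i) = complex_of_real (\<Sum>b<d. (cmod (F x $$ (b,i)))\<^sup>2)"
    using gram_diag[OF unitaryD(1)[OF F[OF assms(1)]] assms(2)] .
  then have "complex_of_real (\<Sum>b<d. (cmod (F x $$ (b,i)))\<^sup>2) = 1"
    using unitaryD(3)[OF F[OF assms(1)]] assms by simp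
  then have "(\<Sum>b<d. (cmod (F x $$ (b,i)))\<^sup>2) = 1" by (simp only: of_real_eq_1_iff)
  then show ?thesis unfolding \<pi>_def using T sum_mono2[of "{..<d}" T "\<lambda>b. (cmod (F x $$ (b,i)))\<^sup>2"] by auto
qed

lemma \<pi>_nonneg: "\<pi> x i \<ge> 0"
  unfolding \<pi>_def by (intro sum_nonneg) auto

text \<open>The expected squared norm of a column is \<open>\<pi> x i\<close>. In a Gram row, the
  means inside the own block contribute at most \<open>\<pi> x i\<close> by Parseval, and each of
  the E card(J x) entries adds a fluctuation of at most 2 / c. The coefficients 3/2 and -1/2 then
  leave \<open>\<pi> x i\<close> minus E R / c.\<close>

lemma gain_avg:
  assumes x: "x < M"
  shows "sign_avg signs (\<lambda>S. gain S x) \<ge> (\<Sum>i\<in>J x. lam x i * \<pi> x i) - real E * R / real c"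
proof -
  note Fc = F[OF x]
  have J_sub: "J x \<subseteq> {..<d}" by (rule J[OF x])
  have cr: "real c > 0" using c_pos by simp
  let ?w = "\<lambda>S e i \<gamma>. \<Sum>b\<in>T. F x $$ (b,i) * rsign S (e,\<gamma>,b)"
  have Wk: "W x S $$ (\<gamma>,e*d+i) = (if i \<in> J x then ?w S e i \<gamma> / sqrt c else 0)" if "\<gamma> < c" "e < E" "i < d" for S e i \<gamma>
    using that pair_index_less[of e E i d] by (auto simp: W_def)
  have n1: "sign_avg signs (\<lambda>S. \<Sum>\<gamma><c. (cmod (W x S $$ (\<gamma>,e*d+i)))\<^sup>2) = \<pi> x i" if e: "e < E" and i: "i \<in> J x" for e i
  proof -
    have "i < d" using i J_sub by auto
    have "(\<Sum>\<gamma><c. (cmod (W x S $$ (\<gamma>,e*d+i)))\<^sup>2) = 1 / c * (\<Sum>\<gamma><c. (cmod (?w S e i \<gamma>))\<^sup>2)" for S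
    proof -
      have "(cmod (W x S $$ (\<gamma>,e*d+i)))\<^sup>2 = 1 / c * (cmod (?w S e i \<gamma>))\<^sup>2" if "\<gamma> < c" for \<gamma>
        unfolding Wk[OF that e \<open>i < d\<close>] using i by (simp add: norm_divide power_divide)
      then show ?thesis by (simp add: sum_distrib_left)
    qed
    then show ?thesis
      using sign_avg_block_norm[OF fin_T e, of c "\<lambda>b. F x $$ (b,i)"] cr by (simp only: sign_avg_cmult) (simp add: \<pi>_def)
  qed
  have n2: "sign_avg signs (\<lambda>S. \<Sum>l<E*d. (cmod (G x S $$ (e*d+i,l)))\<^sup>2) \<le> \<pi> x i + 2 * (E * R / c)"
    if e: "e < E" and i: "i \<in> J x" for e i
  proof -
    have id: "i < d" using i J_sub by auto
    let ?I = "\<lambda>j. cmod (\<Sum>b\<in>T. cnj (F x $$ (b,i)) * F x $$ (b,j))"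
    have G: "(cmod (G x S $$ (e*d+i,e'*d+j)))\<^sup>2 =
       (if j \<in> J x then 1 / c\<^sup>2 * (cmod (\<Sum>\<gamma><c. cnj (?w S e i \<gamma>) * ?w S e' j \<gamma>))\<^sup>2 else 0)" if e': "e' < E" and j: "j < d" for S e' j
    proof -
      have "G x S $$ (e*d+i,e'*d+j) = (\<Sum>\<gamma><c. cnj (W x S $$ (\<gamma>,e*d+i)) * W x S $$ (\<gamma>,e'*d+j))"
        using W_carrier[of x S] pair_index_less[OF e id] pair_index_less[OF e' j]
        by (subst mult_entry'[of _ "E*d" c _ "E*d"]) auto
      also have "\<dots> = (if j \<in> J x then 1 / complex_of_real c * (\<Sum>\<gamma><c. cnj (?w S e i \<gamma>) * ?w S e' j \<gamma>) else 0)"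
      proof (cases "j \<in> J x")
        case True
        have s: "complex_of_real (sqrt c) * complex_of_real (sqrt c) = complex_of_real c" by (simp flip: of_real_mult)
        have "cnj (W x S $$ (\<gamma>,e*d+i)) * W x S $$ (\<gamma>,e'*d+j) = 1 / complex_of_real c * (cnj (?w S e i \<gamma>) * ?w S e' j \<gamma>)"
          if "\<gamma> < c" for \<gamma>
          unfolding Wk[OF that e id] Wk[OF that e' j] using i True s
          by (simp only: if_True complex_cnj_divide complex_cnj_complex_of_real times_divide_times_eq) simp
        then show ?thesis using True by (simp add: sum_distrib_left)
      qed (use Wk e' j in auto)
      finally show ?thesis by (simp add: norm_mult power_mult_distrib norm_divide power_divide)
    qed
    have fin: "finite signs" using fin_T by simp
    have each: "sign_avg signs (\<lambda>S. (cmod (G x S $$ (e*d+i,e'*d+j)))\<^sup>2) \<le>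
       (if j \<in> J x then (if e' = e then (?I j)\<^sup>2 else 0) + 2 / c else 0)" if e': "e' < E" and j: "j < d" for e' j
    proof (cases "j \<in> J x")
      case True
      have "sign_avg signs (\<lambda>S. (cmod (G x S $$ (e*d+i,e'*d+j)))\<^sup>2) =
         1 / c\<^sup>2 * sign_avg signs (\<lambda>S. (cmod (\<Sum>\<gamma><c. cnj (?w S e i \<gamma>) * ?w S e' j \<gamma>))\<^sup>2)"
        unfolding G[OF e' j] sign_avg_cmult[symmetric] using True by simp
      also have "\<dots> \<le> 1 / c\<^sup>2 * ((if e = e' then (c * ?I j)\<^sup>2 else 0) + 2 * c * \<pi> x i * \<pi> x j)"
        unfolding \<pi>_def by (intro mult_left_mono sign_avg_block_overlap[OF fin_T e e']) auto
      also have "\<dots> \<le> 1 / c\<^sup>2 * ((if e = e' then (c * ?I j)\<^sup>2 else 0) + 2 * c * 1)"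
      proof -
        have "\<pi> x i * \<pi> x j \<le> 1"
          using \<pi>_le_1[OF x id] \<pi>_le_1[OF x j] \<pi>_nonneg[of x j] by (intro mult_le_one)
        then have "2 * c * \<pi> x i * \<pi> x j \<le> 2 * c * 1"
          using mult_left_mono[of "\<pi> x i * \<pi> x j" 1 "2 * real c"] by (simp only: mult.assoc) simp
        then show ?thesis by (intro mult_left_mono add_left_mono) auto
      qed
      also have "\<dots> = (if e' = e then (?I j)\<^sup>2 else 0) + 2 / c"
        using cr by (auto simp: field_simps power2_eq_square)
      finally show ?thesis using True by simp
    qed (simp add: G[OF e' j] sign_avg_const[OF fin])
    have "sign_avg signs (\<lambda>S. \<Sum>l<E*d. (cmod (G x S $$ (e*d+i,l)))\<^sup>2) =
      (\<Sum>e'<E. \<Sum>j<d. sign_avg signs (\<lambda>S. (cmod (G x S $$ (e*d+i,e'*d+j)))\<^sup>2))"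
      unfolding sum_lessThan_mult sign_avg_sum ..
    also have "\<dots> \<le> (\<Sum>e'<E. \<Sum>j<d. if j \<in> J x then (if e' = e then (?I j)\<^sup>2 else 0) + 2 / c else 0)"
      by (intro sum_mono each) auto
    also have "\<dots> = (\<Sum>e'<E. \<Sum>j\<in>J x. (if e' = e then (?I j)\<^sup>2 else 0) + 2 / c)"
    proof (rule sum.cong[OF refl])
      fix e'
      have "{..<d} \<inter> J x = J x" using J_sub by auto
      then show "(\<Sum>j<d. if j \<in> J x then (if e' = e then (?I j)\<^sup>2 else 0) + 2 / c else 0) =
          (\<Sum>j\<in>J x. (if e' = e then (?I j)\<^sup>2 else 0) + 2 / c)"
        using sum.inter_restrict[of "{..<d}" "\<lambda>j. (if e' = e then (?I j)\<^sup>2 else 0) + 2 / real c" "J x"] by simp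
    qed
    also have "\<dots> = (\<Sum>e'<E. if e' = e then (\<Sum>j\<in>J x. (?I j)\<^sup>2) else 0) + 2 * (real E * real (card (J x)) / c)"
    proof -
      have "(\<Sum>j\<in>J x. (if e' = e then (?I j)\<^sup>2 else 0) + 2 / c) =
          (if e' = e then (\<Sum>j\<in>J x. (?I j)\<^sup>2) else 0) + card (J x) * (2 / c)" for e'
        by (simp add: sum.distrib)
      then show ?thesis by (simp add: sum.distrib mult_ac)
    qed
    also have "(\<Sum>e'<E. if e' = e then (\<Sum>j\<in>J x. (?I j)\<^sup>2) else 0) = (\<Sum>j\<in>J x. (?I j)\<^sup>2)" using e by simp
    \<comment> \<open>Enlarging \<open>J x\<close> to a full basis makes Parseval
      applicable.\<close>
    also have "\<dots> \<le> (\<Sum>j<d. (?I j)\<^sup>2)" using J_sub by (intro sum_mono2) auto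
    also have "\<dots> = \<pi> x i"
      unfolding \<pi>_def by (rule unitary_parseval[OF Fc T])
    also have "2 * (real E * real (card (J x)) / c) \<le> 2 * (E * R / c)"
      using card_J[OF x] cr by (intro mult_left_mono divide_right_mono) auto
    finally show ?thesis by simp
  qed
  have "(\<Sum>i\<in>J x. lam x i * \<pi> x i) - real E * R / real c \<le> (\<Sum>i\<in>J x. lam x i * \<pi> x i) - (\<Sum>i\<in>J x. lam x i) * (real E * R / real c)"
  proof -
    have "(\<Sum>i\<in>J x. lam x i) \<le> 1"
      unfolding lam_sum[OF x, symmetric] using J_sub lam_nonneg[OF x] by (intro sum_mono2) auto
    moreover have "real E * R / real c \<ge> 0"
      using card_J[OF x] order_trans[of 0 "real (card (J x))" R] by auto
    ultimately show ?thesis using mult_right_mono[of "\<Sum>i\<in>J x. lam x i" 1 "real E * R / real c"] by simp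
  qed
  also have "\<dots> = (\<Sum>e<E. \<Sum>i\<in>J x. lam x i * (3/2 * \<pi> x i - 1/2 * (\<pi> x i + 2 * (E * R / c)))) / E"
  proof -
    have t: "l * (3/2 * p - 1/2 * (p + 2 * k)) = l * p - l * k" for l p k :: real
      by (simp add: algebra_simps)
    show ?thesis unfolding t sum_subtractf sum_distrib_right[symmetric] using E_pos by (simp add: diff_divide_distrib)
  qed
  also have "\<dots> \<le> (\<Sum>e<E. \<Sum>i\<in>J x. lam x i * (3/2 * sign_avg signs (\<lambda>S. \<Sum>\<gamma><c. (cmod (W x S $$ (\<gamma>,e*d+i)))\<^sup>2)
      - 1/2 * sign_avg signs (\<lambda>S. \<Sum>l<E*d. (cmod (G x S $$ (e*d+i,l)))\<^sup>2))) / E"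
    using n1 n2 J_sub lam_nonneg[OF x]
    by (intro divide_right_mono sum_mono mult_left_mono diff_mono) auto
  also have "\<dots> = sign_avg signs (\<lambda>S. gain S x)"
    unfolding gain_def by (simp only: sign_avg_sum sign_avg_diff sign_avg_cmult divide_inverse mult.commute[of _ "inverse (real E)"])
  finally show ?thesis .
qed

text \<open>Averaged over \<open>x\<close>, the cross terms between columns of
  \<open>\<Delta> S\<close> disappear because the average state is diagonal, which leaves the
  squared column norms weighted by \<open>q\<close>. By the polar estimate each is at most the sum
  of squared overlaps with the other columns in \<open>T\<close>, whose means are at most 2 / (E
  c).\<close>

lemma loss_avg: "sign_avg signs (\<lambda>S. \<Sum>x<M. P x * loss S x) \<le> \<tau>\<^sup>2"
proof -
  have Ec: "real E * real c > 0" using E_pos c_pos by simp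
  have spread: "(\<Sum>x<M. P x * loss S x) = (\<Sum>b<d. q b * (\<Sum>k<E*c. (cmod (\<Delta> S k b))\<^sup>2))" for S
  proof -
    have "complex_of_real (\<Sum>x<M. P x * loss S x) = (\<Sum>x<M. \<Sum>k<E*c. \<Sum>i<d. \<Sum>b<d. \<Sum>b'<d.
       \<Delta> S k b * cnj (\<Delta> S k b') * (P x * lam x i * F x $$ (b,i) * cnj (F x $$ (b',i))))"
    proof -
      have l: "loss S x = (\<Sum>k<E*c. \<Sum>i<d. lam x i * (cmod (\<Sum>b<d. \<Delta> S k b * F x $$ (b,i)))\<^sup>2)" for x
        unfolding loss_def sum_distrib_left sum_lessThan_mult by (intro sum.cong refl sum.swap)
      have z: "complex_of_real ((cmod (\<Sum>b<d. \<Delta> S k b * F x $$ (b,i)))\<^sup>2) =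
          (\<Sum>b<d. \<Sum>b'<d. \<Delta> S k b * F x $$ (b,i) * cnj (\<Delta> S k b' * F x $$ (b',i)))" for k x i
        unfolding complex_norm_square cnj_sum sum_product ..
      show ?thesis unfolding l
        by (simp only: of_real_sum of_real_mult z sum_distrib_left) (intro sum.cong refl, simp add: mult_ac)
    qed
    also have "\<dots> = (\<Sum>k<E*c. \<Sum>b<d. \<Sum>b'<d. \<Sum>x<M. \<Sum>i<d.
       \<Delta> S k b * cnj (\<Delta> S k b') * (P x * lam x i * F x $$ (b,i) * cnj (F x $$ (b',i))))"
    proof (subst sum.swap, rule sum.cong[OF refl])
      fix k
      let ?h = "\<lambda>x i b b'. \<Delta> S k b * cnj (\<Delta> S k b') * (P x * lam x i * F x $$ (b,i) * cnj (F x $$ (b',i)))"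
      have "(\<Sum>x<M. \<Sum>i<d. \<Sum>b<d. \<Sum>b'<d. ?h x i b b') = (\<Sum>x<M. \<Sum>b<d. \<Sum>b'<d. \<Sum>i<d. ?h x i b b')"
        by (rule sum.cong[OF refl], subst sum.swap, rule sum.cong[OF refl], rule sum.swap)
      also have "\<dots> = (\<Sum>b<d. \<Sum>b'<d. \<Sum>x<M. \<Sum>i<d. ?h x i b b')"
        by (subst sum.swap, rule sum.cong[OF refl], rule sum.swap)
      finally show "(\<Sum>x<M. \<Sum>i<d. \<Sum>b<d. \<Sum>b'<d. ?h x i b b') = (\<Sum>b<d. \<Sum>b'<d. \<Sum>x<M. \<Sum>i<d. ?h x i b b')" .
    qed
    also have "\<dots> = (\<Sum>k<E*c. \<Sum>b<d. \<Sum>b'<d. if b' = b then \<Delta> S k b * cnj (\<Delta> S k b) * q b else 0)"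
      unfolding sum_distrib_left[symmetric] F_def using avg by (intro sum.cong refl) auto
    also have "\<dots> = (\<Sum>k<E*c. \<Sum>b<d. complex_of_real (q b * (cmod (\<Delta> S k b))\<^sup>2))"
      by (simp add: complex_norm_square mult.commute del: of_real_power)
    also have "\<dots> = complex_of_real (\<Sum>b<d. q b * (\<Sum>k<E*c. (cmod (\<Delta> S k b))\<^sup>2))"
      unfolding of_real_sum[symmetric] sum_distrib_left by (subst sum.swap) (rule refl)
    finally show ?thesis by (simp only: of_real_eq_iff)
  qed
  have Vg: "H S $$ (b,l) = (if b \<in> T \<and> l \<in> T then (\<Sum>e<E. \<Sum>\<gamma><c. complex_of_real (rsign S (e,\<gamma>,b) * rsign S (e,\<gamma>,l))) / complex_of_real (real E * real c) else 0)"
    if "b < d" "l < d" for S b l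
  proof -
    have "H S $$ (b,l) = (\<Sum>k<E*c. cnj (V S $$ (k,b)) * V S $$ (k,l))"
      using V_carrier[of S] that by (subst mult_entry'[of _ d "E*c" _ d]) auto
    also have "\<dots> = (\<Sum>e<E. \<Sum>\<gamma><c. cnj (V S $$ (e*c+\<gamma>,b)) * V S $$ (e*c+\<gamma>,l))"
      by (rule sum_lessThan_mult)
    also have "\<dots> = (\<Sum>e<E. \<Sum>\<gamma><c. if b \<in> T \<and> l \<in> T then complex_of_real (rsign S (e,\<gamma>,b) * rsign S (e,\<gamma>,l)) / complex_of_real (real E * real c) else 0)"
    proof (intro sum.cong refl)
      fix e \<gamma> assume a: "e \<in> {..<E}" "\<gamma> \<in> {..<c}"
      have "complex_of_real (sqrt (real E * real c)) * complex_of_real (sqrt (real E * real c)) = complex_of_real (real E * real c)"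
        using Ec by (simp flip: of_real_mult)
      then show "cnj (V S $$ (e*c+\<gamma>,b)) * V S $$ (e*c+\<gamma>,l) =
         (if b \<in> T \<and> l \<in> T then complex_of_real (rsign S (e,\<gamma>,b) * rsign S (e,\<gamma>,l)) / complex_of_real (real E * real c) else 0)"
        using a that pair_index_less[of e E \<gamma> c] by (auto simp: V_def)
    qed
    finally show ?thesis by (cases "b \<in> T"; cases "l \<in> T") (simp_all add: sum_divide_distrib)
  qed
  \<comment> \<open>The columns in \<open>T\<close> have norm exactly 1, so only the off-diagonal
    part of \<open>H S\<close> is random.\<close>
  have col: "(\<Sum>k<E*c. (cmod (V S $$ (k,b)))\<^sup>2) = 1" if b: "b \<in> T" for S b
  proof -
    have bd: "b < d" using b T by auto
    have "rsign S i * rsign S i = 1" for i by (simp add: rsign_def)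
    then have "H S $$ (b,b) = 1" using E_pos c_pos b by (simp add: Vg[OF bd bd])
    then show ?thesis using gram_diag[OF V_carrier bd, of S] by (simp only: of_real_eq_1_iff)
  qed
  have D: "(\<Sum>k<E*c. (cmod (\<Delta> S k b))\<^sup>2) \<le> (if b \<in> T then \<Sum>l\<in>T-{b}. (cmod (H S $$ (b,l)))\<^sup>2 else 0)" if b: "b < d" for S b
  proof (cases "b \<in> T")
    case True
    \<comment> \<open>The unit column turns the last two terms of the polar estimate into -1, which
      cancels the diagonal entry of \<open>H S\<close> below.\<close>
    have "(\<Sum>k<E*c. (cmod (\<Delta> S k b))\<^sup>2) \<le> (\<Sum>l<d. (cmod (H S $$ (b,l)))\<^sup>2) - 1"
      using polar(5)[OF V_carrier b, of S] col[OF True, of S] unfolding \<Delta>_def by simp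
    also have "(\<Sum>l<d. (cmod (H S $$ (b,l)))\<^sup>2) = (\<Sum>l\<in>T. (cmod (H S $$ (b,l)))\<^sup>2)"
      using T Vg[OF b, of _ S] by (intro sum.mono_neutral_right) auto
    also have "\<dots> = (cmod (H S $$ (b,b)))\<^sup>2 + (\<Sum>l\<in>T-{b}. (cmod (H S $$ (b,l)))\<^sup>2)"
      using True fin_T by (subst sum.remove) auto
    also have "H S $$ (b,b) = 1" using gram_diag[OF V_carrier b, of S] col[OF True, of S] by simp
    finally show ?thesis using True by simp
  next
    case False
    have "V S $$ (k,b) = 0" if "k < E*c" for k using that b False by (auto simp: V_def)
    then have "\<Delta> S k b = 0" if "k < E*c" for k
      using that polar(6)[OF V_carrier b, of S k] by (simp add: \<Delta>_def)
    then show ?thesis using False by simp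
  qed
  have H: "sign_avg signs (\<lambda>S. (cmod (H S $$ (b,l)))\<^sup>2) \<le> 2 / (real E * real c)" if "b \<in> T" "l \<in> T" "b \<noteq> l" for b l
  proof -
    have bl: "b < d" "l < d" using that T by auto
    have scale: "(cmod (X / complex_of_real t))\<^sup>2 = 1 / t\<^sup>2 * (cmod X)\<^sup>2" for X t
      by (simp add: norm_divide power_divide)
    have "(cmod (H S $$ (b,l)))\<^sup>2 = 1 / (real E * real c)\<^sup>2 *
       (cmod (\<Sum>e<E. \<Sum>\<gamma><c. complex_of_real (rsign S (e,\<gamma>,b) * rsign S (e,\<gamma>,l))))\<^sup>2" for S
      unfolding Vg[OF bl] using that by (simp only: scale simp_thms if_True)
    then have "sign_avg signs (\<lambda>S. (cmod (H S $$ (b,l)))\<^sup>2) \<le> 1 / (real E * real c)\<^sup>2 * (2 * (real E * real c))"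
      using sign_avg_column_overlap[OF fin_T that, where E=E and c=c] by (simp only: sign_avg_cmult) (intro mult_left_mono, auto)
    moreover have "1 / t\<^sup>2 * (2 * t) = 2 / t" if "t > 0" for t :: real
      using that by (simp add: power2_eq_square)
    ultimately show ?thesis using Ec by (simp only:)
  qed
  have "sign_avg signs (\<lambda>S. \<Sum>x<M. P x * loss S x) \<le>
     sign_avg signs (\<lambda>S. \<Sum>b<d. q b * (if b \<in> T then \<Sum>l\<in>T-{b}. (cmod (H S $$ (b,l)))\<^sup>2 else 0))"
    unfolding spread using D q_nonneg by (intro sign_avg_mono sum_mono mult_left_mono) auto
  also have "\<dots> = (\<Sum>b<d. q b * (if b \<in> T then \<Sum>l\<in>T-{b}. sign_avg signs (\<lambda>S. (cmod (H S $$ (b,l)))\<^sup>2) else 0))"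
    unfolding sign_avg_sum sign_avg_cmult using fin_T by (intro sum.cong refl) (simp add: sign_avg_sum sign_avg_const)
  also have "\<dots> \<le> (\<Sum>b<d. q b * \<tau>\<^sup>2)"
  proof (intro sum_mono mult_left_mono q_nonneg)
    fix b assume b: "b \<in> {..<d}"
    show "(if b \<in> T then \<Sum>l\<in>T-{b}. sign_avg signs (\<lambda>S. (cmod (H S $$ (b,l)))\<^sup>2) else 0) \<le> \<tau>\<^sup>2"
    proof (cases "b \<in> T")
      case True
      have "(\<Sum>l\<in>T-{b}. sign_avg signs (\<lambda>S. (cmod (H S $$ (b,l)))\<^sup>2)) \<le> (\<Sum>l\<in>T-{b}. 2 / (real E * real c))"
        using True by (intro sum_mono H) auto
      also have "\<dots> \<le> (\<Sum>l\<in>T. 2 / (real E * real c))"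
        using fin_T by (intro sum_mono2) auto
      also have "\<dots> \<le> \<tau>\<^sup>2" using card_T Ec by (simp add: pos_divide_le_eq mult.commute)
      finally show ?thesis using True by simp
    qed simp
  qed auto
  also have "\<dots> = \<tau>\<^sup>2" using q_sum by (simp flip: sum_distrib_right)
  finally show ?thesis .
qed

text \<open>The expected loss of at most \<tau>^2, divided by \<open>2 * \<tau>\<close>, matches the
  other error \<open>\<tau> / 2\<close>; together they give the final \<open>\<tau>\<close>.\<close>

theorem good_code_exists:
  "\<exists>Ks Ls. is_channel d c Ks \<and> is_channel (M*c) (M*d) Ls \<and>
     fidelity (ensemble_state M P \<Psi> d r) (code_state M P \<Psi> d r c Ks Ls)
     \<ge> (\<Sum>x<M. \<Sum>i\<in>J x. P x * lam x i * \<pi> x i) - real E * R / real c - \<tau>"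
proof -
  have fin: "finite signs" using fin_T by simp
  \<comment> \<open>The bound of \<open>code_fidelity_bound\<close> is linear in \<open>gain\<close>
    and \<open>loss\<close>, so its mean needs only their means.\<close>
  let ?X = "\<lambda>S. (\<Sum>x<M. P x * gain S x) - \<tau> / 2 - 1 / (2 * \<tau>) * (\<Sum>x<M. P x * loss S x)"
  obtain S where S: "?X S \<ge> sign_avg signs ?X" using sign_avg_attained[OF fin, of ?X] by blast
  have "sign_avg signs ?X = (\<Sum>x<M. P x * sign_avg signs (\<lambda>S. gain S x)) - \<tau> / 2 - 1 / (2 * \<tau>) * sign_avg signs (\<lambda>S. \<Sum>x<M. P x * loss S x)"
    by (simp only: sign_avg_diff sign_avg_cmult sign_avg_sum sign_avg_const[OF fin])
  also have "\<dots> \<ge> (\<Sum>x<M. P x * ((\<Sum>i\<in>J x. lam x i * \<pi> x i) - real E * R / real c)) - \<tau> / 2 - 1 / (2 * \<tau>) * \<tau>\<^sup>2"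
    using loss_avg gain_avg P_nonneg \<tau>_pos by (intro diff_mono sum_mono mult_left_mono) auto
  also have "(\<Sum>x<M. P x * ((\<Sum>i\<in>J x. lam x i * \<pi> x i) - real E * R / real c)) =
     (\<Sum>x<M. \<Sum>i\<in>J x. P x * lam x i * \<pi> x i) - (\<Sum>x<M. P x) * (real E * R / real c)"
    by (simp only: right_diff_distrib sum_subtractf sum_distrib_left sum_distrib_right mult.assoc)
  also have "1 / (2 * \<tau>) * \<tau>\<^sup>2 = \<tau> / 2" using \<tau>_pos by (simp add: power2_eq_square)
  finally have "(\<Sum>x<M. \<Sum>i\<in>J x. P x * lam x i * \<pi> x i) - real E * R / real c - \<tau> \<le> sign_avg signs ?X"
    by (simp add: P_sum)
  also note S
  also have "?X S \<le> code_fidelity S" using code_fidelity_bound[of S] by simp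
  finally show ?thesis
    unfolding code_fidelity_def using Enc_channel[of S] controlled_channel[of M c d "Dec S", OF Dec_channel] by blast
qed

end

section \<open>Tensor powers and entropies\<close>

lemma digit_less: "d > 0 \<Longrightarrow> digit d i k < d"
  by (simp add: digit_def)

lemma digit_less': "i < d ^ n \<Longrightarrow> k < n \<Longrightarrow> digit d i k < d"
  by (intro digit_less) (auto intro!: Nat.gr0I simp: power_0_left)

text \<open>Digits are numbered from the least significant one, so a string is extended by a new
  leading digit in position \<open>n\<close>.\<close>

lemma digit_append:
  assumes "j < d ^ n" "a < d"
  shows "k < n \<Longrightarrow> digit d (a * d ^ n + j) k = digit d j k" "digit d (a * d ^ n + j) n = a"
proof -
  show "digit d (a * d ^ n + j) n = a" using assms by (simp add: digit_def)
  assume k: "k < n"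
  then obtain l where n: "n = k + Suc l" by (metis add_Suc_right less_iff_Suc_add)
  have e: "a * d ^ n + j = j + (a * d ^ l * d) * d ^ k" by (simp add: n power_add mult_ac)
  have "d ^ k \<noteq> 0" using assms by simp
  then have "(a * d ^ n + j) div d ^ k = j div d ^ k + a * d ^ l * d"
    unfolding e by (subst div_mult_self1) (simp_all only: add.commute not_False_eq_True)
  then show "digit d (a * d ^ n + j) k = digit d j k" by (simp add: digit_def)
qed

lemma sum_digits_Suc:
  fixes d :: nat
  shows "(\<Sum>i<d ^ Suc n. f i) = (\<Sum>a<d. \<Sum>j<d ^ n. f (a * d ^ n + j))"
  unfolding power_Suc by (rule sum_lessThan_mult)

text \<open>The distributive law over strings, from which all factorisations over the letters below
  follow.\<close>

lemma sum_prod_digits: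
  "(\<Sum>i<d ^ n. \<Prod>k<n. f k (digit d i k)) = (\<Prod>k<n. \<Sum>a<d. f k a :: 'a :: comm_semiring_1)"
proof (induction n)
  case (Suc n)
  have "(\<Sum>i<d ^ Suc n. \<Prod>k<Suc n. f k (digit d i k)) = (\<Sum>a<d. \<Sum>j<d ^ n. (\<Prod>k<n. f k (digit d j k)) * f n a)"
    unfolding sum_digits_Suc by (intro sum.cong refl) (simp add: digit_append)
  also have "\<dots> = (\<Sum>j<d ^ n. \<Prod>k<n. f k (digit d j k)) * (\<Sum>a<d. f n a)"
    by (subst sum.swap) (simp add: sum_product)
  finally show ?case using Suc by simp
qed simp

lemma digits_eq_iff:
  assumes "i < d ^ n" "j < d ^ n"
  shows "(\<forall>k<n. digit d i k = digit d j k) \<longleftrightarrow> i = j"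
  using assms
proof (induction n arbitrary: i j)
  case (Suc n)
  have d: "d > 0" using Suc.prems by (auto intro!: Nat.gr0I)
  have split: "i = (i div d ^ n) * d ^ n + i mod d ^ n" "i mod d ^ n < d ^ n" "i div d ^ n < d" if "i < d ^ Suc n" for i
    using that d by (simp_all only: div_mult_mod_eq) (simp_all add: less_mult_imp_div_less)
  let ?a = "i div d ^ n" and ?b = "j div d ^ n" and ?r = "i mod d ^ n" and ?s = "j mod d ^ n"
  note si = split[OF Suc.prems(1)] and sj = split[OF Suc.prems(2)]
  have "digit d i k = digit d ?r k" "digit d j k = digit d ?s k" if "k < n" for k
    using digit_append(1)[OF si(2,3) that] digit_append(1)[OF sj(2,3) that] si(1) sj(1) by simp_all
  moreover have "digit d i n = ?a" "digit d j n = ?b"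
    using digit_append(2)[OF si(2,3)] digit_append(2)[OF sj(2,3)] si(1) sj(1) by simp_all
  ultimately have "(\<forall>k<Suc n. digit d i k = digit d j k) \<longleftrightarrow> (\<forall>k<n. digit d ?r k = digit d ?s k) \<and> ?a = ?b"
    by (auto simp: less_Suc_eq)
  also have "\<dots> \<longleftrightarrow> ?r = ?s \<and> ?a = ?b" using Suc.IH[OF si(2) sj(2)] by simp
  also have "\<dots> \<longleftrightarrow> i = j" using si(1) sj(1) by metis
  finally show ?case .
qed simp

lemma prod_digits_delta:
  assumes "i < d ^ n" "j < d ^ n"
  shows "(\<Prod>k<n. if digit d i k = digit d j k then f k else 0) = (if i = j then \<Prod>k<n. f k else (0 :: 'a :: comm_semiring_1))"
proof (cases "i = j")
  case False
  then obtain k where "k < n" "digit d i k \<noteq> digit d j k" using digits_eq_iff[OF assms] by auto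
  then show ?thesis using False by (intro trans[OF prod_zero]) auto
qed simp

section \<open>Tensor products with letter-dependent factors\<close>

definition tensor :: "nat \<Rightarrow> nat \<Rightarrow> (nat \<Rightarrow> complex mat) \<Rightarrow> complex mat" where
  "tensor n d A = mat (d ^ n) (d ^ n) (\<lambda>(i,j). \<Prod>k<n. A k $$ (digit d i k, digit d j k))"

lemma tensor_carrier[simp]: "tensor n d A \<in> carrier_mat (d ^ n) (d ^ n)"
  by (simp add: tensor_def)

lemma tensor_mult:
  assumes "\<And>k. k < n \<Longrightarrow> A k \<in> carrier_mat d d" "\<And>k. k < n \<Longrightarrow> B k \<in> carrier_mat d d"
  shows "tensor n d A * tensor n d B = tensor n d (\<lambda>k. A k * B k)"
proof (rule eq_matI)
  fix i j assume "i < dim_row (tensor n d (\<lambda>k. A k * B k))" "j < dim_col (tensor n d (\<lambda>k. A k * B k))"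
  then have ij: "i < d ^ n" "j < d ^ n" by (auto simp: tensor_def)
  have "(tensor n d A * tensor n d B) $$ (i,j) = (\<Sum>l<d ^ n. \<Prod>k<n. A k $$ (digit d i k, digit d l k) * B k $$ (digit d l k, digit d j k))"
    using ij by (subst mult_entry'[of _ "d ^ n" "d ^ n" _ "d ^ n"]) (auto simp: tensor_def prod.distrib)
  also have "\<dots> = (\<Prod>k<n. \<Sum>a<d. A k $$ (digit d i k, a) * B k $$ (a, digit d j k))"
    by (rule sum_prod_digits)
  also have "\<dots> = tensor n d (\<lambda>k. A k * B k) $$ (i,j)"
    using assms ij digit_less'[OF ij(1)] digit_less'[OF ij(2)]
    by (simp add: tensor_def mult_entry'[of _ d d _ d] del: index_mult_mat(1))
  finally show "(tensor n d A * tensor n d B) $$ (i,j) = tensor n d (\<lambda>k. A k * B k) $$ (i,j)" .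
qed (auto simp: tensor_def)

lemma tensor_adj:
  assumes "\<And>k. k < n \<Longrightarrow> A k \<in> carrier_mat d d"
  shows "adj (tensor n d A) = tensor n d (\<lambda>k. adj (A k))"
proof (rule eq_matI)
  fix i j assume "i < dim_row (tensor n d (\<lambda>k. adj (A k)))" "j < dim_col (tensor n d (\<lambda>k. adj (A k)))"
  then have ij: "i < d ^ n" "j < d ^ n" by (auto simp: tensor_def)
  have "cnj (A k $$ (digit d j k, digit d i k)) = adj (A k) $$ (digit d i k, digit d j k)" if "k < n" for k
    using digit_less'[OF ij(1) that] digit_less'[OF ij(2) that] assms[OF that] by (subst index_adj) auto
  then show "adj (tensor n d A) $$ (i,j) = tensor n d (\<lambda>k. adj (A k)) $$ (i,j)"
    using ij by (simp add: tensor_def)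
qed (auto simp: tensor_def)

lemma tensor_cong: "(\<And>k. k < n \<Longrightarrow> A k = B k) \<Longrightarrow> tensor n d A = tensor n d B"
  by (auto simp: tensor_def)

lemma tensor_mat_diag:
  "tensor n d (\<lambda>k. mat_diag d (f k)) = mat_diag (d ^ n) (\<lambda>i. \<Prod>k<n. f k (digit d i k))"
proof (rule eq_matI)
  fix i j assume "i < dim_row (mat_diag (d ^ n) (\<lambda>i. \<Prod>k<n. f k (digit d i k)))" "j < dim_col (mat_diag (d ^ n) (\<lambda>i. \<Prod>k<n. f k (digit d i k)))"
  then have ij: "i < d ^ n" "j < d ^ n" by auto
  have "tensor n d (\<lambda>k. mat_diag d (f k)) $$ (i,j) = (\<Prod>k<n. if digit d i k = digit d j k then f k (digit d j k) else 0)"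
    using ij digit_less'[OF ij(1)] digit_less'[OF ij(2)] by (auto simp: tensor_def mat_diag_def intro!: prod.cong)
  then show "tensor n d (\<lambda>k. mat_diag d (f k)) $$ (i,j) = mat_diag (d ^ n) (\<lambda>i. \<Prod>k<n. f k (digit d i k)) $$ (i,j)"
    using ij by (simp add: prod_digits_delta mat_diag_def)
qed (auto simp: tensor_def)

lemma tensor_unitary:
  assumes "\<And>k. k < n \<Longrightarrow> unitary d (U k)"
  shows "unitary (d ^ n) (tensor n d U)"
proof -
  note c = unitaryD[OF assms]
  have "adj (tensor n d U) * tensor n d U = tensor n d (\<lambda>k. adj (U k) * U k)"
    using c by (simp add: tensor_adj tensor_mult)
  also have "\<dots> = tensor n d (\<lambda>k. mat_diag d (\<lambda>_. 1))" using c by (intro tensor_cong) simp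
  also have "\<dots> = 1\<^sub>m (d ^ n)" unfolding tensor_mat_diag by simp
  finally show ?thesis by (simp add: unitary_def)
qed

section \<open>Entropies from spectral decompositions\<close>

text \<open>The roots recover the multiset, which makes the description in \<open>eigs\<close>
  unique.\<close>

lemma proots_linear_factors: "proots (prod_mset (image_mset (\<lambda>e. [:-e, 1:]) M)) = (M :: complex multiset)"
proof (induction M)
  case (add e M)
  have "prod_mset (image_mset (\<lambda>e. [:-e, 1:]) M) \<noteq> (0 :: complex poly)"
    by (auto simp: prod_mset_zero_iff)
  then have "proots ([:-e, 1:] * prod_mset (image_mset (\<lambda>e. [:-e, 1:]) M)) = proots [:-e, 1:] + M"
    using add by (subst proots_mult) auto
  then show ?case by (simp only: image_mset_add_mset prod_mset.add_mset proots_linear_factor) simp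
qed simp

lemma eigs_eqI:
  assumes "char_poly A = prod_mset (image_mset (\<lambda>e. [:-e, 1:]) M)"
  shows "eigs A = M"
  unfolding eigs_def
proof (rule the_equality[where P = "\<lambda>M. char_poly A = prod_mset (image_mset (\<lambda>e. [:-e, 1:]) M)", OF assms])
  fix N assume "char_poly A = prod_mset (image_mset (\<lambda>e. [:-e, 1:]) N)"
  then have "N = proots (char_poly A)" by (simp only: proots_linear_factors)
  then show "N = M" using assms by (simp only: proots_linear_factors)
qed

lemma vn_entropy_spectral:
  assumes U: "unitary n U" and A: "A = U * rdiag n l * adj U"
  shows "vn_entropy A = - (\<Sum>i<n. eta (l i))"
proof -
  note c = unitaryD[OF U]
  let ?D = "rdiag n l"
  have "similar_mat_wit A ?D U (adj U)"
    using c A by (intro similar_mat_witI[of _ _ n]) auto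
  then have "char_poly A = char_poly ?D" by (intro char_poly_similar) (auto simp: similar_mat_def)
  also have "\<dots> = (\<Prod>a\<leftarrow>diag_mat ?D. [:- a, 1:])"
    by (intro char_poly_upper_triangular[of _ n]) (auto simp: upper_triangular_def mat_diag_def)
  also have "diag_mat ?D = map (\<lambda>i. complex_of_real (l i)) [0..<n]"
    by (auto simp: diag_mat_def mat_diag_def)
  also have "(\<Prod>a\<leftarrow>map (\<lambda>i. complex_of_real (l i)) [0..<n]. [:- a, 1:]) =
      prod_mset (image_mset (\<lambda>e. [:-e, 1:]) (mset (map (\<lambda>i. complex_of_real (l i)) [0..<n])))"
    by (simp only: mset_map[symmetric] prod_mset_prod_list)
  finally have "eigs A = mset (map (\<lambda>i. complex_of_real (l i)) [0..<n])" by (rule eigs_eqI)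
  then have "vn_entropy A = - sum_list (map (\<lambda>i. eta (l i)) [0..<n])"
    unfolding vn_entropy_def by (simp only: mset_map[symmetric] sum_mset_sum_list map_map o_def Re_complex_of_real)
  then show ?thesis by (simp add: sum_list_upt)
qed

lemma ptrace_right_carrier[simp]: "ptrace_right a b A \<in> carrier_mat a a"
  by (simp add: ptrace_right_def)

lemma dim_ptrace_right[simp]: "dim_row (ptrace_right a b A) = a" "dim_col (ptrace_right a b A) = a"
  by (auto simp: ptrace_right_def)

lemma ptrace_right_outer_entry:
  assumes "dim_vec v = d * r" "i < d" "j < d"
  shows "marginal d r v $$ (i,j) = (\<Sum>k<r. v $ (i*r+k) * cnj (v $ (j*r+k)))"
  using assms pair_index_less[of i d _ r] pair_index_less[of j d _ r] by (simp add: ptrace_right_def outer_def)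

text \<open>Reshaping \<open>v\<close> into a \<open>d\<close> by \<open>r\<close> matrix exhibits
  its marginal as a Gram matrix.\<close>

lemma ptrace_right_outer_psd:
  assumes v: "dim_vec v = d * r"
  shows "psd (marginal d r v)"
proof -
  define G where "G = mat d r (\<lambda>(b,k). v $ (b*r+k))"
  have "marginal d r v = G * adj G"
  proof (rule eq_matI)
    fix i j assume "i < dim_row (G * adj G)" "j < dim_col (G * adj G)"
    then have ij: "i < d" "j < d" by (auto simp: G_def)
    show "marginal d r v $$ (i,j) = (G * adj G) $$ (i,j)"
      unfolding ptrace_right_outer_entry[OF v ij] using ij
      by (subst mult_entry'[of _ d r _ d]) (auto simp: G_def)
  qed (auto simp: G_def ptrace_right_def)
  then show ?thesis using psd_gram[of "adj G" r d] by (simp add: G_def)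
qed

lemma mtrace_spectral:
  assumes "unitary n U"
  shows "mtrace (U * mat_diag n f * adj U) = (\<Sum>i<n. f i)"
proof -
  note c = unitaryD[OF assms]
  have "mtrace (U * mat_diag n f * adj U) = mtrace (adj U * (U * mat_diag n f))"
    using c by (intro mtrace_comm[of _ n n]) auto
  also have "adj U * (U * mat_diag n f) = (adj U * U) * mat_diag n f" using c(1) by (simp add: mat_assoc)
  also have "\<dots> = mat_diag n f" unfolding c(3) by (simp add: one_mult_dim)
  finally show ?thesis by (simp add: mtrace_def mat_diag_def)
qed

lemma mtrace_ptrace_right_outer:
  assumes "dim_vec v = d * r"
  shows "mtrace (marginal d r v) = complex_of_real (\<Sum>i<d*r. (cmod (v $ i))\<^sup>2)"
proof -
  have "mtrace (marginal d r v) = (\<Sum>i<d. \<Sum>k<r. v $ (i*r+k) * cnj (v $ (i*r+k)))"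
    using ptrace_right_carrier[of d r "outer v v"] ptrace_right_outer_entry[OF assms] by (simp add: mtrace_def)
  also have "\<dots> = (\<Sum>i<d*r. v $ i * cnj (v $ i))" by (rule sum_lessThan_mult[symmetric])
  finally show ?thesis unfolding of_real_sum complex_norm_square .
qed

lemma omega1_XB_entry:
  assumes "\<And>x. x < m \<Longrightarrow> dim_vec (psi x) = dB * dR" and "x < m" "y < m" "b < dB" "b' < dB"
  shows "ptrace_right (m*dB) dR (omega1 m p psi dB dR) $$ (x*dB+b, y*dB+b') =
    (if x = y then complex_of_real (p x) * marginal dB dR (psi x) $$ (b,b') else 0)"
proof -
  note i = pair_index_less[OF assms(2,4)] pair_index_less[OF assms(3,5)]
  have kr: "(x*dB+b)*dR+k < m*dB*dR" "(y*dB+b')*dR+k < m*dB*dR" "b*dR+k < dB*dR" "b'*dR+k < dB*dR" if "k < dR" for k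
    using pair_index_less[OF i(1) that] pair_index_less[OF i(2) that] pair_index_less[OF assms(4) that] pair_index_less[OF assms(5) that]
    by auto
  have dm: "(t + x * N) div N = x" "(t + x * N) mod N = t" if "t < N" for t x N :: nat
    using that by auto
  have dv: "((x*dB+b)*dR+k) div (dB*dR) = x" "((x*dB+b)*dR+k) mod (dB*dR) = b*dR+k"
    if "k < dR" "b < dB" for x b k
  proof -
    have e: "(x*dB+b)*dR+k = (b*dR+k) + x*(dB*dR)" by (simp add: algebra_simps)
    have l: "b*dR+k < dB*dR" using pair_index_less[OF that(2,1)] .
    show "((x*dB+b)*dR+k) div (dB*dR) = x" "((x*dB+b)*dR+k) mod (dB*dR) = b*dR+k"
      unfolding e using dm[OF l] by blast+
  qed
  have om: "omega1 m p psi dB dR $$ ((x*dB+b)*dR+k, (y*dB+b')*dR+k) =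
     (if x = y then complex_of_real (p x) * (psi x $ (b*dR+k) * cnj (psi x $ (b'*dR+k))) else 0)" if k: "k < dR" for k
  proof -
    have "omega1 m p psi dB dR $$ ((x*dB+b)*dR+k, (y*dB+b')*dR+k) =
       (\<Sum>z<m. complex_of_real (p z) * kron (proj m z) (outer (psi z) (psi z)) $$ ((x*dB+b)*dR+k, (y*dB+b')*dR+k))"
      using kr[OF k] assms(1) by (auto simp: omega1_def msum_def outer_def mult.assoc intro!: sum.cong)
    also have "\<dots> = (\<Sum>z<m. if z = x then (if x = y then complex_of_real (p x) * (psi x $ (b*dR+k) * cnj (psi x $ (b'*dR+k))) else 0) else 0)"
    proof (rule sum.cong[OF refl])
      fix z assume "z \<in> {..<m}"
      then have d: "dim_vec (psi z) = dB * dR" using assms(1) by auto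
      show "complex_of_real (p z) * kron (proj m z) (outer (psi z) (psi z)) $$ ((x*dB+b)*dR+k, (y*dB+b')*dR+k) =
        (if z = x then (if x = y then complex_of_real (p x) * (psi x $ (b*dR+k) * cnj (psi x $ (b'*dR+k))) else 0) else 0)"
        using kr[OF k] d assms(2,3) dv[OF k assms(4)] dv[OF k assms(5)]
        by (subst index_kron) (auto simp: outer_def proj_def mult.assoc)
    qed
    finally show ?thesis using assms(2) by simp
  qed
  have "ptrace_right (m*dB) dR (omega1 m p psi dB dR) $$ (x*dB+b, y*dB+b') =
      (\<Sum>k<dR. omega1 m p psi dB dR $$ ((x*dB+b)*dR+k, (y*dB+b')*dR+k))"
    using i by (simp add: ptrace_right_def)
  also have "\<dots> = (\<Sum>k<dR. if x = y then complex_of_real (p x) * (psi x $ (b*dR+k) * cnj (psi x $ (b'*dR+k))) else 0)"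
    by (intro sum.cong refl om) auto
  finally show ?thesis using assms by (simp add: ptrace_right_outer_entry sum_distrib_left)
qed

section \<open>Typicality\<close>

lemma sum_pair_digits_Suc:
  fixes m d :: nat
  shows "(\<Sum>xi<m ^ Suc n. \<Sum>i<d ^ Suc n. G xi i) =
    (\<Sum>x<m. \<Sum>a<d. \<Sum>xi<m ^ n. \<Sum>i<d ^ n. G (x * m ^ n + xi) (a * d ^ n + i))"
  unfolding sum_digits_Suc by (rule sum.cong[OF refl], rule sum.swap)

lemma sum4_product:
  "(\<Sum>x\<in>X. \<Sum>a\<in>A. \<Sum>y\<in>Y. \<Sum>b\<in>B. f y b * g x a) = (\<Sum>y\<in>Y. \<Sum>b\<in>B. f y b) * (\<Sum>x\<in>X. \<Sum>a\<in>A. g x a :: 'a :: comm_semiring_0)"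
  by (simp add: sum_distrib_left sum_distrib_right)

context
  fixes m d :: nat and w h :: "nat \<Rightarrow> nat \<Rightarrow> real" and \<mu> :: real
  assumes w_nonneg: "\<And>x i. x < m \<Longrightarrow> i < d \<Longrightarrow> w x i \<ge> 0"
    and w_sum: "(\<Sum>x<m. \<Sum>i<d. w x i) = 1"
    and mean: "(\<Sum>x<m. \<Sum>i<d. w x i * h x i) = \<mu>"
begin

text \<open>The three claims are proved together because the cross term in the variance needs the
  vanishing mean, and both need the total weight 1.\<close>

lemma iid_moments:
  defines "W \<equiv> \<lambda>n xi i. \<Prod>k<n. w (digit m xi k) (digit d i k)"
    and "D \<equiv> \<lambda>n xi i. \<Sum>k<n. h (digit m xi k) (digit d i k) - \<mu>"
  shows "(\<Sum>xi<m ^ n. \<Sum>i<d ^ n. W n xi i) = 1"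
    "(\<Sum>xi<m ^ n. \<Sum>i<d ^ n. W n xi i * D n xi i) = 0"
    "(\<Sum>xi<m ^ n. \<Sum>i<d ^ n. W n xi i * (D n xi i)\<^sup>2) = n * (\<Sum>x<m. \<Sum>i<d. w x i * (h x i - \<mu>)\<^sup>2)"
proof (induction n)
  case 0
  { case 1 show ?case by (simp add: W_def) }
  { case 2 show ?case by (simp add: D_def) }
  { case 3 show ?case by (simp add: D_def) }
next
  case (Suc n)
  have centred: "(\<Sum>x<m. \<Sum>i<d. w x i * (h x i - \<mu>)) = 0"
    using w_sum mean by (simp add: right_diff_distrib sum_subtractf flip: sum_distrib_right)
  have WD: "W (Suc n) (x * m ^ n + xi) (a * d ^ n + i) = W n xi i * w x a"
    "D (Suc n) (x * m ^ n + xi) (a * d ^ n + i) = D n xi i + (h x a - \<mu>)"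
    if "x < m" "a < d" "xi < m ^ n" "i < d ^ n" for x a xi i
    using that by (simp_all add: W_def D_def digit_append)
  have red: "(\<Sum>xi<m ^ Suc n. \<Sum>i<d ^ Suc n. W (Suc n) xi i * \<phi> (D (Suc n) xi i)) =
     (\<Sum>x<m. \<Sum>a<d. \<Sum>xi<m ^ n. \<Sum>i<d ^ n. W n xi i * w x a * \<phi> (D n xi i + (h x a - \<mu>)))" for \<phi> :: "real \<Rightarrow> real"
    unfolding sum_pair_digits_Suc by (intro sum.cong refl) (simp add: WD)
  { case 1
    show ?case using red[of "\<lambda>_. 1"] Suc(1) w_sum by (simp add: sum4_product) }
  { case 2
    have "W n xi i * w x a * (D n xi i + (h x a - \<mu>)) = (W n xi i * D n xi i) * w x a + W n xi i * (w x a * (h x a - \<mu>))" for xi i x a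
      by (simp add: algebra_simps)
    then show ?case unfolding red[of "\<lambda>t. t"] by (simp add: sum.distrib sum4_product Suc(1,2) centred) }
  { case 3
    have "u * v * (s + t)\<^sup>2 = (u * s\<^sup>2) * v + (u * s) * (2 * (v * t)) + u * (v * t\<^sup>2)" for u v s t :: real
      by (simp add: power2_sum algebra_simps)
    then show ?case unfolding red[of "\<lambda>t. t\<^sup>2"]
      by (simp add: sum.distrib sum4_product Suc w_sum) (simp add: algebra_simps) }
qed

text \<open>Chebyshev's inequality. The deviation is demanded only where the weight is positive,
  because \<open>h\<close> will be a negative logarithm, which says nothing at probability
  0.\<close>

lemma iid_tail:
  assumes n: "n > 0" and \<delta>: "\<delta> > 0"
    and bad: "\<And>xi i. xi < m ^ n \<Longrightarrow> i < d ^ n \<Longrightarrow> Bad xi i \<Longrightarrow> (\<Prod>k<n. w (digit m xi k) (digit d i k)) > 0 \<Longrightarrow>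
       (\<Sum>k<n. h (digit m xi k) (digit d i k)) \<ge> n * (\<mu> + \<delta>)"
  shows "(\<Sum>xi<m ^ n. \<Sum>i<d ^ n. if Bad xi i then (\<Prod>k<n. w (digit m xi k) (digit d i k)) else 0)
    \<le> (\<Sum>x<m. \<Sum>i<d. w x i * (h x i - \<mu>)\<^sup>2) / (n * \<delta>\<^sup>2)"
proof -
  let ?W = "\<lambda>xi i. \<Prod>k<n. w (digit m xi k) (digit d i k)" and ?D = "\<lambda>xi i. \<Sum>k<n. h (digit m xi k) (digit d i k) - \<mu>"
  have nd: "n * \<delta> > 0" using n \<delta> by simp
  have "(\<Sum>xi<m ^ n. \<Sum>i<d ^ n. if Bad xi i then ?W xi i else 0) \<le> (\<Sum>xi<m ^ n. \<Sum>i<d ^ n. ?W xi i * (?D xi i)\<^sup>2 / (n * \<delta>)\<^sup>2)"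
  proof (intro sum_mono)
    fix xi i assume "xi \<in> {..<m ^ n}" "i \<in> {..<d ^ n}"
    then have xi: "xi < m ^ n" "i < d ^ n" by auto
    have W0: "?W xi i \<ge> 0" using digit_less'[OF xi(1)] digit_less'[OF xi(2)] by (intro prod_nonneg w_nonneg) auto
    show "(if Bad xi i then ?W xi i else 0) \<le> ?W xi i * (?D xi i)\<^sup>2 / (n * \<delta>)\<^sup>2"
    proof (cases "Bad xi i \<and> ?W xi i > 0")
      case True
      have "n * \<delta> \<le> ?D xi i" using bad[OF xi] True by (simp add: sum_subtractf algebra_simps)
      then have "(n * \<delta>)\<^sup>2 \<le> (?D xi i)\<^sup>2" using nd by (intro power_mono) auto
      then have "?W xi i * (n * \<delta>)\<^sup>2 \<le> ?W xi i * (?D xi i)\<^sup>2" using W0 by (intro mult_left_mono)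
      moreover have "(n * \<delta>)\<^sup>2 > 0" using n \<delta> by simp
      ultimately have "?W xi i \<le> ?W xi i * (?D xi i)\<^sup>2 / (n * \<delta>)\<^sup>2" by (simp only: pos_le_divide_eq)
      then show ?thesis using True by simp
    next
      case False
      then have "(if Bad xi i then ?W xi i else 0) = 0" using W0 by auto
      then show ?thesis using W0 by simp
    qed
  qed
  also have "\<dots> = n * (\<Sum>x<m. \<Sum>i<d. w x i * (h x i - \<mu>)\<^sup>2) / (n * \<delta>)\<^sup>2"
    unfolding sum_divide_distrib[symmetric] iid_moments(3) ..
  also have "\<dots> = (\<Sum>x<m. \<Sum>i<d. w x i * (h x i - \<mu>)\<^sup>2) / (n * \<delta>\<^sup>2)"
    using n by (simp add: power2_eq_square)
  finally show ?thesis .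
qed

end

text \<open>Summed over all \<open>i\<close>, the weights \<open>\<pi> x i\<close> average to the
  mass of \<open>q\<close> on \<open>T\<close>, again by \<open>avg\<close>. Restricting to
  \<open>J x\<close> loses at most the mass outside it, as \<open>\<pi> x i\<close> is at most
  1.\<close>

lemma (in random_code) typical_mass:
  "(\<Sum>x<M. \<Sum>i\<in>J x. P x * lam x i * \<pi> x i) \<ge>
    1 - (\<Sum>b<d. if b \<notin> T then q b else 0) - (\<Sum>x<M. \<Sum>i<d. if i \<notin> J x then P x * lam x i else 0)"
proof -
  have qb: "(\<Sum>x<M. \<Sum>i<d. P x * lam x i * (cmod (F x $$ (b,i)))\<^sup>2) = q b" if b: "b < d" for b
  proof -
    have "complex_of_real (\<Sum>x<M. \<Sum>i<d. P x * lam x i * (cmod (F x $$ (b,i)))\<^sup>2) = complex_of_real (q b)"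
      using avg[OF b b] unfolding F_def of_real_sum of_real_mult complex_norm_square by (simp add: mult.assoc)
    then show ?thesis by (simp only: of_real_eq_iff)
  qed
  have "1 - (\<Sum>b<d. if b \<notin> T then q b else 0) = (\<Sum>b<d. if b \<in> T then q b else 0)"
    unfolding q_sum[symmetric] sum_subtractf[symmetric] by (intro sum.cong) auto
  also have "\<dots> = (\<Sum>b\<in>T. q b)"
  proof -
    have "{..<d} \<inter> T = T" using T by auto
    then show ?thesis using sum.inter_restrict[of "{..<d}" q T] by simp
  qed
  also have "\<dots> = (\<Sum>b\<in>T. \<Sum>x<M. \<Sum>i<d. P x * lam x i * (cmod (F x $$ (b,i)))\<^sup>2)"
    using T qb by (intro sum.cong) auto
  also have "\<dots> = (\<Sum>x<M. \<Sum>i<d. P x * lam x i * \<pi> x i)"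
    unfolding \<pi>_def sum_distrib_left by (subst sum.swap, rule sum.cong[OF refl], rule sum.swap)
  also have "\<dots> \<le> (\<Sum>x<M. (\<Sum>i\<in>J x. P x * lam x i * \<pi> x i) + (\<Sum>i<d. if i \<notin> J x then P x * lam x i else 0))"
  proof (rule sum_mono)
    fix x assume "x \<in> {..<M}" then have x: "x < M" by simp
    have "(\<Sum>i<d. P x * lam x i * \<pi> x i) \<le> (\<Sum>i<d. (if i \<in> J x then P x * lam x i * \<pi> x i else 0) + (if i \<notin> J x then P x * lam x i else 0))"
    proof (rule sum_mono)
      fix i assume "i \<in> {..<d}" then have i: "i < d" by simp
      have "P x * lam x i * \<pi> x i \<le> P x * lam x i * 1"
        using P_nonneg[OF x] lam_nonneg[OF x i] \<pi>_le_1[OF x i] by (intro mult_left_mono) auto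
      then show "P x * lam x i * \<pi> x i \<le> (if i \<in> J x then P x * lam x i * \<pi> x i else 0) + (if i \<notin> J x then P x * lam x i else 0)"
        by auto
    qed
    also have "\<dots> = (\<Sum>i\<in>J x. P x * lam x i * \<pi> x i) + (\<Sum>i<d. if i \<notin> J x then P x * lam x i else 0)"
    proof -
      have "{..<d} \<inter> J x = J x" using J[OF x] by auto
      then show ?thesis using sum.inter_restrict[of "{..<d}" "\<lambda>i. P x * lam x i * \<pi> x i" "J x"] by (simp add: sum.distrib)
    qed
    finally show "(\<Sum>i<d. P x * lam x i * \<pi> x i) \<le> (\<Sum>i\<in>J x. P x * lam x i * \<pi> x i) + (\<Sum>i<d. if i \<notin> J x then P x * lam x i else 0)" .
  qed
  finally show ?thesis by (simp add: sum.distrib)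
qed

section \<open>The single-letter source and its entropies\<close>

locale source =
  fixes m dB dR :: nat and p :: "nat \<Rightarrow> real" and psi :: "nat \<Rightarrow> complex vec"
    and U :: "nat \<Rightarrow> complex mat" and l :: "nat \<Rightarrow> nat \<Rightarrow> real" and \<beta> :: "complex mat" and q :: "nat \<Rightarrow> real"
  assumes p_nonneg: "\<And>x. x < m \<Longrightarrow> p x \<ge> 0" and p_sum: "(\<Sum>x<m. p x) = 1"
    and psi_dim: "\<And>x. x < m \<Longrightarrow> dim_vec (psi x) = dB * dR"
    and psi_unit: "\<And>x. x < m \<Longrightarrow> (\<Sum>i<dB * dR. (cmod (psi x $ i))\<^sup>2) = 1"
    and U: "\<And>x. x < m \<Longrightarrow> unitary dB (U x)"
    and l_nonneg: "\<And>x i. l x i \<ge> 0"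
    and \<rho>: "\<And>x. x < m \<Longrightarrow> marginal dB dR (psi x) = U x * rdiag dB (l x) * adj (U x)"
    and \<beta>: "unitary dB \<beta>"
    and \<rho>_avg: "mat dB dB (\<lambda>ij. \<Sum>x<m. complex_of_real (p x) * marginal dB dR (psi x) $$ ij) =
       \<beta> * rdiag dB q * adj \<beta>"
begin

lemma l_sum: assumes "x < m" shows "(\<Sum>i<dB. l x i) = 1"
proof -
  have "complex_of_real (\<Sum>i<dB. l x i) = complex_of_real 1"
    using mtrace_ptrace_right_outer[OF psi_dim[OF assms]] mtrace_spectral[OF U[OF assms], of "\<lambda>i. complex_of_real (l x i)"]
    unfolding \<rho>[OF assms] psi_unit[OF assms] by simp
  then show ?thesis by (simp only: of_real_eq_iff)
qed

definition f :: "nat \<Rightarrow> complex mat" where "f x = adj \<beta> * U x"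

lemma f: assumes "x < m" shows "unitary dB (f x)"
  unfolding f_def using unitary_mult[OF unitary_adj[OF \<beta>] U[OF assms]] .

text \<open>The average state in the basis \<open>\<beta>\<close>, computed once through the
  spectral form of each letter and once through its own.\<close>

lemma avg_entry:
  assumes b: "b < dB" "b' < dB"
  shows "(\<Sum>x<m. \<Sum>i<dB. p x * l x i * f x $$ (b,i) * cnj (f x $$ (b',i))) = (if b = b' then complex_of_real (q b) else 0)"
proof -
  note Bc = unitaryD[OF \<beta>]
  let ?\<rho> = "\<lambda>x. marginal dB dR (psi x)"
  define \<sigma> where "\<sigma> = mat dB dB (\<lambda>ij. \<Sum>x<m. complex_of_real (p x) * ?\<rho> x $$ ij)"
  have \<sigma>: "\<sigma> \<in> carrier_mat dB dB" by (simp add: \<sigma>_def)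
  have "(\<Sum>x<m. \<Sum>i<dB. p x * l x i * f x $$ (b,i) * cnj (f x $$ (b',i))) = (\<Sum>x<m. complex_of_real (p x) * (adj \<beta> * ?\<rho> x * \<beta>) $$ (b,b'))"
  proof (rule sum.cong[OF refl])
    fix x assume "x \<in> {..<m}" then have x: "x < m" by simp
    have "adj \<beta> * ?\<rho> x * \<beta> = f x * rdiag dB (l x) * adj (f x)"
      unfolding \<rho>[OF x] f_def using Bc(1) unitaryD(1)[OF U[OF x]] by (simp add: mat_assoc adj_mult_dim)
    then show "(\<Sum>i<dB. p x * l x i * f x $$ (b,i) * cnj (f x $$ (b',i))) = complex_of_real (p x) * (adj \<beta> * ?\<rho> x * \<beta>) $$ (b,b')"
      using b by (simp only: spectral_entry[OF f[OF x]] sum_distrib_left) (simp add: mult_ac)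
  qed
  also have "\<dots> = (\<Sum>x<m. \<Sum>r<dB. \<Sum>s<dB. cnj (\<beta> $$ (r,b)) * (complex_of_real (p x) * ?\<rho> x $$ (r,s)) * \<beta> $$ (s,b'))"
    using b by (simp only: sandwich_entry[OF ptrace_right_carrier Bc(1) Bc(1)] sum_distrib_left) (simp add: mult_ac)
  also have "\<dots> = (\<Sum>r<dB. \<Sum>s<dB. \<Sum>x<m. cnj (\<beta> $$ (r,b)) * (complex_of_real (p x) * ?\<rho> x $$ (r,s)) * \<beta> $$ (s,b'))"
    by (subst sum.swap, rule sum.cong[OF refl], rule sum.swap)
  also have "\<dots> = (\<Sum>r<dB. \<Sum>s<dB. cnj (\<beta> $$ (r,b)) * \<sigma> $$ (r,s) * \<beta> $$ (s,b'))"
    by (intro sum.cong refl) (simp add: \<sigma>_def sum_distrib_left sum_distrib_right)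
  also have "\<dots> = (adj \<beta> * \<sigma> * \<beta>) $$ (b,b')"
    using sandwich_entry[OF \<sigma> Bc(1) Bc(1) b] by simp
  also have "adj \<beta> * \<sigma> * \<beta> = (adj \<beta> * \<beta>) * (rdiag dB q * (adj \<beta> * \<beta>))"
    unfolding \<sigma>_def \<rho>_avg using Bc(1) by (simp add: mat_assoc)
  also have "\<dots> = rdiag dB q" unfolding Bc(3) by (simp add: one_mult_dim)
  finally show ?thesis using b by (simp add: mat_diag_def)
qed

lemma avg_diag:
  assumes b: "b < dB" shows "(\<Sum>x<m. \<Sum>i<dB. p x * l x i * (cmod (f x $$ (b,i)))\<^sup>2) = q b"
proof -
  have "complex_of_real (\<Sum>x<m. \<Sum>i<dB. p x * l x i * (cmod (f x $$ (b,i)))\<^sup>2) = complex_of_real (q b)"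
    using avg_entry[OF b b] unfolding of_real_sum of_real_mult complex_norm_square by (simp add: mult.assoc)
  then show ?thesis by (simp only: of_real_eq_iff)
qed

lemma q_nonneg: "b < dB \<Longrightarrow> q b \<ge> 0"
  using avg_diag[of b] p_nonneg l_nonneg by (auto intro!: sum_nonneg mult_nonneg_nonneg simp flip: avg_diag)

lemma weights_sum: "(\<Sum>x<m. \<Sum>i<dB. p x * l x i) = 1"
  using l_sum p_sum by (simp flip: sum_distrib_left)

text \<open>With \<open>f_row\<close>: the squared moduli of the overlaps are doubly stochastic, as
  the Gibbs argument below requires.\<close>

lemma f_col: assumes "x < m" "i < dB" shows "(\<Sum>b<dB. (cmod (f x $$ (b,i)))\<^sup>2) = 1"
  using gram_diag[OF unitaryD(1)[OF f[OF assms(1)]] assms(2)] assms unfolding unitaryD(3)[OF f[OF assms(1)]]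
  by (simp del: of_real_sum)

lemma f_row: assumes "x < m" "b < dB" shows "(\<Sum>i<dB. (cmod (f x $$ (b,i)))\<^sup>2) = 1"
proof -
  have c: "adj (f x) \<in> carrier_mat dB dB" using unitaryD(2)[OF f[OF assms(1)]] .
  have "(\<Sum>i<dB. (cmod (adj (f x) $$ (i,b)))\<^sup>2) = 1"
    using gram_diag[OF c assms(2)] assms unitaryD(4)[OF f[OF assms(1)]]
    by (simp del: of_real_sum)
  then show ?thesis using unitaryD(1)[OF f[OF assms(1)]] assms(2) by simp
qed

lemma q_sum: "(\<Sum>b<dB. q b) = 1"
proof -
  have "(\<Sum>b<dB. q b) = (\<Sum>b<dB. \<Sum>x<m. \<Sum>i<dB. p x * l x i * (cmod (f x $$ (b,i)))\<^sup>2)"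
    by (simp add: avg_diag)
  also have "\<dots> = (\<Sum>x<m. \<Sum>i<dB. \<Sum>b<dB. p x * l x i * (cmod (f x $$ (b,i)))\<^sup>2)"
    by (subst sum.swap, rule sum.cong[OF refl], rule sum.swap)
  also have "\<dots> = 1" unfolding sum_distrib_left[symmetric] using weights_sum by (simp add: f_col)
  finally show ?thesis .
qed

definition SB :: real where "SB = - (\<Sum>b<dB. q b * log 2 (q b))"
definition SBX :: real where "SBX = - (\<Sum>x<m. \<Sum>i<dB. p x * l x i * log 2 (l x i))"

lemma SBX_nonneg: "SBX \<ge> 0"
proof -
  have "p x * l x i * log 2 (l x i) \<le> 0" if x: "x < m" and i: "i < dB" for x i
  proof -
    have "l x i \<le> (\<Sum>i<dB. l x i)" using i l_nonneg by (intro member_le_sum) auto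
    then have "l x i \<le> 1" using l_sum[OF x] by simp
    then have "log 2 (l x i) \<le> 0" by (cases "l x i = 0") (use l_nonneg[of x i] in \<open>auto simp: log_def intro!: divide_nonpos_nonneg\<close>)
    then show ?thesis using p_nonneg[OF x] l_nonneg[of x i] by (intro mult_nonneg_nonpos) auto
  qed
  then have "(\<Sum>x<m. \<Sum>i<dB. p x * l x i * log 2 (l x i)) \<le> 0" by (intro sum_nonpos) auto
  then show ?thesis by (simp add: SBX_def)
qed

text \<open>Gibbs' inequality for the joint weights of the eigenbases of the \<open>\<rho>\<^sub>x\<close> and of their average.\<close>
lemma SBX_le_SB: "SBX \<le> SB"
proof -
  let ?a = "\<lambda>x i b. (cmod (f x $$ (b,i)))\<^sup>2"
  have ge: "p x * l x i * ?a x i b - p x * q b * ?a x i b \<le> p x * l x i * ?a x i b * (ln (l x i) - ln (q b))"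
    if x: "x < m" and i: "i < dB" and b: "b < dB" for x i b
  proof (cases "p x * l x i * ?a x i b = 0")
    case True
    have "p x * q b * ?a x i b \<ge> 0" using p_nonneg[OF x] q_nonneg[OF b] by simp
    then show ?thesis unfolding True by simp
  next
    case False
    define t where "t = p x * l x i * ?a x i b"
    have t: "t > 0" using False p_nonneg[OF x] l_nonneg[of x i] by (simp add: t_def less_le)
    have lp: "l x i > 0" using False l_nonneg[of x i] by (auto simp: less_le)
    \<comment> \<open>\<open>t\<close> is one of the nonnegative terms that add up to
      \<open>q b\<close>, so \<open>q b\<close> is positive and its logarithm is meaningful.\<close>
    have "t \<le> (\<Sum>i<dB. p x * l x i * ?a x i b)"
      unfolding t_def using i p_nonneg[OF x] l_nonneg by (intro member_le_sum[where f = "\<lambda>i. p x * l x i * ?a x i b"]) auto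
    also have "\<dots> \<le> (\<Sum>x<m. \<Sum>i<dB. p x * l x i * ?a x i b)"
      using x p_nonneg l_nonneg by (intro member_le_sum[where f = "\<lambda>x. \<Sum>i<dB. p x * l x i * ?a x i b"] sum_nonneg) auto
    also have "\<dots> = q b" by (rule avg_diag[OF b])
    finally have qp: "q b > 0" using t by simp
    have "ln (q b / l x i) \<le> q b / l x i - 1" using qp lp by (intro ln_le_minus_one) simp
    then have "1 - q b / l x i \<le> ln (l x i) - ln (q b)" using qp lp by (simp add: ln_div)
    then have "t * (1 - q b / l x i) \<le> t * (ln (l x i) - ln (q b))" using t by (intro mult_left_mono) auto
    moreover have "t * (1 - q b / l x i) = p x * l x i * ?a x i b - p x * q b * ?a x i b"
      using lp by (simp add: t_def field_simps)
    ultimately show ?thesis by (simp add: t_def)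
  qed
  have s1: "(\<Sum>x<m. \<Sum>i<dB. \<Sum>b<dB. p x * l x i * ?a x i b) = 1"
    unfolding sum_distrib_left[symmetric] using weights_sum by (simp add: f_col)
  have s2: "(\<Sum>x<m. \<Sum>i<dB. \<Sum>b<dB. p x * q b * ?a x i b) = 1"
  proof -
    have "(\<Sum>x<m. \<Sum>i<dB. \<Sum>b<dB. p x * q b * ?a x i b) = (\<Sum>x<m. \<Sum>b<dB. \<Sum>i<dB. p x * q b * ?a x i b)"
      by (intro sum.cong refl sum.swap)
    also have "\<dots> = (\<Sum>x<m. \<Sum>b<dB. p x * q b)"
    proof (intro sum.cong refl)
      fix x b assume "x \<in> {..<m}" "b \<in> {..<dB}"
      then show "(\<Sum>i<dB. p x * q b * ?a x i b) = p x * q b"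
        using f_row[of x b] unfolding sum_distrib_left[symmetric] by simp
    qed
    also have "\<dots> = 1" using p_sum q_sum by (simp flip: sum_distrib_left)
    finally show ?thesis .
  qed
  have s3: "(\<Sum>x<m. \<Sum>i<dB. \<Sum>b<dB. p x * l x i * ?a x i b * ln (l x i)) = (\<Sum>x<m. \<Sum>i<dB. p x * l x i * ln (l x i))"
  proof (intro sum.cong refl)
    fix x i assume "x \<in> {..<m}" "i \<in> {..<dB}"
    then show "(\<Sum>b<dB. p x * l x i * ?a x i b * ln (l x i)) = p x * l x i * ln (l x i)"
      using f_col[of x i] unfolding sum_distrib_right[symmetric] sum_distrib_left[symmetric] by simp
  qed
  have s4: "(\<Sum>x<m. \<Sum>i<dB. \<Sum>b<dB. p x * l x i * ?a x i b * ln (q b)) = (\<Sum>b<dB. q b * ln (q b))"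
  proof -
    have "(\<Sum>x<m. \<Sum>i<dB. \<Sum>b<dB. p x * l x i * ?a x i b * ln (q b)) = (\<Sum>x<m. \<Sum>b<dB. \<Sum>i<dB. p x * l x i * ?a x i b * ln (q b))"
      by (intro sum.cong refl sum.swap)
    also have "\<dots> = (\<Sum>b<dB. \<Sum>x<m. \<Sum>i<dB. p x * l x i * ?a x i b * ln (q b))" by (rule sum.swap)
    finally show ?thesis unfolding sum_distrib_right[symmetric] by (simp add: avg_diag)
  qed
  have "0 = (\<Sum>x<m. \<Sum>i<dB. \<Sum>b<dB. p x * l x i * ?a x i b - p x * q b * ?a x i b)"
    unfolding sum_subtractf s1 s2 by simp
  also have "\<dots> \<le> (\<Sum>x<m. \<Sum>i<dB. \<Sum>b<dB. p x * l x i * ?a x i b * (ln (l x i) - ln (q b)))"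
    using ge by (intro sum_mono) auto
  also have "\<dots> = (\<Sum>x<m. \<Sum>i<dB. p x * l x i * ln (l x i)) - (\<Sum>b<dB. q b * ln (q b))"
    unfolding right_diff_distrib sum_subtractf s3 s4 ..
  finally have "(\<Sum>b<dB. q b * ln (q b)) / ln 2 \<le> (\<Sum>x<m. \<Sum>i<dB. p x * l x i * ln (l x i)) / ln 2"
    by (intro divide_right_mono) auto
  then show ?thesis by (simp add: SB_def SBX_def log_def sum_divide_distrib)
qed

end

section \<open>Block codes for the source\<close>

text \<open>Translates a small product of probabilities into the large sum that
  \<open>iid_tail\<close> asks for. Positivity of the product makes every factor positive, so the
  logarithm splits.\<close>

lemma neg_log_prod_ge:
  fixes a :: "nat \<Rightarrow> real"
  assumes "\<And>k. k < n \<Longrightarrow> a k \<ge> 0" and pos: "(\<Prod>k<n. a k) > 0" and small: "(\<Prod>k<n. a k) < 2 powr (- t)"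
  shows "(\<Sum>k<n. - log 2 (a k)) \<ge> t"
proof -
  have ak: "a k > 0" if "k < n" for k
  proof -
    have "a k \<noteq> 0" using pos that by (metis finite_lessThan lessThan_iff less_irrefl prod_zero)
    then show ?thesis using assms(1)[OF that] by simp
  qed
  have "ln (\<Prod>k<n. a k) = (\<Sum>k<n. ln (a k))" by (rule ln_prod) (auto dest!: ak)
  then have "log 2 (\<Prod>k<n. a k) = (\<Sum>k<n. log 2 (a k))" by (simp add: log_def sum_divide_distrib)
  moreover have "log 2 (\<Prod>k<n. a k) < - t" using pos small by (simp add: log_less_iff)
  ultimately show ?thesis by (simp add: sum_negf)
qed

text \<open>Weights bounded below by 2^(-t) with total at most 1 cannot be more than 2^t in
  number.\<close>

lemma card_typical_le:
  assumes "finite A" "(\<Sum>i\<in>A. w i) \<le> 1" "\<And>i. i \<in> B \<Longrightarrow> w i \<ge> 2 powr (- t)" "B \<subseteq> A" "\<And>i. i \<in> A \<Longrightarrow> w i \<ge> 0"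
  shows "real (card B) \<le> 2 powr t"
proof -
  have "real (card B) * 2 powr (- t) = (\<Sum>i\<in>B. 2 powr (- t))" by simp
  also have "\<dots> \<le> (\<Sum>i\<in>B. w i)" using assms by (intro sum_mono) auto
  also have "\<dots> \<le> (\<Sum>i\<in>A. w i)" using assms by (intro sum_mono2) auto
  also have "\<dots> \<le> 1" by (rule assms(2))
  finally show ?thesis by (simp add: powr_minus field_simps)
qed

lemma omega_ext_ensemble_state:
  "omega_ext m p psi dB dR n = ensemble_state (m^n) (p_n m p n) (psi_n m psi dB dR n) (dB^n) (dR^n)"
  by (simp add: omega_ext_def ensemble_state_def)

context source
begin

definition U_n :: "nat \<Rightarrow> nat \<Rightarrow> complex mat" where "U_n n xi = tensor n dB (\<lambda>k. U (digit m xi k))"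
definition l_n :: "nat \<Rightarrow> nat \<Rightarrow> nat \<Rightarrow> real" where "l_n n xi i = (\<Prod>k<n. l (digit m xi k) (digit dB i k))"
definition q_n :: "nat \<Rightarrow> nat \<Rightarrow> real" where "q_n n b = (\<Prod>k<n. q (digit dB b k))"

lemma marginal_n:
  assumes xi: "xi < m ^ n"
  shows "marginal (dB^n) (dR^n) (psi_n m psi dB dR n xi) =
    tensor n dB (\<lambda>k. marginal dB dR (psi (digit m xi k)))"
proof (rule eq_matI)
  fix i j assume "i < dim_row (tensor n dB (\<lambda>k. marginal dB dR (psi (digit m xi k))))"
     "j < dim_col (tensor n dB (\<lambda>k. marginal dB dR (psi (digit m xi k))))"
  then have ij: "i < dB ^ n" "j < dB ^ n" by (auto simp: tensor_def)
  let ?v = "psi_n m psi dB dR n xi"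
  have dv: "dim_vec ?v = dB^n * dR^n" by (simp add: psi_n_def)
  have ent: "?v $ (i * dR^n + k) = (\<Prod>t<n. psi (digit m xi t) $ (digit dB i t * dR + digit dR k t))"
    if "i < dB^n" "k < dR^n" for i k
  proof -
    have "(x * N + t) div N = x" "(x * N + t) mod N = t" if "t < N" for x N t :: nat
      using that by auto
    note dm = this[OF that(2), of i]
    show ?thesis using pair_index_less[OF that] by (simp only: psi_n_def index_vec dm)
  qed
  have "marginal (dB^n) (dR^n) ?v $$ (i,j) =
     (\<Sum>k<dR^n. \<Prod>t<n. psi (digit m xi t) $ (digit dB i t * dR + digit dR k t) * cnj (psi (digit m xi t) $ (digit dB j t * dR + digit dR k t)))"
    unfolding ptrace_right_outer_entry[OF dv ij] using ij by (intro sum.cong refl) (simp add: ent prod.distrib)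
  also have "\<dots> = (\<Prod>t<n. \<Sum>a<dR. psi (digit m xi t) $ (digit dB i t * dR + a) * cnj (psi (digit m xi t) $ (digit dB j t * dR + a)))"
    by (rule sum_prod_digits)
  also have "\<dots> = tensor n dB (\<lambda>k. marginal dB dR (psi (digit m xi k))) $$ (i,j)"
    using ij digit_less'[OF ij(1)] digit_less'[OF ij(2)] digit_less'[OF xi]
    by (auto simp: tensor_def ptrace_right_outer_entry psi_dim intro!: prod.cong)
  finally show "marginal (dB^n) (dR^n) ?v $$ (i,j) =
     tensor n dB (\<lambda>k. marginal dB dR (psi (digit m xi k))) $$ (i,j)" .
qed (auto simp: tensor_def)

lemma U_n: assumes "xi < m ^ n" shows "unitary (dB ^ n) (U_n n xi)"
  unfolding U_n_def using digit_less'[OF assms] by (intro tensor_unitary U)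

lemma marginal_n_spectral:
  assumes xi: "xi < m ^ n"
  shows "marginal (dB^n) (dR^n) (psi_n m psi dB dR n xi) =
    U_n n xi * rdiag (dB^n) (l_n n xi) * adj (U_n n xi)"
proof -
  note c = unitaryD[OF U[OF digit_less'[OF xi]]]
  have "U_n n xi * rdiag (dB^n) (l_n n xi) * adj (U_n n xi) =
     tensor n dB (\<lambda>k. U (digit m xi k)) * tensor n dB (\<lambda>k. rdiag dB (l (digit m xi k))) * tensor n dB (\<lambda>k. adj (U (digit m xi k)))"
    unfolding U_n_def tensor_mat_diag l_n_def using c by (simp add: tensor_adj)
  also have "\<dots> = tensor n dB (\<lambda>k. U (digit m xi k) * rdiag dB (l (digit m xi k)) * adj (U (digit m xi k)))"
    using c by (subst tensor_mult, (auto)[2], subst tensor_mult) (auto intro!: mult_carrier_mat[of _ dB dB _ dB])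
  also have "\<dots> = tensor n dB (\<lambda>k. marginal dB dR (psi (digit m xi k)))"
    using \<rho>[OF digit_less'[OF xi]] by (intro tensor_cong) simp
  finally show ?thesis unfolding marginal_n[OF xi] by simp
qed

lemma l_n_nonneg: "l_n n xi i \<ge> 0" unfolding l_n_def by (intro prod_nonneg) (auto simp: l_nonneg)

lemma l_n_sum: assumes "xi < m ^ n" shows "(\<Sum>i<dB^n. l_n n xi i) = 1"
  unfolding l_n_def sum_prod_digits[of "\<lambda>k a. l (digit m xi k) a"] using l_sum[OF digit_less'[OF assms]] by simp

lemma q_n_nonneg: assumes "b < dB ^ n" shows "q_n n b \<ge> 0"
  unfolding q_n_def using digit_less'[OF assms] q_nonneg by (intro prod_nonneg) auto

lemma q_n_sum: "(\<Sum>b<dB^n. q_n n b) = 1"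
  unfolding q_n_def sum_prod_digits[of "\<lambda>k. q"] by (simp add: q_sum)

lemma p_n_nonneg: assumes "xi < m ^ n" shows "p_n m p n xi \<ge> 0"
  unfolding p_n_def using digit_less'[OF assms] p_nonneg by (intro prod_nonneg) auto

lemma p_n_sum: "(\<Sum>xi<m^n. p_n m p n xi) = 1"
  unfolding p_n_def sum_prod_digits[of "\<lambda>k. p"] by (simp add: p_sum)

text \<open>Both sums run over strings and factor into single-letter averages; the product of the
  letterwise deltas is the delta of the strings.\<close>

lemma avg_entry_n:
  assumes b: "b < dB ^ n" "b' < dB ^ n"
  defines "G \<equiv> \<lambda>xi. adj (tensor n dB (\<lambda>_. \<beta>)) * U_n n xi"
  shows "(\<Sum>xi<m^n. \<Sum>i<dB^n. p_n m p n xi * l_n n xi i * G xi $$ (b,i) * cnj (G xi $$ (b',i))) =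
    (if b = b' then complex_of_real (q_n n b) else 0)"
proof -
  let ?d = "digit dB" and ?x = "digit m"
  have G: "G xi = tensor n dB (\<lambda>k. f (?x xi k))" if xi: "xi < m ^ n" for xi
    using unitaryD[OF \<beta>] unitaryD[OF U[OF digit_less'[OF xi]]]
    unfolding G_def U_n_def f_def by (simp add: tensor_adj tensor_mult)
  have "(\<Sum>xi<m^n. \<Sum>i<dB^n. p_n m p n xi * l_n n xi i * G xi $$ (b,i) * cnj (G xi $$ (b',i))) =
    (\<Sum>xi<m^n. \<Sum>i<dB^n. \<Prod>k<n. p (?x xi k) * l (?x xi k) (?d i k) * f (?x xi k) $$ (?d b k, ?d i k) * cnj (f (?x xi k) $$ (?d b' k, ?d i k)))"
    using b by (intro sum.cong refl) (simp add: G tensor_def p_n_def l_n_def prod.distrib)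
  also have "\<dots> = (\<Sum>xi<m^n. \<Prod>k<n. \<Sum>a<dB. p (?x xi k) * l (?x xi k) a * f (?x xi k) $$ (?d b k, a) * cnj (f (?x xi k) $$ (?d b' k, a)))"
    by (intro sum.cong refl sum_prod_digits)
  also have "\<dots> = (\<Prod>k<n. \<Sum>x<m. \<Sum>a<dB. p x * l x a * f x $$ (?d b k, a) * cnj (f x $$ (?d b' k, a)))"
    by (rule sum_prod_digits)
  also have "\<dots> = (\<Prod>k<n. if ?d b k = ?d b' k then complex_of_real (q (?d b k)) else 0)"
    using avg_entry digit_less'[OF b(1)] digit_less'[OF b(2)] by (intro prod.cong) auto
  also have "\<dots> = (if b = b' then complex_of_real (q_n n b) else 0)"
    unfolding prod_digits_delta[OF b] by (simp add: q_n_def)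
  finally show ?thesis .
qed

section \<open>Typical sets and block codes\<close>

text \<open>Typicality is one-sided here: a lower bound on the weights already limits the
  cardinality.\<close>

definition Tn :: "nat \<Rightarrow> real \<Rightarrow> nat set" where
  "Tn n \<delta> = {b. b < dB ^ n \<and> q_n n b \<ge> 2 powr (- (n * (SB + \<delta>)))}"
text \<open>The threshold concerns the conditional weight, so the cardinality bound holds for every
  string \<open>xi\<close>; an untypical \<open>xi\<close> merely has too little weight in its
  set.\<close>

definition Jn :: "nat \<Rightarrow> real \<Rightarrow> nat \<Rightarrow> nat set" where
  "Jn n \<delta> xi = {i. i < dB ^ n \<and> l_n n xi i \<ge> 2 powr (- (n * (SBX + \<delta>)))}"

definition VB :: real where "VB = (\<Sum>b<dB. q b * (- log 2 (q b) - SB)\<^sup>2)"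
definition VBX :: real where "VBX = (\<Sum>x<m. \<Sum>i<dB. p x * l x i * (- log 2 (l x i) - SBX)\<^sup>2)"

lemma Tn_tail:
  assumes "n > 0" "\<delta> > 0"
  shows "(\<Sum>b<dB^n. if b \<notin> Tn n \<delta> then q_n n b else 0) \<le> VB / (n * \<delta>\<^sup>2)"
proof -
  have "(\<Sum>xi<(1::nat) ^ n. \<Sum>b<dB ^ n. if b \<notin> Tn n \<delta> then \<Prod>k<n. q (digit dB b k) else 0) \<le>
     (\<Sum>x<1::nat. \<Sum>b<dB. q b * (- log 2 (q b) - SB)\<^sup>2) / (n * \<delta>\<^sup>2)"
  \<comment> \<open>A one-letter alphabet for \<open>x\<close> reduces the statement about pairs of
    strings to single strings.\<close>
  proof (rule iid_tail[OF _ _ _ assms, where w = "\<lambda>_. q" and h = "\<lambda>_ b. - log 2 (q b)" and m = 1 and d = dB and Bad = "\<lambda>_ b. b \<notin> Tn n \<delta>"])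
    fix b assume b: "b < dB ^ n" "b \<notin> Tn n \<delta>" "0 < (\<Prod>k<n. q (digit dB b k))"
    then show "n * (SB + \<delta>) \<le> (\<Sum>k<n. - log 2 (q (digit dB b k)))"
      using digit_less'[OF b(1)] q_nonneg by (intro neg_log_prod_ge) (auto simp: Tn_def q_n_def)
  qed (use q_nonneg q_sum in \<open>auto simp: SB_def sum_negf\<close>)
  then show ?thesis unfolding VB_def q_n_def by simp
qed

lemma Jn_tail:
  assumes "n > 0" "\<delta> > 0"
  shows "(\<Sum>xi<m^n. \<Sum>i<dB^n. if i \<notin> Jn n \<delta> xi then p_n m p n xi * l_n n xi i else 0) \<le> VBX / (n * \<delta>\<^sup>2)"
proof -
  have "(\<Sum>xi<m ^ n. \<Sum>i<dB ^ n. if i \<notin> Jn n \<delta> xi then \<Prod>k<n. p (digit m xi k) * l (digit m xi k) (digit dB i k) else 0) \<le>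
     (\<Sum>x<m. \<Sum>i<dB. p x * l x i * (- log 2 (l x i) - SBX)\<^sup>2) / (n * \<delta>\<^sup>2)"
  proof (rule iid_tail[OF _ _ _ assms, where w = "\<lambda>x i. p x * l x i" and h = "\<lambda>x i. - log 2 (l x i)" and m = m and d = dB and Bad = "\<lambda>xi i. i \<notin> Jn n \<delta> xi"])
    fix xi i assume xi: "xi < m ^ n" "i < dB ^ n" and J: "i \<notin> Jn n \<delta> xi" and pos: "0 < (\<Prod>k<n. p (digit m xi k) * l (digit m xi k) (digit dB i k))"
    have "p_n m p n xi * l_n n xi i > 0" using pos by (simp add: p_n_def l_n_def prod.distrib)
    then have "l_n n xi i > 0" using p_n_nonneg[OF xi(1)] by (simp add: zero_less_mult_iff)
    then show "n * (SBX + \<delta>) \<le> (\<Sum>k<n. - log 2 (l (digit m xi k) (digit dB i k)))"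
      using J xi l_nonneg by (intro neg_log_prod_ge) (auto simp: Jn_def l_n_def)
  qed (use p_nonneg l_nonneg weights_sum in \<open>auto simp: SBX_def sum_negf\<close>)
  then show ?thesis unfolding VBX_def p_n_def l_n_def prod.distrib .
qed

text \<open>Of the slack \<open>2 * \<delta>\<close>, one \<open>\<delta>\<close> pays for the size
  of the typical sets and the other leaves a factor 2^(-n \<delta>) in both conditions of the random
  code.\<close>

definition code_dim :: "nat \<Rightarrow> real \<Rightarrow> nat" where
  "code_dim n \<delta> = nat \<lceil>2 powr (n * ((SB + SBX) / 2 + 2 * \<delta>))\<rceil>"

text \<open>Channels are needed for every block length, including \<open>n = 0\<close> with
  \<open>\<delta> = 0\<close>; the fidelity is bounded only for positive \<open>n\<close> and
  \<open>\<delta>\<close>.\<close>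

lemma codes_exist:
  assumes \<delta>: "\<delta> \<ge> 0"
  shows "\<exists>Ks Ls. is_channel (dB^n) (code_dim n \<delta>) Ks \<and> is_channel (m^n * code_dim n \<delta>) (m^n * dB^n) Ls \<and>
     (n > 0 \<longrightarrow> \<delta> > 0 \<longrightarrow> fidelity (omega_ext m p psi dB dR n) (code_output m p psi dB dR n (code_dim n \<delta>) Ks Ls)
       \<ge> 1 - (VB + VBX) / (n * \<delta>\<^sup>2) - 2 * 2 powr (- (n * \<delta>)) - sqrt 2 * 2 powr (- (n * \<delta>) / 2))"
proof -
  define c where "c = code_dim n \<delta>"
  define y where "y = 2 powr (n * ((SB + SBX) / 2 + 2 * \<delta>))"
  define z where "z = 2 powr (n * ((SB - SBX) / 2))"
  define E where "E = nat \<lceil>z\<rceil>"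
  define R where "R = 2 powr (n * (SBX + \<delta>))"
  \<comment> \<open>Chosen so that \<tau>^2 = 2 * 2^(-n \<delta>), which is what the requirement on
    \<open>card T\<close> calls for.\<close>
  define \<tau> where "\<tau> = sqrt 2 * 2 powr (- (n * \<delta>) / 2)"
  have y1: "y \<ge> 1" unfolding y_def using \<delta> SBX_nonneg SBX_le_SB by (intro ge_one_powr_ge_zero) auto
  \<comment> \<open>\<open>SBX_le_SB\<close> enters here: for \<open>z\<close> at least 1 the
    ceiling \<open>E\<close> is at most twice \<open>z\<close>, the origin of the factor 2 in
    \<open>ERc\<close>.\<close>
  have z1: "z \<ge> 1" unfolding z_def using SBX_le_SB by (intro ge_one_powr_ge_zero) auto
  have cy: "real c \<ge> y" unfolding c_def code_dim_def y_def[symmetric] by (rule real_nat_ceiling_ge)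
  have Ez: "real E \<ge> z" "real E \<le> 2 * z"
  proof -
    show "real E \<ge> z" unfolding E_def by (rule real_nat_ceiling_ge)
    have "real E < z + 1" using z1 unfolding E_def by linarith
    then show "real E \<le> 2 * z" using z1 by linarith
  qed
  have cE: "c > 0" "E > 0" using cy Ez y1 z1 by (auto intro!: Nat.gr0I)
  have \<tau>2: "\<tau>\<^sup>2 = 2 * 2 powr (- (n * \<delta>))"
    by (simp add: \<tau>_def power_mult_distrib powr_power)
  have cT: "real (card (Tn n \<delta>)) \<le> 2 powr (n * (SB + \<delta>))"
    by (rule card_typical_le[of "{..<dB^n}" "q_n n"]) (auto simp: Tn_def q_n_sum q_n_nonneg)
  have cJ: "real (card (Jn n \<delta> xi)) \<le> R" if "xi < m ^ n" for xi
    unfolding R_def by (rule card_typical_le[of "{..<dB^n}" "l_n n xi"]) (auto simp: Jn_def l_n_sum[OF that] l_n_nonneg)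
  have "2 * real (card (Tn n \<delta>)) \<le> 2 * (2 powr (- (n * \<delta>)) * (z * y))"
    using cT by (simp add: z_def y_def algebra_simps flip: powr_add) (simp add: field_simps)
  also have "\<dots> \<le> 2 * (2 powr (- (n * \<delta>)) * (real E * real c))"
    using cy Ez y1 z1 by (intro mult_left_mono mult_mono) auto
  finally have card_T: "2 * real (card (Tn n \<delta>)) \<le> \<tau>\<^sup>2 * (real E * real c)" unfolding \<tau>2 by simp
  interpret random_code "m^n" "dB^n" "dR^n" c E "p_n m p n" "psi_n m psi dB dR n" "tensor n dB (\<lambda>_. \<beta>)" "q_n n" "U_n n" "l_n n" "Tn n \<delta>" "Jn n \<delta>" R \<tau>
  proof
    show "unitary (dB^n) (tensor n dB (\<lambda>_. \<beta>))" by (intro tensor_unitary \<beta>)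
    show "\<tau> > 0" by (simp add: \<tau>_def)
    show "dim_vec (psi_n m psi dB dR n xi) = dB^n * dR^n" for xi by (simp add: psi_n_def)
    show "Tn n \<delta> \<subseteq> {..<dB^n}" "Jn n \<delta> xi \<subseteq> {..<dB^n}" for xi by (auto simp: Tn_def Jn_def)
  qed (use p_n_nonneg p_n_sum U_n marginal_n_spectral l_n_nonneg l_n_sum avg_entry_n q_n_nonneg q_n_sum cJ cE card_T in auto)
  have ERc: "real E * R / real c \<le> 2 * 2 powr (- (n * \<delta>))"
  proof -
    have "real E * R / real c \<le> (2 * z) * R / y"
      using Ez cy y1 z1 by (intro frac_le mult_right_mono) (auto simp: R_def)
    \<comment> \<open>The entropies cancel in the exponents, leaving \<delta> - 2 \<delta>.\<close>
    also have "z * R / y = 2 powr (- (n * \<delta>))"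
      unfolding z_def R_def y_def powr_add[symmetric] powr_diff[symmetric]
      by (intro arg_cong[of _ _ "\<lambda>t. 2 powr t"]) (simp add: algebra_simps, simp add: field_simps)
    then have "(2 * z) * R / y = 2 * 2 powr (- (n * \<delta>))" by simp
    finally show ?thesis .
  qed
  obtain Ks Ls where code: "is_channel (dB^n) c Ks" "is_channel (m^n*c) (m^n*dB^n) Ls"
     "fidelity (omega_ext m p psi dB dR n) (code_output m p psi dB dR n c Ks Ls)
     \<ge> (\<Sum>x<m^n. \<Sum>i\<in>Jn n \<delta> x. p_n m p n x * l_n n x i * \<pi> x i) - real E * R / real c - \<tau>"
    using good_code_exists unfolding code_output_def omega_ext_ensemble_state by blast
  have "fidelity (omega_ext m p psi dB dR n) (code_output m p psi dB dR n c Ks Ls)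
       \<ge> 1 - (VB + VBX) / (n * \<delta>\<^sup>2) - 2 * 2 powr (- (n * \<delta>)) - sqrt 2 * 2 powr (- (n * \<delta>) / 2)" if "n > 0" "\<delta> > 0"
    using code(3) typical_mass Tn_tail[OF that] Jn_tail[OF that] ERc
    unfolding \<tau>_def[symmetric] add_divide_distrib by linarith
  then show ?thesis using code(1,2) unfolding c_def by blast
qed

end

section \<open>Entropies of the classical-quantum state and the rate\<close>

lemma eta_nonneg_eq: "x \<ge> 0 \<Longrightarrow> eta x = x * log 2 x"
  by (auto simp: eta_def)

context source
begin

definition XB :: "complex mat" where "XB = ptrace_right (m*dB) dR (omega1 m p psi dB dR)"

lemma XB_entry:
  assumes "x < m" "y < m" "b < dB" "b' < dB"
  shows "XB $$ (x*dB+b, y*dB+b') = (if x = y then complex_of_real (p x) * marginal dB dR (psi x) $$ (b,b') else 0)"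
  unfolding XB_def by (rule omega1_XB_entry[OF psi_dim assms])

lemma vn_entropy_B: "vn_entropy (ptrace_left m dB XB) = SB"
proof -
  have "ptrace_left m dB XB = mat dB dB (\<lambda>ij. \<Sum>x<m. complex_of_real (p x) * marginal dB dR (psi x) $$ ij)"
    by (rule eq_matI) (auto simp: ptrace_left_def XB_entry)
  then have "vn_entropy (ptrace_left m dB XB) = - (\<Sum>b<dB. eta (q b))"
    unfolding \<rho>_avg by (rule vn_entropy_spectral[OF \<beta>])
  then show ?thesis by (simp add: SB_def eta_nonneg_eq q_nonneg)
qed

lemma vn_entropy_X: "vn_entropy (ptrace_right m dB XB) = - (\<Sum>x<m. eta (p x))"
proof -
  have one: "unitary m (1\<^sub>m m)" by (simp add: unitary_def)
  have tr: "(\<Sum>b<dB. marginal dB dR (psi x) $$ (b,b)) = 1" if "x < m" for x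
    using mtrace_ptrace_right_outer[OF psi_dim[OF that]] psi_unit[OF that] by (simp add: mtrace_def)
  have "ptrace_right m dB XB = rdiag m p"
  proof (rule eq_matI)
    fix x y assume "x < dim_row (rdiag m p)" "y < dim_col (rdiag m p)"
    then have xy: "x < m" "y < m" by auto
    have "ptrace_right m dB XB $$ (x,y) = (\<Sum>b<dB. XB $$ (x*dB+b, y*dB+b))"
      using xy by (simp add: ptrace_right_def)
    also have "\<dots> = (\<Sum>b<dB. if x = y then complex_of_real (p x) * marginal dB dR (psi x) $$ (b,b) else 0)"
      using xy by (intro sum.cong refl XB_entry) auto
    also have "\<dots> = rdiag m p $$ (x,y)"
      using xy tr[of x] by (cases "x = y") (simp_all add: mat_diag_def flip: sum_distrib_left)
    finally show "ptrace_right m dB XB $$ (x,y) = rdiag m p $$ (x,y)" .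
  qed auto
  also have "\<dots> = 1\<^sub>m m * rdiag m p * adj (1\<^sub>m m)"
    by (simp add: one_mult_dim)
  finally show ?thesis by (rule vn_entropy_spectral[OF one])
qed

text \<open>The state is block diagonal in \<open>x\<close>. Its eigenbasis \<open>V\<close> has the
  blocks \<open>U x\<close>, and its eigenvalues are the joint weights
  \<open>p x * l x i\<close>.\<close>

lemma vn_entropy_XB: "vn_entropy XB = - (\<Sum>x<m. \<Sum>i<dB. eta (p x * l x i))"
proof -
  define V where "V = mat (m*dB) (m*dB) (\<lambda>(i,j). if i div dB = j div dB then U (i div dB) $$ (i mod dB, j mod dB) else 0)"
  have Vc: "V \<in> carrier_mat (m*dB) (m*dB)" by (simp add: V_def)
  have V_entry: "V $$ (x*dB+b, y*dB+b') = (if x = y then U x $$ (b,b') else 0)" if "x < m" "y < m" "b < dB" "b' < dB" for x y b b'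
  proof -
    have "(x * N + t) div N = x" "(x * N + t) mod N = t" if "t < N" for x N t :: nat
      using that by auto
    note dm = this[OF that(3)] this[OF that(4)]
    show ?thesis using pair_index_less[OF that(1,3)] pair_index_less[OF that(2,4)]
      by (simp only: V_def index_mat prod.case dm)
  qed
  have split: "i = (i div dB) * dB + i mod dB" "i div dB < m" "i mod dB < dB" if "i < m*dB" for i
    using div_mod_less[OF that] by auto
  have uV: "unitary (m*dB) V"
  proof -
    have "adj V * V = 1\<^sub>m (m*dB)"
    proof (rule eq_matI)
      fix i j assume "i < dim_row (1\<^sub>m (m*dB) :: complex mat)" "j < dim_col (1\<^sub>m (m*dB) :: complex mat)"
      then have ij: "i < m*dB" "j < m*dB" by auto
      define x y b b' where "x = i div dB" and "y = j div dB" and "b = i mod dB" and "b' = j mod dB"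
      note si = split[OF ij(1), folded x_def b_def] and sj = split[OF ij(2), folded y_def b'_def]
      have "(adj V * V) $$ (i,j) = (\<Sum>z<m. \<Sum>a<dB. cnj (V $$ (z*dB+a, i)) * V $$ (z*dB+a, j))"
        using ij Vc by (subst mult_entry'[of _ "m*dB" "m*dB" _ "m*dB"]) (auto simp: sum_lessThan_mult[where f = "\<lambda>k. cnj (V $$ (k,i)) * V $$ (k,j)"])
      also have "\<dots> = (\<Sum>z<m. if z = x then (if x = y then (adj (U x) * U x) $$ (b,b') else 0) else 0)"
      proof (rule sum.cong[OF refl])
        fix z assume "z \<in> {..<m}"
        then have z: "z < m" by simp
        have "(\<Sum>a<dB. cnj (V $$ (z*dB+a, i)) * V $$ (z*dB+a, j)) =
           (\<Sum>a<dB. if z = x \<and> x = y then cnj (U x $$ (a,b)) * U x $$ (a,b') else 0)"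
          by (subst si(1), subst sj(1), intro sum.cong refl) (use z si(2,3) sj(2,3) V_entry in auto)
        also have "\<dots> = (if z = x then (if x = y then (adj (U x) * U x) $$ (b,b') else 0) else 0)"
          using si(2,3) sj(3) unitaryD(1,2)[OF U[OF si(2)]] by (auto simp: mult_entry'[of _ dB dB _ dB] simp del: index_mult_mat(1))
        finally show "(\<Sum>a<dB. cnj (V $$ (z*dB+a, i)) * V $$ (z*dB+a, j)) =
           (if z = x then (if x = y then (adj (U x) * U x) $$ (b,b') else 0) else 0)" .
      qed
      also have "\<dots> = (if x = y \<and> b = b' then 1 else 0)"
        using si(2,3) sj(3) unitaryD(3)[OF U[OF si(2)]] by (cases "x = y") simp_all
      also have "\<dots> = 1\<^sub>m (m*dB) $$ (i,j)" 
      proof -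
        have "x = y \<and> b = b' \<longleftrightarrow> i = j" by (metis si(1) sj(1) x_def y_def b_def b'_def)
        then show ?thesis using ij by simp
      qed
      finally show "(adj V * V) $$ (i,j) = 1\<^sub>m (m*dB) $$ (i,j)" .
    qed (use Vc in auto)
    then show ?thesis using Vc by (simp add: unitary_def)
  qed
  define L where "L i = p (i div dB) * l (i div dB) (i mod dB)" for i
  have L: "L (z*dB+a) = p z * l z a" if "a < dB" for z a
  proof -
    have "(x * N + t) div N = x" "(x * N + t) mod N = t" if "t < N" for x N t :: nat
      using that by auto
    from this[OF that] show ?thesis by (simp only: L_def)
  qed
  have "XB = V * rdiag (m*dB) L * adj V"
  proof (rule eq_matI)
    fix i j assume "i < dim_row (V * rdiag (m*dB) L * adj V)" "j < dim_col (V * rdiag (m*dB) L * adj V)"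
    then have ij: "i < m*dB" "j < m*dB" using Vc by auto
    define x y b b' where "x = i div dB" and "y = j div dB" and "b = i mod dB" and "b' = j mod dB"
    note si = split[OF ij(1), folded x_def b_def] and sj = split[OF ij(2), folded y_def b'_def]
    have "(V * rdiag (m*dB) L * adj V) $$ (i,j) = (\<Sum>z<m. \<Sum>a<dB. V $$ (i, z*dB+a) * L (z*dB+a) * cnj (V $$ (j, z*dB+a)))"
      unfolding spectral_entry[OF uV ij] by (rule sum_lessThan_mult)
    also have "\<dots> = (\<Sum>z<m. if z = x then (if x = y then complex_of_real (p x) * marginal dB dR (psi x) $$ (b,b') else 0) else 0)"
    proof (rule sum.cong[OF refl])
      fix z assume "z \<in> {..<m}"
      then have z: "z < m" by simp
      have "(\<Sum>a<dB. V $$ (i, z*dB+a) * L (z*dB+a) * cnj (V $$ (j, z*dB+a))) =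
         (\<Sum>a<dB. if z = x \<and> x = y then complex_of_real (p x) * (U x $$ (b,a) * complex_of_real (l x a) * cnj (U x $$ (b',a))) else 0)"
        by (subst si(1), subst sj(1), intro sum.cong refl) (use z si(2,3) sj(2,3) V_entry L in auto)
      also have "\<dots> = (if z = x then (if x = y then complex_of_real (p x) * marginal dB dR (psi x) $$ (b,b') else 0) else 0)"
        unfolding \<rho>[OF si(2)] spectral_entry[OF U[OF si(2)] si(3) sj(3)] by (simp add: sum_distrib_left)
      finally show "(\<Sum>a<dB. V $$ (i, z*dB+a) * L (z*dB+a) * cnj (V $$ (j, z*dB+a))) =
         (if z = x then (if x = y then complex_of_real (p x) * marginal dB dR (psi x) $$ (b,b') else 0) else 0)" .
    qed
    also have "\<dots> = XB $$ (x*dB+b, y*dB+b')" using XB_entry[OF si(2) sj(2) si(3) sj(3)] si(2) by simp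
    finally show "XB $$ (i,j) = (V * rdiag (m*dB) L * adj V) $$ (i,j)"
      by (simp only: si(1)[symmetric] sj(1)[symmetric])
  qed (use Vc in \<open>auto simp: XB_def\<close>)
  then have "vn_entropy XB = - (\<Sum>i<m*dB. eta (L i))" by (rule vn_entropy_spectral[OF uV])
  then show ?thesis unfolding sum_lessThan_mult by (simp add: L)
qed

text \<open>The chain rule: the logarithm of a joint weight splits, and the part that depends on
  \<open>p x\<close> alone sums to the entropy of \<open>X\<close>.\<close>

lemma conditional_entropy: "vn_entropy XB - vn_entropy (ptrace_right m dB XB) = SBX"
proof -
  have "(\<Sum>i<dB. eta (p x * l x i)) = (\<Sum>i<dB. p x * l x i * log 2 (l x i)) + eta (p x)" if x: "x < m" for x
  proof -
    have "eta (p x * l x i) = p x * l x i * log 2 (l x i) + l x i * eta (p x)" for i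
      using p_nonneg[OF x] l_nonneg[of x i]
      by (cases "p x = 0 \<or> l x i = 0") (auto simp: eta_nonneg_eq log_mult algebra_simps)
    then show ?thesis using l_sum[OF x] by (simp add: sum.distrib flip: sum_distrib_right)
  qed
  then show ?thesis unfolding vn_entropy_XB vn_entropy_X SBX_def by (simp add: sum.distrib)
qed

text \<open>The slack n^(-1/4) tends to 0, while n times its square is sqrt n, so that the Chebyshev
  and the exponential error terms vanish too.\<close>

lemma rate_limit:
  "(\<lambda>n. log 2 (real (code_dim n (real n powr (-1/4)))) / real n) \<longlonglongrightarrow> (SB + SBX) / 2"
proof (rule tendsto_sandwich)
  define H where "H = (SB + SBX) / 2"
  have H: "H \<ge> 0" unfolding H_def using SBX_nonneg SBX_le_SB by simp
  have b: "H + 2 * real n powr (-1/4) \<le> log 2 (real (code_dim n (real n powr (-1/4)))) / real n \<and>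
     log 2 (real (code_dim n (real n powr (-1/4)))) / real n \<le> H + 2 * real n powr (-1/4) + 1 / real n" if n: "n > 0" for n
  proof -
    define a where "a = real n * (H + 2 * real n powr (-1/4))"
    define c where "c = real (code_dim n (real n powr (-1/4)))"
    have a0: "a \<ge> 0" unfolding a_def using H by simp
    have c: "c = real (nat \<lceil>2 powr a\<rceil>)" unfolding c_def code_dim_def a_def H_def ..
    have y1: "2 powr a \<ge> 1" using a0 by (intro ge_one_powr_ge_zero) auto
    have lo: "2 powr a \<le> c" unfolding c by (rule real_nat_ceiling_ge)
    have "c < 2 powr a + 1" using y1 unfolding c by linarith
    \<comment> \<open>Rounding the dimension up costs at most one qubit per block.\<close>
    then have hi: "c \<le> 2 powr (a + 1)" using y1 by (simp add: powr_add)
    have "c > 0" using lo y1 by linarith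
    then have "a \<le> log 2 c" "log 2 c \<le> a + 1" using lo hi by (simp_all add: le_log_iff log_le_iff)
    then show ?thesis unfolding c_def[symmetric] using n by (simp add: a_def field_simps)
  qed
  show "\<forall>\<^sub>F n in sequentially. (SB + SBX) / 2 + 2 * real n powr (-1/4) \<le> log 2 (real (code_dim n (real n powr (-1/4)))) / real n"
    using eventually_gt_at_top[of 0] by eventually_elim (use b in \<open>simp add: H_def\<close>)
  show "\<forall>\<^sub>F n in sequentially. log 2 (real (code_dim n (real n powr (-1/4)))) / real n \<le> (SB + SBX) / 2 + 2 * real n powr (-1/4) + 1 / real n"
    using eventually_gt_at_top[of 0] by eventually_elim (use b in \<open>simp add: H_def\<close>)
  have "(\<lambda>n. 2 * real n powr (-1/4)) \<longlonglongrightarrow> 0" by real_asymp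
  from tendsto_add[OF tendsto_const this]
  show "(\<lambda>n. (SB + SBX) / 2 + 2 * real n powr (-1/4)) \<longlonglongrightarrow> (SB + SBX) / 2" by simp
  have "(\<lambda>n. 2 * real n powr (-1/4) + 1 / real n) \<longlonglongrightarrow> 0" by real_asymp
  from tendsto_add[OF tendsto_const this]
  show "(\<lambda>n. (SB + SBX) / 2 + 2 * real n powr (-1/4) + 1 / real n) \<longlonglongrightarrow> (SB + SBX) / 2"
    by (simp add: add.assoc)
qed

end

theorem theorem5p2:
  fixes m dB dR :: nat and p :: "nat \<Rightarrow> real" and psi :: "nat \<Rightarrow> complex vec"
  assumes p_nonneg: "\<forall>x<m. p x \<ge> 0"
      and p_sum: "(\<Sum>x<m. p x) = 1"
      and psi_dim: "\<forall>x<m. dim_vec (psi x) = dB * dR"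
      and psi_unit: "\<forall>x<m. (\<Sum>i<dB * dR. (cmod (psi x $ i))\<^sup>2) = 1"
  shows "\<exists>(c :: nat \<Rightarrow> nat) (Enc :: nat \<Rightarrow> complex mat list) (Dec :: nat \<Rightarrow> complex mat list) (eps :: nat \<Rightarrow> real).
     (\<forall>n. is_channel (dB^n) (c n) (Enc n)
        \<and> is_channel (m^n * c n) (m^n * dB^n) (Dec n)
        \<and> fidelity (omega_ext m p psi dB dR n) (code_output m p psi dB dR n (c n) (Enc n) (Dec n)) \<ge> 1 - eps n)
     \<and> eps \<longlonglongrightarrow> 0
     \<and> (\<lambda>n. log 2 (real (c n)) / real n) \<longlonglongrightarrow>
         (1/2) * (vn_entropy (ptrace_left m dB (ptrace_right (m*dB) dR (omega1 m p psi dB dR)))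
                 + (vn_entropy (ptrace_right (m*dB) dR (omega1 m p psi dB dR))
                    - vn_entropy (ptrace_right m dB (ptrace_right (m*dB) dR (omega1 m p psi dB dR)))))"
proof -
  let ?\<rho> = "\<lambda>x. ptrace_right dB dR (outer (psi x) (psi x))"
  have psd: "psd (?\<rho> x)" if "x < m" for x using psi_dim that by (intro ptrace_right_outer_psd) auto
  have "\<forall>x. \<exists>U l. x < m \<longrightarrow> unitary dB U \<and> (\<forall>i. l i \<ge> 0) \<and> ?\<rho> x = U * mat_diag dB (\<lambda>i. complex_of_real (l i)) * adj U"
    using psd_spectral[OF psd ptrace_right_carrier] by blast
  then obtain U0 l0 where U0: "\<And>x. x < m \<Longrightarrow> unitary dB (U0 x) \<and> (\<forall>i. l0 x i \<ge> 0) \<and>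
      ?\<rho> x = U0 x * mat_diag dB (\<lambda>i. complex_of_real (l0 x i)) * adj (U0 x)"
    by metis
  \<comment> \<open>\<open>source\<close> asks for nonnegativity at every \<open>x\<close>, so the
    spectra are extended by 0 beyond the alphabet.\<close>
  define l where "l x i = (if x < m then l0 x i else 0)" for x i
  define \<sigma> where "\<sigma> = mat dB dB (\<lambda>ij. \<Sum>x<m. complex_of_real (p x) * ?\<rho> x $$ ij)"
  have \<sigma>: "\<sigma> \<in> carrier_mat dB dB" by (simp add: \<sigma>_def)
  have "adj \<sigma> = \<sigma>"
  proof (rule eq_matI)
    fix i j assume "i < dim_row \<sigma>" "j < dim_col \<sigma>"
    then have ij: "i < dB" "j < dB" using \<sigma> by auto
    have "cnj (?\<rho> x $$ (j,i)) = ?\<rho> x $$ (i,j)" if "x < m" for x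
      using arg_cong[OF psd_hermitian[OF psd[OF that]], of "\<lambda>A. A $$ (i,j)"] ij by (subst (asm) index_adj) auto
    then show "adj \<sigma> $$ (i,j) = \<sigma> $$ (i,j)" using ij by (simp add: \<sigma>_def)
  qed (use \<sigma> in auto)
  then obtain \<beta> q where \<beta>: "unitary dB \<beta>" "\<sigma> = \<beta> * mat_diag dB (\<lambda>i. complex_of_real (q i)) * adj \<beta>"
    using hermitian_spectral[OF \<sigma>] by blast
  interpret source m dB dR p psi U0 l \<beta> q
    by unfold_locales (use assms U0 \<beta> in \<open>auto simp: l_def \<sigma>_def\<close>)
  define \<delta> where "\<delta> n = real n powr (-1/4)" for n :: nat
  define err where "err n = (VB + VBX) / (real n * (\<delta> n)\<^sup>2) + 2 * 2 powr (- (real n * \<delta> n)) + sqrt 2 * 2 powr (- (real n * \<delta> n) / 2)" for n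
  have "\<forall>n. \<exists>Ks Ls. is_channel (dB^n) (code_dim n (\<delta> n)) Ks \<and> is_channel (m^n * code_dim n (\<delta> n)) (m^n * dB^n) Ls \<and>
     (n > 0 \<longrightarrow> fidelity (omega_ext m p psi dB dR n) (code_output m p psi dB dR n (code_dim n (\<delta> n)) Ks Ls) \<ge> 1 - err n)"
  proof
    fix n
    have "\<delta> n \<ge> 0" "n > 0 \<longrightarrow> \<delta> n > 0" by (auto simp: \<delta>_def)
    then show "\<exists>Ks Ls. is_channel (dB^n) (code_dim n (\<delta> n)) Ks \<and> is_channel (m^n * code_dim n (\<delta> n)) (m^n * dB^n) Ls \<and>
     (n > 0 \<longrightarrow> fidelity (omega_ext m p psi dB dR n) (code_output m p psi dB dR n (code_dim n (\<delta> n)) Ks Ls) \<ge> 1 - err n)"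
      using codes_exist[of "\<delta> n" n] unfolding err_def diff_diff_add by (simp only: add.assoc) blast
  qed
  then obtain Enc Dec where code: "\<And>n. is_channel (dB^n) (code_dim n (\<delta> n)) (Enc n)"
     "\<And>n. is_channel (m^n * code_dim n (\<delta> n)) (m^n * dB^n) (Dec n)"
     "\<And>n. n > 0 \<Longrightarrow> fidelity (omega_ext m p psi dB dR n) (code_output m p psi dB dR n (code_dim n (\<delta> n)) (Enc n) (Dec n)) \<ge> 1 - err n"
    by metis
  define F where "F n = fidelity (omega_ext m p psi dB dR n) (code_output m p psi dB dR n (code_dim n (\<delta> n)) (Enc n) (Dec n))" for n
  have "(\<lambda>n. 1 / (real n * (real n powr (-1/4))\<^sup>2)) \<longlonglongrightarrow> 0" by real_asymp
  then have "(\<lambda>n. (VB + VBX) * (1 / (real n * (real n powr (-1/4))\<^sup>2))) \<longlonglongrightarrow> 0"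
    by (rule tendsto_mult_right_zero)
  moreover have "(\<lambda>n. 2 * 2 powr (- (real n * real n powr (-1/4))) + sqrt 2 * 2 powr (- (real n * real n powr (-1/4)) / 2)) \<longlonglongrightarrow> 0"
    by real_asymp
  ultimately have "(\<lambda>n. (VB + VBX) * (1 / (real n * (real n powr (-1/4))\<^sup>2)) +
      (2 * 2 powr (- (real n * real n powr (-1/4))) + sqrt 2 * 2 powr (- (real n * real n powr (-1/4)) / 2))) \<longlonglongrightarrow> 0 + 0"
    by (rule tendsto_add)
  then have "err \<longlonglongrightarrow> 0" unfolding err_def \<delta>_def by (simp add: add.assoc)
  then have err: "(\<lambda>n. \<bar>err n\<bar>) \<longlonglongrightarrow> 0" by (rule tendsto_rabs_zero)
  \<comment> \<open>The actual infidelity, cut off at 0, serves as error: it is valid at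
    \<open>n = 0\<close> too, where \<open>err\<close> bounds nothing, and \<open>err\<close>
    dominates it from \<open>n = 1\<close> on.\<close>
  have "(\<lambda>n. max 0 (1 - F n)) \<longlonglongrightarrow> 0"
  proof (rule tendsto_sandwich[OF _ _ tendsto_const err])
    show "\<forall>\<^sub>F n in sequentially. max 0 (1 - F n) \<le> \<bar>err n\<bar>"
      using eventually_gt_at_top[of 0]
    proof eventually_elim
      case (elim n)
      then show ?case using code(3)[of n] by (auto simp: F_def)
    qed
  qed auto
  moreover have "(\<lambda>n. log 2 (real (code_dim n (\<delta> n))) / real n) \<longlonglongrightarrow> (1/2) * (SB + SBX)"
    using rate_limit unfolding \<delta>_def by simp
  ultimately show ?thesis
    unfolding XB_def[symmetric] vn_entropy_B conditional_entropy
    using code(1,2) by (intro exI[of _ "\<lambda>n. code_dim n (\<delta> n)"] exI[of _ Enc] exI[of _ Dec] exI[of _ "\<lambda>n. max 0 (1 - F n)"])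
      (auto simp: F_def)
qed

end
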